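(* Let $n \ge 4$ be an integer. There exist a polynomial $p(q) \in \mathbb{Z}[q]$ and, for each isomorphism class $h$ of hyperfigurations on at most $n$ points, a polynomial $p_h(q) \in \mathbb{Z}[q]$ such that for every prime power $q$ $$C_{n,4}(q) = p(q) + \sum_{h} p_h(q)\, A_h(4,q),$$ where the sum runs over all isomorphism classes $h$ of hyperfigurations on at most $n$ points. Moreover, there is an algorithm that produces $p(q)$ and $p_h(q)$ for each isomorphism class $h$.
   Context: $\mathbb{P}^3(\mathbb{F}_q)$ is projective 3-space over the finite field $\mathbb{F}_q$. An $n$-arc in $\mathbb{P}^3(\mathbb{F}_q)$ is a set of $n$ points no $4$ of which lie on a plane; $C_{n,4}(q)$ is the number of ordered $n$-arcs in $\mathbb{P}^3(\mathbb{F}_q)$. The polynomials depend on $n$ but not on $q$. A linear space $(\mathcal{P},\mathcal{L})$ is a (finite) set $\mathcal{P}$ of points and a set $\mathcal{L}$ of subsets of $\mathcal{P}$ called lines, such that any two distinct points belong to exactly one line and every line contains at least 2 points. A planar space is a triple $(\mathcal{P},\mathcal{L},\mathcal{H})$ with $\mathcal{L},\mathcal{H}\subseteq 2^{\mathcal{P}}$ (elements of $\mathcal{H}$ are called planes) such that $(\mathcal{P},\mathcal{L})$ is a linear space and any three distinct non-collinear points lie on a unique plane. Planes are subspaces: a plane containing two distinct points of a line contains that line. Every plane contains three non-collinear points, except that if all points of $\mathcal{P}$ are collinear one sets $\mathcal{H}=\{\mathcal{P}\}$. Thus planar spaces on $n\geq 2$ points correspond to simple matroids of rank at most 4 on $n$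 elements. Two planar spaces are isomorphic if there is a bijection of their point sets preserving lines and planes. A strong realization of a planar space $f=(\mathcal{P},\mathcal{L},\mathcal{H})$ in $\mathbb{P}^3(\mathbb{F}_q)$ is an injective map $\sigma:\mathcal{P}\to\mathbb{P}^3(\mathbb{F}_q)$ such that each subset $Q\subseteq\mathcal{P}$ (1) is contained in a line of $f$ if and only if $\sigma(Q)$ is contained in a line of $\mathbb{P}^3(\mathbb{F}_q)$, and (2) is contained in a plane of $f$ if and only if $\sigma(Q)$ is contained in a plane of $\mathbb{P}^3(\mathbb{F}_q)$. $A_f(4,q)$ denotes the number of strong realizations of $f$ in $\mathbb{P}^3(\mathbb{F}_q)$; it depends only on the isomorphism class of $f$. A full line is a line with at least 3 points; a full plane is a plane with at least 4 points. A point has index $(i,j)$ if it lies on exactly $i$ full planes and exactly $j$ full lines. A hyperfiguration is a planar space such that the index $(i,j)$ of every point satisfies at least one of: $i\ge 4$; $j\ge 3$; $(i,j)=(3,0)$. *)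

theory Defs
  imports
    "HOL-Algebra.Ring"
    "HOL-Library.FuncSet"
    "HOL-Library.Nat_Bijection"
    "HOL-Computational_Algebra.Polynomial"
    "HOL-Number_Theory.Prime_Powers"
begin

section \<open>Projective 3-space over a field\<close>

definition vectors4 :: "('a, 'm) ring_scheme \<Rightarrow> (nat \<Rightarrow> 'a) set" where
  "vectors4 R = {..<4} \<rightarrow>\<^sub>E carrier R"

definition lin_comb4 ::
    "('a, 'm) ring_scheme \<Rightarrow> nat \<Rightarrow> (nat \<Rightarrow> 'a) \<Rightarrow> (nat \<Rightarrow> nat \<Rightarrow> 'a) \<Rightarrow> nat \<Rightarrow> 'a" where
  "lin_comb4 R k c v = (\<lambda>j\<in>{..<4}. \<Oplus>\<^bsub>R\<^esub>i\<in>{..<k}. c i \<otimes>\<^bsub>R\<^esub> v i j)"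

definition lin_indep4 :: "('a, 'm) ring_scheme \<Rightarrow> nat \<Rightarrow> (nat \<Rightarrow> nat \<Rightarrow> 'a) \<Rightarrow> bool" where
  "lin_indep4 R k v \<longleftrightarrow>
     (\<forall>c \<in> {..<k} \<rightarrow> carrier R.
        lin_comb4 R k c v = (\<lambda>j\<in>{..<4}. \<zero>\<^bsub>R\<^esub>) \<longrightarrow> (\<forall>i<k. c i = \<zero>\<^bsub>R\<^esub>))"

text \<open>A field \<open>F\<^sub>q\<close> is represented by an arbitrary field record \<open>R\<close> with \<open>q\<close> elements. Such a field
  is unique up to isomorphism and has a copy with carrier in \<^typ>\<open>nat\<close>; unlike a type class field,
  it can be quantified inside the scope of the polynomials, which must not depend on \<open>q\<close>.\<close>

text \<open>The \<open>k\<close>-dimensional linear subspaces of \<open>R\<^sup>4\<close>.\<close>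

definition subspaces4 :: "('a, 'm) ring_scheme \<Rightarrow> nat \<Rightarrow> (nat \<Rightarrow> 'a) set set" where
  "subspaces4 R k =
     {{lin_comb4 R k c v | c. c \<in> {..<k} \<rightarrow> carrier R} | v.
        v \<in> {..<k} \<rightarrow> vectors4 R \<and> lin_indep4 R k v}"

text \<open>A point of projective space is a linear subspace, so incidence of a point with a line or
  plane is inclusion of subspaces.\<close>

abbreviation proj_points where "proj_points R \<equiv> subspaces4 R 1"
abbreviation proj_lines where "proj_lines R \<equiv> subspaces4 R 2"
abbreviation proj_planes where "proj_planes R \<equiv> subspaces4 R 3"

definition ordered_arcs :: "('a, 'm) ring_scheme \<Rightarrow> nat \<Rightarrow> (nat \<Rightarrow> 'a) set list set" where
  "ordered_arcs R n =
     {xs. length xs = n \<and> distinct xs \<and> set xs \<subseteq> proj_points R \<and>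
        (\<forall>T \<subseteq> set xs. card T = 4 \<longrightarrow> \<not> (\<exists>W \<in> proj_planes R. \<forall>x\<in>T. x \<subseteq> W))}"

text \<open>The number \<open>C\<^bsub>n,4\<^esub>(q)\<close>, for a field \<open>R\<close> of order \<open>q\<close>.\<close>

definition num_arcs :: "('a, 'm) ring_scheme \<Rightarrow> nat \<Rightarrow> nat" where
  "num_arcs R n = card (ordered_arcs R n)"


section \<open>Planar spaces\<close>

text \<open>A triple of points, lines and planes.\<close>

type_synonym 'p pspace = "'p set \<times> 'p set set \<times> 'p set set"

definition linear_space :: "'p set \<Rightarrow> 'p set set \<Rightarrow> bool" where
  "linear_space P L \<longleftrightarrow>
     finite P \<and> L \<subseteq> Pow P \<and>
     (\<forall>x\<in>P. \<forall>y\<in>P. x \<noteq> y \<longrightarrow> (\<exists>!l. l \<in> L \<and> x \<in> l \<and> y \<in> l)) \<and>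
     (\<forall>l\<in>L. card l \<ge> 2)"

definition noncollinear3 :: "'p set set \<Rightarrow> 'p \<Rightarrow> 'p \<Rightarrow> 'p \<Rightarrow> bool" where
  "noncollinear3 L x y z \<longleftrightarrow>
     x \<noteq> y \<and> x \<noteq> z \<and> y \<noteq> z \<and> \<not> (\<exists>l\<in>L. {x, y, z} \<subseteq> l)"

text \<open>For \<open>card P \<ge> 2\<close> the condition of the last conditional fails precisely when some line
  contains all of \<open>P\<close>; in the degenerate cases \<open>card P \<le> 1\<close> (where there are no lines) the points
  count as collinear.\<close>

fun planar_space :: "'p pspace \<Rightarrow> bool" where
  "planar_space (P, L, H) \<longleftrightarrow>
     linear_space P L \<and> H \<subseteq> Pow P \<and>
     (\<forall>x\<in>P. \<forall>y\<in>P. \<forall>z\<in>P. noncollinear3 L x y z \<longrightarrow>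
        (\<exists>!h. h \<in> H \<and> {x, y, z} \<subseteq> h)) \<and>
     (\<forall>h\<in>H. \<forall>l\<in>L. \<forall>x \<in> h \<inter> l. \<forall>y \<in> h \<inter> l. x \<noteq> y \<longrightarrow> l \<subseteq> h) \<and>
     (if \<exists>x\<in>P. \<exists>y\<in>P. \<exists>z\<in>P. noncollinear3 L x y z
      then \<forall>h\<in>H. \<exists>x\<in>h. \<exists>y\<in>h. \<exists>z\<in>h. noncollinear3 L x y z
      else H = {P})"

fun pspace_iso :: "'p pspace \<Rightarrow> 'r pspace \<Rightarrow> bool" where
  "pspace_iso (P, L, H) (P', L', H') \<longleftrightarrow>
     (\<exists>\<phi>. bij_betw \<phi> P P' \<and> (\<lambda>l. \<phi> ` l) ` L = L' \<and> (\<lambda>h. \<phi> ` h) ` H = H')"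

fun strong_realizations ::
    "('a, 'm) ring_scheme \<Rightarrow> 'p pspace \<Rightarrow> ('p \<Rightarrow> (nat \<Rightarrow> 'a) set) set" where
  "strong_realizations R (P, L, H) =
     {\<sigma>. \<sigma> \<in> P \<rightarrow>\<^sub>E proj_points R \<and> inj_on \<sigma> P \<and>
        (\<forall>Q\<subseteq>P.
           ((\<exists>l\<in>L. Q \<subseteq> l) \<longleftrightarrow> (\<exists>W \<in> proj_lines R. \<forall>x\<in>Q. \<sigma> x \<subseteq> W)) \<and>
           ((\<exists>h\<in>H. Q \<subseteq> h) \<longleftrightarrow> (\<exists>W \<in> proj_planes R. \<forall>x\<in>Q. \<sigma> x \<subseteq> W)))}"

text \<open>The number \<open>A\<^sub>f(4,q)\<close>, for a field \<open>R\<close> of order \<open>q\<close>.\<close>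

definition num_realizations :: "('a, 'm) ring_scheme \<Rightarrow> 'p pspace \<Rightarrow> nat" where
  "num_realizations R f = card (strong_realizations R f)"

definition full_line_index :: "'p set set \<Rightarrow> 'p \<Rightarrow> nat" where
  "full_line_index L x = card {l \<in> L. x \<in> l \<and> card l \<ge> 3}"

definition full_plane_index :: "'p set set \<Rightarrow> 'p \<Rightarrow> nat" where
  "full_plane_index H x = card {h \<in> H. x \<in> h \<and> card h \<ge> 4}"

fun hyperfiguration :: "'p pspace \<Rightarrow> bool" where
  "hyperfiguration (P, L, H) \<longleftrightarrow>
     planar_space (P, L, H) \<and>
     (\<forall>x\<in>P. full_plane_index H x \<ge> 4 \<or> full_line_index L x \<ge> 3 \<or>
        (full_plane_index H x = 3 \<and> full_line_index L x = 0))"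

text \<open>Every finite planar space is isomorphic to one with point set \<open>{..<m}\<close>, so isomorphism
  classes are taken among these.\<close>

definition std_hyperfigurations :: "nat \<Rightarrow> nat pspace set" where
  "std_hyperfigurations n = {f. hyperfiguration f \<and> (\<exists>m\<le>n. fst f = {..<m})}"

definition hyperfiguration_classes :: "nat \<Rightarrow> nat pspace set set" where
  "hyperfiguration_classes n =
     std_hyperfigurations n //
       {(f, g). f \<in> std_hyperfigurations n \<and> g \<in> std_hyperfigurations n \<and> pspace_iso f g}"

text \<open>The number of strong realizations is constant on an isomorphism class; this is the
  common value.\<close>

definition class_realizations :: "('a, 'm) ring_scheme \<Rightarrow> 'p pspace set \<Rightarrow> nat" where
  "class_realizations R h = the_elem (num_realizations R ` h)"


section \<open>Algorithms\<close>

text \<open>\<open>total_recursive k f\<close>: the restriction of \<open>f\<close> to lists of length \<open>k\<close> is a total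
  (general) recursive function \<open>\<nat>\<^sup>k \<rightarrow> \<nat>\<close> in the sense of Kleene: the smallest class closed under
  composition, primitive recursion and minimization of regular functions. By Kleene's normal form
  theorem these are precisely the functions computed by an everywhere terminating algorithm.\<close>

inductive total_recursive :: "nat \<Rightarrow> (nat list \<Rightarrow> nat) \<Rightarrow> bool" where
  zero: "total_recursive k (\<lambda>xs. 0)"
| succ: "total_recursive 1 (\<lambda>xs. Suc (xs ! 0))"
| proj: "i < k \<Longrightarrow> total_recursive k (\<lambda>xs. xs ! i)"
| comp: "total_recursive (length fs) g \<Longrightarrow> (\<And>f. f \<in> set fs \<Longrightarrow> total_recursive k f) \<Longrightarrow>
    total_recursive k (\<lambda>xs. g (map (\<lambda>f. f xs) fs))"
| prim_rec: "total_recursive k f \<Longrightarrow> total_recursive (k + 2) g \<Longrightarrow>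
    total_recursive (Suc k)
      (\<lambda>xs. rec_nat (f (tl xs)) (\<lambda>i r. g (i # r # tl xs)) (hd xs))"
| minim: "total_recursive (Suc k) f \<Longrightarrow> (\<And>xs. length xs = k \<Longrightarrow> \<exists>y. f (y # xs) = 0) \<Longrightarrow>
    total_recursive k (\<lambda>xs. LEAST y. f (y # xs) = 0)"
| restrict: "total_recursive k f \<Longrightarrow> (\<And>xs. length xs = k \<Longrightarrow> g xs = f xs) \<Longrightarrow> total_recursive k g"

definition poly_code :: "int poly \<Rightarrow> nat" where
  "poly_code p = list_encode (map int_encode (coeffs p))"

fun pspace_code :: "nat pspace \<Rightarrow> nat" where
  "pspace_code (P, L, H) =
     prod_encode (set_encode P,
       prod_encode (set_encode (set_encode ` L), set_encode (set_encode ` H)))"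

end

theory Submission
  imports Defs "HOL-Algebra.Module"
begin

text \<open>
  Call two injective maps into projective space of the same type if the same sets of points become
  collinear and the same become coplanar. Every injective map realizes exactly one planar space,
  so \<open>C\<^bsub>n,4\<^esub>\<close> is a sum of numbers \<open>A\<^sub>f\<close>. If \<open>f\<close> is not a hyperfiguration, it has a point \<open>x\<close> such
  that, for every realization of \<open>f - x\<close>, the positions of \<open>x\<close> satisfying the constraints of its
  full lines and planes form a projective subspace whose dimension \<open>k\<close> depends on \<open>f\<close> only. Such a
  position is occupied by another point, or else the extended map realizes \<open>f\<close> or a degeneration \<open>g\<close>
  of \<open>f\<close> with \<open>g - x = f - x\<close>. Hence
  \<open>A\<^sub>f = (1 + q + \<dots> + q\<^sup>k - c) A\<^bsub>f-x\<^esub> - \<Sum>\<^sub>g A\<^sub>g\<close>, and iterating this leaves only hyperfigurations and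
  the empty space.

  Each coefficient is a signed number of chains of expansion steps. A chain of bounded length with
  bounded entries is the digit sequence of a bounded number, so these counts are total recursive.
\<close>

section \<open>Linear subspaces of the four-dimensional space\<close>

text \<open>The index conditions exclude dependence on the realization. Once \<open>x\<close> is
  removed, three coplanar full lines through it need not be concurrent, four planes need not have a
  common point, and three planes without a full line through \<open>x\<close> may meet in a point or
  in a line. Below these thresholds \<open>k\<close> is forced: among at most three full planes at
  most one fails to contain a given full line, and of two full lines every full plane contains at
  least one. The number \<open>c\<close> of occupied admissible positions depends on
  \<open>f\<close> alone as well, because the incidences of the other points belong to the type of
  \<open>f - x\<close>. Termination has two sources: a deletion lowers the number of points, and a
  proper degeneration on the same points has strictly more dependent sets. Dimension is handled by
  counting throughout: a linear subspace has dimension \<open>k\<close> exactly if it has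
  \<open>q^k\<close> elements, so the dimension formula and the number of points of a subspace
  become statements about cardinalities. The field is a record in a locale rather than a type, so
  that the final polynomials can be fixed before the field is chosen.\<close>

locale finite_field4 = field R for R :: "('a, 'm) ring_scheme" (structure) +
  assumes finite_carrier: "finite (carrier R)"
begin

section \<open>The vector space of coordinate quadruples\<close>

definition V4 :: "('a, nat \<Rightarrow> 'a) module" where
  "V4 = \<lparr>carrier = vectors4 R, monoid.mult = (\<lambda>u v. undefined), one = undefined,
     zero = (\<lambda>j\<in>{..<4}. \<zero>), add = (\<lambda>u v. \<lambda>j\<in>{..<4}. u j \<oplus> v j),
     smult = (\<lambda>c v. \<lambda>j\<in>{..<4}. c \<otimes> v j)\<rparr>"

lemma carrier_V4: "carrier V4 = vectors4 R"
  by (simp add: V4_def)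

lemma vectors4_eqI:
  assumes "u \<in> vectors4 R" "v \<in> vectors4 R" "\<And>j. j < 4 \<Longrightarrow> u j = v j"
  shows "u = v"
  using assms unfolding vectors4_def by (intro PiE_ext[of u _ _ v]) auto

lemma vectors4_in: "u \<in> vectors4 R \<Longrightarrow> j < 4 \<Longrightarrow> u j \<in> carrier R"
  by (auto simp: vectors4_def)

lemma V4_simps:
  "j < 4 \<Longrightarrow> (u \<oplus>\<^bsub>V4\<^esub> v) j = u j \<oplus> v j"
  "j < 4 \<Longrightarrow> (c \<odot>\<^bsub>V4\<^esub> v) j = c \<otimes> v j"
  "j < 4 \<Longrightarrow> \<zero>\<^bsub>V4\<^esub> j = \<zero>"
  by (simp_all add: V4_def)

lemma V4_closed:
  "u \<in> vectors4 R \<Longrightarrow> v \<in> vectors4 R \<Longrightarrow> u \<oplus>\<^bsub>V4\<^esub> v \<in> vectors4 R"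
  "c \<in> carrier R \<Longrightarrow> v \<in> vectors4 R \<Longrightarrow> c \<odot>\<^bsub>V4\<^esub> v \<in> vectors4 R"
  "\<zero>\<^bsub>V4\<^esub> \<in> vectors4 R"
  by (auto simp: V4_def vectors4_def)

lemma V4_abelian_group: "abelian_group V4"
proof (rule abelian_groupI, unfold carrier_V4)
  fix x assume x: "x \<in> vectors4 R"
  have y: "(\<ominus> \<one>) \<odot>\<^bsub>V4\<^esub> x \<in> vectors4 R" using x by (simp add: V4_closed)
  moreover have "(\<ominus> \<one>) \<odot>\<^bsub>V4\<^esub> x \<oplus>\<^bsub>V4\<^esub> x = \<zero>\<^bsub>V4\<^esub>"
    using x y by (intro vectors4_eqI V4_closed) (simp_all add: V4_simps vectors4_in l_minus l_neg)
  ultimately show "\<exists>y\<in>vectors4 R. y \<oplus>\<^bsub>V4\<^esub> x = \<zero>\<^bsub>V4\<^esub>" by blast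
qed (auto intro!: vectors4_eqI simp: V4_closed V4_simps vectors4_in a_ac)

lemma V4_module: "module R V4"
  by (rule moduleI[OF is_cring V4_abelian_group], unfold carrier_V4)
    (auto intro!: vectors4_eqI simp: V4_closed V4_simps vectors4_in m_assoc l_distr r_distr)

end

sublocale finite_field4 \<subseteq> V: module R V4
  by (rule V4_module)

context finite_field4
begin

lemma finite_vectors4: "finite (carrier V4)"
  unfolding carrier_V4 vectors4_def by (intro finite_PiE) (auto simp: finite_carrier)

lemma card_vectors4: "card (carrier V4) = card (carrier R) ^ 4"
  unfolding carrier_V4 vectors4_def by (simp add: card_PiE)

text \<open>A base of at least 2 makes \<open>q^k\<close> injective in \<open>k\<close>, which is
  what allows cardinalities to stand for dimensions.\<close>

lemma card_carrier_ge_2: "2 \<le> card (carrier R)"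
proof -
  have "card {\<zero>, \<one>} \<le> card (carrier R)"
    using finite_carrier by (intro card_mono) auto
  then show ?thesis by simp
qed

lemma lin_comb4_0: "lin_comb4 R 0 c v = \<zero>\<^bsub>V4\<^esub>"
  by (simp add: lin_comb4_def V4_def)

text \<open>Trades the coordinatewise finite sums for a recursion on the number of vectors, so that
  later facts about combinations are inductions inside the module.\<close>

lemma lin_comb4_Suc:
  assumes "c \<in> {..<Suc k} \<rightarrow> carrier R" "v \<in> {..<Suc k} \<rightarrow> carrier V4"
  shows "lin_comb4 R (Suc k) c v = lin_comb4 R k c v \<oplus>\<^bsub>V4\<^esub> c k \<odot>\<^bsub>V4\<^esub> v k"
proof -
  have "(\<Oplus>i\<in>{..<Suc k}. c i \<otimes> v i j) = (\<Oplus>i\<in>{..<k}. c i \<otimes> v i j) \<oplus> c k \<otimes> v k j" if "j < 4" for j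
  proof -
    have v: "v i j \<in> carrier R" if "i < Suc k" for i
      using that \<open>j < 4\<close> assms by (intro vectors4_in) (auto simp: carrier_V4 Pi_iff)
    have c: "c i \<in> carrier R" if "i < Suc k" for i
      using that assms by (auto simp: Pi_iff)
    show ?thesis unfolding lessThan_Suc
      by (subst finsum_insert) (auto simp: v c a_comm)
  qed
  then show ?thesis
    by (auto simp: lin_comb4_def V4_def fun_eq_iff restrict_def)
qed

lemma lin_comb4_closed:
  assumes "c \<in> {..<k} \<rightarrow> carrier R" "v \<in> {..<k} \<rightarrow> carrier V4"
  shows "lin_comb4 R k c v \<in> carrier V4"
  using assms
proof (induction k)
  case (Suc k)
  have "lin_comb4 R k c v \<in> carrier V4" by (rule Suc.IH) (use Suc.prems in \<open>auto simp: Pi_iff\<close>)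
  with Suc.prems show ?case by (subst lin_comb4_Suc) (auto simp: Pi_iff)
qed (simp add: lin_comb4_0)

lemma lin_comb4_add:
  assumes "c \<in> {..<k} \<rightarrow> carrier R" "d \<in> {..<k} \<rightarrow> carrier R" "v \<in> {..<k} \<rightarrow> carrier V4"
  shows "lin_comb4 R k (\<lambda>i. c i \<oplus> d i) v = lin_comb4 R k c v \<oplus>\<^bsub>V4\<^esub> lin_comb4 R k d v"
  using assms
proof (induction k)
  case (Suc k)
  have "lin_comb4 R k c v \<in> carrier V4" "lin_comb4 R k d v \<in> carrier V4"
    using Suc.prems by (auto intro!: lin_comb4_closed)
  moreover have "c k \<in> carrier R" "d k \<in> carrier R" "v k \<in> carrier V4" using Suc.prems by auto
  moreover have "lin_comb4 R k (\<lambda>i. c i \<oplus> d i) v = lin_comb4 R k c v \<oplus>\<^bsub>V4\<^esub> lin_comb4 R k d v"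
    by (rule Suc.IH) (use Suc.prems in \<open>auto simp: Pi_iff\<close>)
  ultimately show ?case using Suc.prems
    by (simp add: lin_comb4_Suc Pi_iff V.smult_l_distr V.M.a_ac)
qed (simp add: lin_comb4_0)

lemma lin_comb4_smult:
  assumes "a \<in> carrier R" "c \<in> {..<k} \<rightarrow> carrier R" "v \<in> {..<k} \<rightarrow> carrier V4"
  shows "lin_comb4 R k (\<lambda>i. a \<otimes> c i) v = a \<odot>\<^bsub>V4\<^esub> lin_comb4 R k c v"
  using assms
proof (induction k)
  case (Suc k)
  have "lin_comb4 R k c v \<in> carrier V4"
    using Suc.prems by (auto intro!: lin_comb4_closed)
  moreover have "c k \<in> carrier R" "v k \<in> carrier V4" using Suc.prems by auto
  moreover have "lin_comb4 R k (\<lambda>i. a \<otimes> c i) v = a \<odot>\<^bsub>V4\<^esub> lin_comb4 R k c v"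
    by (rule Suc.IH) (use Suc.prems in \<open>auto simp: Pi_iff\<close>)
  ultimately show ?case using Suc.prems
    by (simp add: lin_comb4_Suc Pi_iff V.smult_r_distr V.smult_assoc1)
qed (simp add: lin_comb4_0)

lemma lin_comb4_cong:
  "(\<And>i. i < k \<Longrightarrow> c i = d i) \<Longrightarrow> (\<And>i. i < k \<Longrightarrow> u i = v i) \<Longrightarrow> c \<in> {..<k} \<rightarrow> carrier R \<Longrightarrow>
     v \<in> {..<k} \<rightarrow> carrier V4 \<Longrightarrow> lin_comb4 R k c u = lin_comb4 R k d v"
proof (induction k)
  case (Suc k)
  have "lin_comb4 R k c u = lin_comb4 R k d v"
    by (rule Suc.IH) (use Suc.prems in \<open>auto simp: Pi_iff\<close>)
  moreover have "d \<in> {..<Suc k} \<rightarrow> carrier R" "u \<in> {..<Suc k} \<rightarrow> carrier V4"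
    using Suc.prems by (auto simp: Pi_iff)
  ultimately show ?case using Suc.prems(1,2) Suc.prems(3,4) by (simp add: lin_comb4_Suc)
qed (simp add: lin_comb4_0)

section \<open>Linear subspaces and their dimension by counting\<close>

definition lin :: "(nat \<Rightarrow> 'a) set \<Rightarrow> bool" where
  "lin U \<longleftrightarrow> U \<subseteq> carrier V4 \<and> \<zero>\<^bsub>V4\<^esub> \<in> U \<and> (\<forall>u\<in>U. \<forall>v\<in>U. u \<oplus>\<^bsub>V4\<^esub> v \<in> U) \<and>
     (\<forall>c\<in>carrier R. \<forall>u\<in>U. c \<odot>\<^bsub>V4\<^esub> u \<in> U)"

lemma lin_carrier: "lin (carrier V4)"
  by (auto simp: lin_def)

lemma lin_Int: "lin U \<Longrightarrow> lin W \<Longrightarrow> lin (U \<inter> W)"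
  by (auto simp: lin_def)

lemma lin_finite: "lin U \<Longrightarrow> finite U"
  using finite_vectors4 by (auto simp: lin_def intro: finite_subset)

lemma lin_uminus: "lin U \<Longrightarrow> u \<in> U \<Longrightarrow> \<ominus>\<^bsub>V4\<^esub> u \<in> U"
proof -
  assume *: "lin U" "u \<in> U"
  then have "(\<ominus> \<one>) \<odot>\<^bsub>V4\<^esub> u \<in> U" by (auto simp: lin_def)
  moreover have "(\<ominus> \<one>) \<odot>\<^bsub>V4\<^esub> u = \<ominus>\<^bsub>V4\<^esub> u"
    using * by (subst V.smult_l_minus) (auto simp: lin_def)
  ultimately show ?thesis by simp
qed

lemma lin_minus: "lin U \<Longrightarrow> u \<in> U \<Longrightarrow> v \<in> U \<Longrightarrow> u \<ominus>\<^bsub>V4\<^esub> v \<in> U"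
  unfolding V.M.minus_eq using lin_uminus[of U v] by (auto simp: lin_def)

lemma lin_comb4_in_lin:
  assumes "lin U" "c \<in> {..<k} \<rightarrow> carrier R" "v \<in> {..<k} \<rightarrow> U"
  shows "lin_comb4 R k c v \<in> U"
  using assms
proof (induction k)
  case (Suc k)
  have "v \<in> {..<Suc k} \<rightarrow> carrier V4" using Suc.prems by (auto simp: lin_def)
  then show ?case using Suc by (subst lin_comb4_Suc) (auto simp: lin_def Pi_iff)
qed (simp add: lin_comb4_0 lin_def)

definition span4 :: "nat \<Rightarrow> (nat \<Rightarrow> nat \<Rightarrow> 'a) \<Rightarrow> (nat \<Rightarrow> 'a) set" where
  "span4 k v = {lin_comb4 R k c v | c. c \<in> {..<k} \<rightarrow> carrier R}"

lemma lin_span4: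
  assumes v: "v \<in> {..<k} \<rightarrow> carrier V4"
  shows "lin (span4 k v)"
  unfolding lin_def
proof (intro conjI ballI)
  show "span4 k v \<subseteq> carrier V4" using v by (auto simp: span4_def intro!: lin_comb4_closed)
  have "lin_comb4 R k (\<lambda>i. \<zero> \<otimes> \<zero>) v = \<zero> \<odot>\<^bsub>V4\<^esub> lin_comb4 R k (\<lambda>i. \<zero>) v"
    using v by (intro lin_comb4_smult) auto
  also have "\<dots> = \<zero>\<^bsub>V4\<^esub>" using v by (auto intro!: V.smult_l_null lin_comb4_closed)
  finally show "\<zero>\<^bsub>V4\<^esub> \<in> span4 k v" unfolding span4_def by (auto intro!: exI[of _ "\<lambda>i. \<zero> \<otimes> \<zero>"])
next
  fix x y assume "x \<in> span4 k v" "y \<in> span4 k v"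
  then show "x \<oplus>\<^bsub>V4\<^esub> y \<in> span4 k v" using v unfolding span4_def
    by (force simp: lin_comb4_add[symmetric] Pi_iff)
next
  fix a x assume "a \<in> carrier R" "x \<in> span4 k v"
  then show "a \<odot>\<^bsub>V4\<^esub> x \<in> span4 k v" using v unfolding span4_def
    by (force simp: lin_comb4_smult[symmetric] Pi_iff)
qed

text \<open>Independence makes the combination injective in its coefficient vector, and there are
  \<open>q^k\<close> extensional coefficient vectors.\<close>

lemma card_span4:
  assumes v: "v \<in> {..<k} \<rightarrow> carrier V4" and ind: "lin_indep4 R k v"
  shows "card (span4 k v) = card (carrier R) ^ k"
proof -
  have "inj_on (\<lambda>c. lin_comb4 R k c v) ({..<k} \<rightarrow>\<^sub>E carrier R)"
  proof (rule inj_onI)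
    fix c d assume c: "c \<in> {..<k} \<rightarrow>\<^sub>E carrier R" and d: "d \<in> {..<k} \<rightarrow>\<^sub>E carrier R"
      and eq: "lin_comb4 R k c v = lin_comb4 R k d v"
    have c': "c \<in> {..<k} \<rightarrow> carrier R" and d': "d \<in> {..<k} \<rightarrow> carrier R" using c d by auto
    have cl: "lin_comb4 R k d v \<in> carrier V4" by (intro lin_comb4_closed d' v)
    \<comment> \<open>The difference of the two coefficient vectors is written as
      \<open>c + (-1) d\<close>, which reduces it to the sum and scalar laws for
      combinations.\<close>
    have "lin_comb4 R k (\<lambda>i. c i \<oplus> \<ominus> \<one> \<otimes> d i) v
        = lin_comb4 R k c v \<oplus>\<^bsub>V4\<^esub> (\<ominus> \<one>) \<odot>\<^bsub>V4\<^esub> lin_comb4 R k d v"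
      using c' d' v by (subst lin_comb4_add) (auto simp: lin_comb4_smult Pi_iff)
    also have "\<dots> = \<zero>\<^bsub>V4\<^esub>"
      unfolding eq using cl by (subst V.smult_l_minus) (auto simp: V.M.r_neg)
    finally have "lin_comb4 R k (\<lambda>i. c i \<oplus> \<ominus> \<one> \<otimes> d i) v = (\<lambda>j\<in>{..<4}. \<zero>)"
      by (simp add: V4_def)
    then have z: "\<forall>i<k. c i \<oplus> \<ominus> \<one> \<otimes> d i = \<zero>"
      using ind c' d' unfolding lin_indep4_def by (auto simp: Pi_iff)
    show "c = d"
    proof (rule PiE_ext[OF c d])
      fix i assume "i \<in> {..<k}"
      then have i: "i < k" "c i \<in> carrier R" "d i \<in> carrier R" using c' d' by auto
      with z have "c i \<oplus> \<ominus> d i = \<zero>" by (auto simp: l_minus)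
      then show "c i = d i" using i by (metis minus_equality minus_minus a_inv_closed a_comm)
    qed
  qed
  moreover have "(\<lambda>c. lin_comb4 R k c v) ` ({..<k} \<rightarrow>\<^sub>E carrier R) = span4 k v"
  proof (intro equalityI subsetI)
    fix x assume "x \<in> span4 k v"
    then obtain c where c: "c \<in> {..<k} \<rightarrow> carrier R" "x = lin_comb4 R k c v" by (auto simp: span4_def)
    then have "x = lin_comb4 R k (restrict c {..<k}) v"
      using v by (auto intro!: lin_comb4_cong)
    moreover have "restrict c {..<k} \<in> {..<k} \<rightarrow>\<^sub>E carrier R" using c by auto
    ultimately show "x \<in> (\<lambda>c. lin_comb4 R k c v) ` ({..<k} \<rightarrow>\<^sub>E carrier R)" by blast
  qed (auto simp: span4_def)
  ultimately have "card (span4 k v) = card ({..<k} \<rightarrow>\<^sub>E carrier R)"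
    by (metis card_image)
  then show ?thesis by (simp add: card_PiE)
qed

lemma subspaces4_eq:
  "subspaces4 R k = {span4 k v | v. v \<in> {..<k} \<rightarrow> carrier V4 \<and> lin_indep4 R k v}"
  by (simp add: subspaces4_def span4_def carrier_V4)

text \<open>An independent family of maximal size inside \<open>U\<close> spans \<open>U\<close>. A
  maximum exists because the span of an independent family of size \<open>k\<close> has
  \<open>q^k > k\<close> elements, all in \<open>U\<close>.\<close>

lemma lin_exists_basis:
  assumes U: "lin U"
  obtains k where "U \<in> subspaces4 R k"
proof -
  define J where "J = {k. \<exists>v. v \<in> {..<k} \<rightarrow> U \<and> lin_indep4 R k v}"
  have UV: "U \<subseteq> carrier V4" using U by (simp add: lin_def)
  have bound: "k \<le> card U" if "k \<in> J" for k
  proof -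
    from that obtain v where v: "v \<in> {..<k} \<rightarrow> U" "lin_indep4 R k v" by (auto simp: J_def)
    have "span4 k v \<subseteq> U" using U v by (auto simp: span4_def intro!: lin_comb4_in_lin)
    then have "card (span4 k v) \<le> card U" using U by (intro card_mono) (auto simp: lin_finite)
    then have "card (carrier R) ^ k \<le> card U" using v UV by (subst (asm) card_span4) auto
    moreover have "k < card (carrier R) ^ k"
      using card_carrier_ge_2 by (simp add: power_gt_expt)
    ultimately show ?thesis by simp
  qed
  have "0 \<in> J" by (auto simp: J_def lin_indep4_def)
  then have "Max J \<in> J" and max: "\<And>k. k \<in> J \<Longrightarrow> k \<le> Max J"
    using bound by (auto intro!: Max_in Max_ge bounded_nat_set_is_finite[of J "Suc (card U)"] simp: le_imp_less_Suc)
  define k where "k = Max J"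
  have k: "k = Max J" by (simp add: k_def)
  have "k \<in> J" using \<open>Max J \<in> J\<close> k by simp
  then obtain v where v: "v \<in> {..<k} \<rightarrow> U" "lin_indep4 R k v"
    unfolding J_def by blast
  have v': "v \<in> {..<k} \<rightarrow> carrier V4" using v UV by auto
  \<comment> \<open>A vector of \<open>U\<close> outside the span could be appended to
    \<open>v\<close>: in a vanishing combination a nonzero last coefficient could be inverted, which
    would put \<open>u\<close> into the span.\<close>
  have "u \<in> span4 k v" if u: "u \<in> U" for u
  proof (rule ccontr)
    assume nu: "u \<notin> span4 k v"
    let ?w = "v(k := u)"
    have w: "?w \<in> {..<Suc k} \<rightarrow> U" using v u by (auto simp: Pi_iff less_Suc_eq)
    have w': "?w \<in> {..<Suc k} \<rightarrow> carrier V4" using w UV by auto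
    have "lin_indep4 R (Suc k) ?w"
      unfolding lin_indep4_def
    proof (intro ballI impI)
      fix c assume c: "c \<in> {..<Suc k} \<rightarrow> carrier R"
        and z: "lin_comb4 R (Suc k) c ?w = (\<lambda>j\<in>{..<4}. \<zero>)"
      have c': "c \<in> {..<k} \<rightarrow> carrier R" "c k \<in> carrier R" using c by auto
      have cong: "lin_comb4 R k c ?w = lin_comb4 R k c v"
        using c' v' by (intro lin_comb4_cong) auto
      have in_span: "lin_comb4 R k c v \<in> span4 k v" using c' by (auto simp: span4_def)
      have cl: "lin_comb4 R k c v \<in> carrier V4" by (intro lin_comb4_closed c' v')
      have uV: "u \<in> carrier V4" using u UV by auto
      have z': "lin_comb4 R k c v \<oplus>\<^bsub>V4\<^esub> c k \<odot>\<^bsub>V4\<^esub> u = \<zero>\<^bsub>V4\<^esub>"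
        using z lin_comb4_Suc[OF c w'] cong by (simp add: V4_def)
      have ck: "c k = \<zero>"
      proof (rule ccontr)
        assume nz: "c k \<noteq> \<zero>"
        then have unit: "c k \<in> Units R" using c' by (simp add: field_Units)
        have "c k \<odot>\<^bsub>V4\<^esub> u = \<ominus>\<^bsub>V4\<^esub> lin_comb4 R k c v"
          using z' cl uV c' by (metis V.M.minus_equality V.M.a_comm V.smult_closed)
        then have "c k \<odot>\<^bsub>V4\<^esub> u \<in> span4 k v"
          using lin_uminus[OF lin_span4[OF v'] in_span] by simp
        then have "inv (c k) \<odot>\<^bsub>V4\<^esub> (c k \<odot>\<^bsub>V4\<^esub> u) \<in> span4 k v"
          using lin_span4[OF v'] unit by (auto simp: lin_def)
        then show False using nu unit uV c' by (simp add: V.smult_assoc1[symmetric])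
      qed
      then have "lin_comb4 R k c v = \<zero>\<^bsub>V4\<^esub>" using z' cl uV by simp
      then have "\<forall>i<k. c i = \<zero>" using v c' by (auto simp: lin_indep4_def V4_def)
      then show "\<forall>i<Suc k. c i = \<zero>" using ck by (auto simp: less_Suc_eq)
    qed
    then have "Suc k \<in> J" using w unfolding J_def by blast
    then show False using max[of "Suc k"] k by simp
  qed
  moreover have "span4 k v \<subseteq> U" using U v by (auto simp: span4_def intro!: lin_comb4_in_lin)
  ultimately have "U = span4 k v" by blast
  then have "U \<in> subspaces4 R k" using v v' by (auto simp: subspaces4_eq)
  then show ?thesis by (rule that)
qed

text \<open>From here on dimensions are read off cardinalities. For the converse direction,
  \<open>U\<close> has some basis, of size \<open>j\<close> say, and \<open>q^j = q^k\<close> forces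
  \<open>j = k\<close>.\<close>

lemma subspaces4_iff: "U \<in> subspaces4 R k \<longleftrightarrow> lin U \<and> card U = card (carrier R) ^ k"
proof -
  have *: "lin U \<and> card U = card (carrier R) ^ k" if "U \<in> subspaces4 R k" for k
    using that by (auto simp: subspaces4_eq lin_span4 card_span4)
  have "U \<in> subspaces4 R k" if U: "lin U" "card U = card (carrier R) ^ k"
  proof -
    obtain j where j: "U \<in> subspaces4 R j" using lin_exists_basis[OF U(1)] .
    then have "card (carrier R) ^ j = card (carrier R) ^ k" using *[of j] U by simp
    then have "j = k" using card_carrier_ge_2 by (simp add: power_inject_exp)
    with j show ?thesis by simp
  qed
  with * show ?thesis by blast
qed

lemma subspaces4_4: "carrier V4 \<in> subspaces4 R 4"
  by (simp add: subspaces4_iff lin_carrier card_vectors4)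

lemma subspaces4_mono:
  assumes "U \<subseteq> W" "U \<in> subspaces4 R j" "W \<in> subspaces4 R k"
  shows "j \<le> k"
proof -
  have "card U \<le> card W" using assms by (intro card_mono) (auto simp: subspaces4_iff lin_finite)
  then show ?thesis using assms card_carrier_ge_2 by (simp add: subspaces4_iff)
qed

lemma subspaces4_subset_eq:
  assumes "U \<subseteq> W" "U \<in> subspaces4 R k" "W \<in> subspaces4 R k"
  shows "U = W"
  using assms by (intro card_subset_eq) (auto simp: subspaces4_iff lin_finite)

section \<open>Joins and the dimension formula\<close>

definition sum4 :: "(nat \<Rightarrow> 'a) set \<Rightarrow> (nat \<Rightarrow> 'a) set \<Rightarrow> (nat \<Rightarrow> 'a) set" where
  "sum4 U W = (\<lambda>(u, w). u \<oplus>\<^bsub>V4\<^esub> w) ` (U \<times> W)"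

lemma sum4_upper: 
  assumes "lin U" "lin W" shows "U \<subseteq> sum4 U W" "W \<subseteq> sum4 U W"
proof -
  have "u \<in> sum4 U W" if "u \<in> U" for u
    using that assms unfolding sum4_def lin_def by (intro image_eqI[of _ _ "(u, \<zero>\<^bsub>V4\<^esub>)"]) auto
  moreover have "w \<in> sum4 U W" if "w \<in> W" for w
    using that assms unfolding sum4_def lin_def by (intro image_eqI[of _ _ "(\<zero>\<^bsub>V4\<^esub>, w)"]) auto
  ultimately show "U \<subseteq> sum4 U W" "W \<subseteq> sum4 U W" by blast+
qed

lemma sum4_least: "lin X \<Longrightarrow> U \<subseteq> X \<Longrightarrow> W \<subseteq> X \<Longrightarrow> sum4 U W \<subseteq> X"
  by (auto simp: sum4_def lin_def subset_iff)

lemma lin_sum4: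
  assumes "lin U" "lin W" shows "lin (sum4 U W)"
proof -
  have cl: "\<And>u. u \<in> U \<Longrightarrow> u \<in> carrier V4" "\<And>u. u \<in> W \<Longrightarrow> u \<in> carrier V4"
    using assms by (auto simp: lin_def)
  have add: "(u \<oplus>\<^bsub>V4\<^esub> w) \<oplus>\<^bsub>V4\<^esub> (u' \<oplus>\<^bsub>V4\<^esub> w') \<in> sum4 U W"
    if "u \<in> U" "w \<in> W" "u' \<in> U" "w' \<in> W" for u w u' w'
  proof -
    have "(u \<oplus>\<^bsub>V4\<^esub> w) \<oplus>\<^bsub>V4\<^esub> (u' \<oplus>\<^bsub>V4\<^esub> w') = (u \<oplus>\<^bsub>V4\<^esub> u') \<oplus>\<^bsub>V4\<^esub> (w \<oplus>\<^bsub>V4\<^esub> w')"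
      using that cl by (simp add: V.M.a_ac)
    then show ?thesis using that assms unfolding sum4_def lin_def
      by (intro image_eqI[of _ _ "(u \<oplus>\<^bsub>V4\<^esub> u', w \<oplus>\<^bsub>V4\<^esub> w')"]) auto
  qed
  have smult: "a \<odot>\<^bsub>V4\<^esub> (u \<oplus>\<^bsub>V4\<^esub> w) \<in> sum4 U W" if "u \<in> U" "w \<in> W" "a \<in> carrier R" for a u w
    using that cl assms unfolding sum4_def lin_def
    by (intro image_eqI[of _ _ "(a \<odot>\<^bsub>V4\<^esub> u, a \<odot>\<^bsub>V4\<^esub> w)"]) (auto simp: V.smult_r_distr)
  have "\<zero>\<^bsub>V4\<^esub> \<in> sum4 U W" using sum4_upper[OF assms] assms by (auto simp: lin_def)
  moreover have "sum4 U W \<subseteq> carrier V4" using assms by (intro sum4_least lin_carrier) (auto simp: lin_def)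
  ultimately show ?thesis unfolding lin_def
    using add smult by (auto simp: sum4_def)
qed

lemma V4_cancel:
  assumes "u \<in> carrier V4" "z \<in> carrier V4"
  shows "u \<oplus>\<^bsub>V4\<^esub> z \<ominus>\<^bsub>V4\<^esub> u = z" "u \<oplus>\<^bsub>V4\<^esub> (z \<ominus>\<^bsub>V4\<^esub> u) = z"
    "z \<oplus>\<^bsub>V4\<^esub> u \<ominus>\<^bsub>V4\<^esub> u = z"
proof -
  show 1: "z \<oplus>\<^bsub>V4\<^esub> u \<ominus>\<^bsub>V4\<^esub> u = z"
    using assms by (simp add: V.M.minus_eq V.M.a_assoc V.M.r_neg)
  then show "u \<oplus>\<^bsub>V4\<^esub> z \<ominus>\<^bsub>V4\<^esub> u = z" using assms by (simp add: V.M.a_comm)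
  show "u \<oplus>\<^bsub>V4\<^esub> (z \<ominus>\<^bsub>V4\<^esub> u) = z"
    using 1 assms by (metis V.M.a_assoc V.M.a_comm V.M.minus_eq V.M.a_inv_closed)
qed

text \<open>Each fibre of the addition map on \<open>U\<close> times \<open>W\<close> is a copy of
  the intersection: from one solution \<open>(u, w)\<close> all others arise as
  \<open>(u + z, w - z)\<close> with \<open>z\<close> in both subspaces.\<close>

lemma card_sum4:
  assumes U: "lin U" and W: "lin W"
  shows "card (sum4 U W) * card (U \<inter> W) = card U * card W"
proof -
  let ?f = "\<lambda>(u, w). u \<oplus>\<^bsub>V4\<^esub> w"
  have cl: "\<And>u. u \<in> U \<Longrightarrow> u \<in> carrier V4" "\<And>u. u \<in> W \<Longrightarrow> u \<in> carrier V4"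
    using assms by (auto simp: lin_def)
  have fin: "finite (U \<times> W)" "finite (sum4 U W)"
    using U W by (auto simp: lin_finite lin_sum4)
  have fib: "card {p \<in> U \<times> W. ?f p = s} = card (U \<inter> W)" if s: "s \<in> sum4 U W" for s
  proof -
    obtain u w where uw: "u \<in> U" "w \<in> W" "s = u \<oplus>\<^bsub>V4\<^esub> w" using s by (auto simp: sum4_def)
    have "bij_betw (\<lambda>z. (u \<oplus>\<^bsub>V4\<^esub> z, w \<ominus>\<^bsub>V4\<^esub> z)) (U \<inter> W) {p \<in> U \<times> W. ?f p = s}"
    proof (rule bij_betw_byWitness[where f' = "\<lambda>(a, b). a \<ominus>\<^bsub>V4\<^esub> u"])
      show "\<forall>z\<in>U \<inter> W. (\<lambda>(a, b). a \<ominus>\<^bsub>V4\<^esub> u) (u \<oplus>\<^bsub>V4\<^esub> z, w \<ominus>\<^bsub>V4\<^esub> z) = z"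
      proof
        fix z assume "z \<in> U \<inter> W"
        then show "(\<lambda>(a, b). a \<ominus>\<^bsub>V4\<^esub> u) (u \<oplus>\<^bsub>V4\<^esub> z, w \<ominus>\<^bsub>V4\<^esub> z) = z"
          using uw cl by (simp add: V4_cancel)
      qed
      show "\<forall>p\<in>{p \<in> U \<times> W. ?f p = s}. (u \<oplus>\<^bsub>V4\<^esub> (case p of (a, b) \<Rightarrow> a \<ominus>\<^bsub>V4\<^esub> u),
          w \<ominus>\<^bsub>V4\<^esub> (case p of (a, b) \<Rightarrow> a \<ominus>\<^bsub>V4\<^esub> u)) = p"
      proof
        fix p assume "p \<in> {p \<in> U \<times> W. ?f p = s}"
        then obtain a b where ab: "p = (a, b)" "a \<in> U" "b \<in> W" "a \<oplus>\<^bsub>V4\<^esub> b = u \<oplus>\<^bsub>V4\<^esub> w" using uw by auto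
        note c = cl(1)[OF uw(1)] cl(2)[OF uw(2)] cl(1)[OF ab(2)] cl(2)[OF ab(3)]
        have 1: "u \<oplus>\<^bsub>V4\<^esub> (a \<ominus>\<^bsub>V4\<^esub> u) = a"
          using c by (simp add: V4_cancel)
        have "u \<oplus>\<^bsub>V4\<^esub> ((a \<ominus>\<^bsub>V4\<^esub> u) \<oplus>\<^bsub>V4\<^esub> b) = u \<oplus>\<^bsub>V4\<^esub> w"
          using c 1 ab(4) by (simp add: V.M.a_assoc[symmetric])
        then have "(a \<ominus>\<^bsub>V4\<^esub> u) \<oplus>\<^bsub>V4\<^esub> b = w" using c by simp
        then have "w \<ominus>\<^bsub>V4\<^esub> (a \<ominus>\<^bsub>V4\<^esub> u) = b" using c V4_cancel(1) by auto
        then show "(u \<oplus>\<^bsub>V4\<^esub> (case p of (a, b) \<Rightarrow> a \<ominus>\<^bsub>V4\<^esub> u),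
          w \<ominus>\<^bsub>V4\<^esub> (case p of (a, b) \<Rightarrow> a \<ominus>\<^bsub>V4\<^esub> u)) = p" using 1 ab by simp
      qed
      show "(\<lambda>z. (u \<oplus>\<^bsub>V4\<^esub> z, w \<ominus>\<^bsub>V4\<^esub> z)) ` (U \<inter> W) \<subseteq> {p \<in> U \<times> W. ?f p = s}"
      proof safe
        fix z assume z: "z \<in> U" "z \<in> W"
        show "u \<oplus>\<^bsub>V4\<^esub> z \<in> U" using z uw U by (auto simp: lin_def)
        show "w \<ominus>\<^bsub>V4\<^esub> z \<in> W" using z uw W lin_minus by auto
        show "u \<oplus>\<^bsub>V4\<^esub> z \<oplus>\<^bsub>V4\<^esub> (w \<ominus>\<^bsub>V4\<^esub> z) = s"
          using z uw cl by (simp add: V.M.minus_eq V.M.a_ac V.M.r_neg V.M.r_neg1)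
      qed
      show "(\<lambda>(a, b). a \<ominus>\<^bsub>V4\<^esub> u) ` {p \<in> U \<times> W. ?f p = s} \<subseteq> U \<inter> W"
      proof safe
        fix a b assume ab: "a \<in> U" "b \<in> W" "s = a \<oplus>\<^bsub>V4\<^esub> b"
        show "a \<ominus>\<^bsub>V4\<^esub> u \<in> U" using ab uw U lin_minus by auto
        note c = cl(1)[OF uw(1)] cl(2)[OF uw(2)] cl(1)[OF ab(1)] cl(2)[OF ab(2)]
        have "a = (a \<oplus>\<^bsub>V4\<^esub> b) \<ominus>\<^bsub>V4\<^esub> b" using c by (simp add: V.M.minus_eq V.M.a_assoc V.M.r_neg)
        also have "\<dots> = (u \<oplus>\<^bsub>V4\<^esub> w) \<ominus>\<^bsub>V4\<^esub> b" using ab uw by simp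
        finally have "a \<ominus>\<^bsub>V4\<^esub> u = w \<ominus>\<^bsub>V4\<^esub> b"
          using c by (metis V.M.minus_eq V.M.add.inv_solve_right V.M.a_comm V.M.a_assoc V.M.minus_closed V.M.add.m_closed V.M.a_inv_closed)
        then show "a \<ominus>\<^bsub>V4\<^esub> u \<in> W" using ab uw W lin_minus by auto
      qed
    qed
    then show ?thesis by (simp add: bij_betw_same_card)
  qed
  have "card (U \<times> W) = (\<Sum>s\<in>?f ` (U \<times> W). \<Sum>p\<in>{p \<in> U \<times> W. ?f p = s}. 1)"
    unfolding card_eq_sum by (rule sum.image_gen[OF fin(1)])
  also have "\<dots> = (\<Sum>s\<in>sum4 U W. card {p \<in> U \<times> W. ?f p = s})"
    by (simp only: card_eq_sum sum4_def)
  also have "\<dots> = card (sum4 U W) * card (U \<inter> W)" by (simp add: fib)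
  finally show ?thesis by (simp add: card_cartesian_product)
qed

lemma subspaces4_lin: "U \<in> subspaces4 R k \<Longrightarrow> lin U"
  by (simp add: subspaces4_iff)

lemma subspaces4_carrier: "U \<in> subspaces4 R k \<Longrightarrow> U \<subseteq> carrier V4"
  by (auto simp: subspaces4_iff lin_def)

lemma subspaces4_unique_dim: "U \<in> subspaces4 R j \<Longrightarrow> U \<in> subspaces4 R k \<Longrightarrow> j = k"
  by (meson subspaces4_mono le_antisym subset_refl)

lemma finite_subspaces4: "finite (subspaces4 R k)"
  by (rule finite_subset[of _ "Pow (carrier V4)"])
     (use subspaces4_carrier finite_vectors4 in \<open>auto\<close>)

text \<open>The dimension formula, obtained from \<open>card_sum4\<close> by comparing exponents of
  \<open>q\<close>.\<close>

lemma subspaces4_modular: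
  assumes "U \<in> subspaces4 R i" "W \<in> subspaces4 R j"
  obtains k l where "U \<inter> W \<in> subspaces4 R k" "sum4 U W \<in> subspaces4 R l" "k + l = i + j"
proof -
  note L = subspaces4_lin[OF assms(1)] subspaces4_lin[OF assms(2)]
  obtain k where k: "U \<inter> W \<in> subspaces4 R k" using lin_exists_basis[OF lin_Int[OF L]] .
  obtain l where l: "sum4 U W \<in> subspaces4 R l" using lin_exists_basis[OF lin_sum4[OF L]] .
  have "card (carrier R) ^ (l + k) = card (carrier R) ^ (i + j)"
    using card_sum4[OF L] assms k l by (simp add: subspaces4_iff power_add)
  then have "l + k = i + j" using card_carrier_ge_2 by (simp add: power_inject_exp)
  then show ?thesis using that k l by simp
qed

lemma sum4_subspaces4_upper:
  assumes "U \<in> subspaces4 R i" "W \<in> subspaces4 R j"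
  shows "U \<subseteq> sum4 U W" "W \<subseteq> sum4 U W"
  using assms sum4_upper subspaces4_lin by blast+

section \<open>Incidence of points, lines and planes\<close>

lemma sum4_point:
  assumes U: "U \<in> subspaces4 R k" and p: "p \<in> proj_points R" and np: "\<not> p \<subseteq> U"
  shows "sum4 U p \<in> subspaces4 R (Suc k)"
proof -
  obtain i l where il: "U \<inter> p \<in> subspaces4 R i" "sum4 U p \<in> subspaces4 R l" "i + l = k + 1"
    using subspaces4_modular[OF U p] .
  have "i \<le> 1" using subspaces4_mono[OF _ il(1) p] by auto
  moreover have "i \<noteq> 1" using subspaces4_subset_eq[of "U \<inter> p" p 1] il(1) p np by auto
  ultimately have "l = Suc k" using il(3) by linarith
  then show ?thesis using il by simp
qed

lemma points_span_line:
  assumes "p \<in> proj_points R" "p' \<in> proj_points R" "p \<noteq> p'"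
  shows "sum4 p p' \<in> proj_lines R"
proof -
  have "\<not> p' \<subseteq> p" using subspaces4_subset_eq[of p' p 1] assms by auto
  then show ?thesis using sum4_point[OF assms(1,2)] by (simp add: numeral_2_eq_2)
qed

lemma line_unique:
  assumes "p \<in> proj_points R" "p' \<in> proj_points R" "p \<noteq> p'" "W \<in> proj_lines R" "p \<subseteq> W" "p' \<subseteq> W"
  shows "W = sum4 p p'"
  using subspaces4_subset_eq[OF _ points_span_line[OF assms(1-3)] assms(4)]
    sum4_least[OF subspaces4_lin[OF assms(4)] assms(5,6)] by simp

text \<open>The scalar multiples of \<open>v\<close> form a subspace with at most \<open>q\<close>
  elements that contains both \<open>v\<close> and zero, which leaves only dimension 1.\<close>

lemma point_through_vector:
  assumes v: "v \<in> carrier V4" "v \<noteq> \<zero>\<^bsub>V4\<^esub>"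
  obtains p where "p \<in> proj_points R" "v \<in> p" "\<And>U. lin U \<Longrightarrow> v \<in> U \<Longrightarrow> p \<subseteq> U"
proof -
  define p where "p = (\<lambda>c. c \<odot>\<^bsub>V4\<^esub> v) ` carrier R"
  have "lin p" unfolding lin_def
  proof (intro conjI ballI)
    show "\<zero>\<^bsub>V4\<^esub> \<in> p" using v unfolding p_def by (intro image_eqI[of _ _ \<zero>]) auto
  next
    fix x y assume "x \<in> p" "y \<in> p"
    then obtain c d where "c \<in> carrier R" "d \<in> carrier R" "x = c \<odot>\<^bsub>V4\<^esub> v" "y = d \<odot>\<^bsub>V4\<^esub> v"
      by (auto simp: p_def)
    then show "x \<oplus>\<^bsub>V4\<^esub> y \<in> p" using v unfolding p_def
      by (intro image_eqI[of _ _ "c \<oplus> d"]) (auto simp: V.smult_l_distr)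
  next
    fix a x assume "a \<in> carrier R" "x \<in> p"
    then obtain c where "a \<in> carrier R" "c \<in> carrier R" "x = c \<odot>\<^bsub>V4\<^esub> v"
      by (auto simp: p_def)
    then show "a \<odot>\<^bsub>V4\<^esub> x \<in> p" using v unfolding p_def
      by (intro image_eqI[of _ _ "a \<otimes> c"]) (auto simp: V.smult_assoc1)
  qed (use v in \<open>auto simp: p_def\<close>)
  then obtain k where k: "p \<in> subspaces4 R k" using lin_exists_basis by blast
  have "card p \<le> card (carrier R) ^ 1" unfolding p_def using card_image_le[OF finite_carrier] by simp
  then have "card (carrier R) ^ k \<le> card (carrier R) ^ 1" using k by (simp add: subspaces4_iff)
  then have k1: "k \<le> 1" using card_carrier_ge_2 by (subst (asm) power_increasing_iff) auto
  have vp: "v \<in> p" unfolding p_def using v by (intro image_eqI[of _ _ \<one>]) auto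
  have "\<zero>\<^bsub>V4\<^esub> \<in> p" using \<open>lin p\<close> by (simp add: lin_def)
  then have "card {v, \<zero>\<^bsub>V4\<^esub>} \<le> card p" using vp lin_finite[OF \<open>lin p\<close>] by (intro card_mono) auto
  then have "k \<noteq> 0" using k v by (intro notI) (simp add: subspaces4_iff)
  then have "p \<in> proj_points R" using k k1 by (cases "k = 1") auto
  moreover have "p \<subseteq> U" if "lin U" "v \<in> U" for U using that by (auto simp: lin_def p_def)
  ultimately show ?thesis using that vp by blast
qed

lemma point_outside:
  assumes "U \<in> subspaces4 R k" "k < 4"
  obtains p where "p \<in> proj_points R" "\<not> p \<subseteq> U"
proof -
  have "U \<noteq> carrier V4" using assms subspaces4_4 subspaces4_unique_dim by blast
  then obtain v where v: "v \<in> carrier V4" "v \<notin> U" using subspaces4_carrier[OF assms(1)] by auto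
  moreover have "\<zero>\<^bsub>V4\<^esub> \<in> U" using assms by (simp add: subspaces4_iff lin_def)
  ultimately have "v \<noteq> \<zero>\<^bsub>V4\<^esub>" by auto
  with v show ?thesis using point_through_vector that by (metis subsetD)
qed

lemma subspaces4_extend:
  assumes "U \<in> subspaces4 R k" "k < 4"
  obtains W where "W \<in> subspaces4 R (Suc k)" "U \<subseteq> W"
  using assms sum4_point sum4_subspaces4_upper by (metis point_outside)

lemma subspaces4_le_4: "U \<in> subspaces4 R k \<Longrightarrow> k \<le> 4"
  using subspaces4_mono[OF subspaces4_carrier _ subspaces4_4] by blast

text \<open>This and the next two lemmas apply the dimension formula: the join is bounded by the
  common plane or by the whole space, so the intersection is large, and distinctness or
  non-inclusion keeps it from being larger.\<close>

lemma lines_meet: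
  assumes "W \<in> proj_lines R" "W' \<in> proj_lines R" "W \<noteq> W'" "H \<in> proj_planes R" "W \<subseteq> H" "W' \<subseteq> H"
  shows "W \<inter> W' \<in> proj_points R"
proof -
  obtain k l where kl: "W \<inter> W' \<in> subspaces4 R k" "sum4 W W' \<in> subspaces4 R l" "k + l = 2 + 2"
    using subspaces4_modular[OF assms(1,2)] .
  have "l \<le> 3" using subspaces4_mono[OF _ kl(2) assms(4)] sum4_least assms subspaces4_lin by blast
  moreover have "k \<le> 2" using subspaces4_mono[OF _ kl(1) assms(1)] by auto
  moreover have "k \<noteq> 2"
    using subspaces4_subset_eq[of "W \<inter> W'" W 2] subspaces4_subset_eq[of "W \<inter> W'" W' 2] kl(1) assms by auto
  ultimately have "k = 1" using kl(3) by linarith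
  then show ?thesis using kl by simp
qed

lemma planes_meet:
  assumes "H \<in> proj_planes R" "H' \<in> proj_planes R" "H \<noteq> H'"
  shows "H \<inter> H' \<in> proj_lines R"
proof -
  obtain k l where kl: "H \<inter> H' \<in> subspaces4 R k" "sum4 H H' \<in> subspaces4 R l" "k + l = 3 + 3"
    using subspaces4_modular[OF assms(1,2)] .
  have "l \<le> 4" using subspaces4_le_4 kl by blast
  moreover have "k \<le> 3" using subspaces4_mono[OF _ kl(1) assms(1)] by auto
  moreover have "k \<noteq> 3"
    using subspaces4_subset_eq[of "H \<inter> H'" H 3] subspaces4_subset_eq[of "H \<inter> H'" H' 3] kl(1) assms by auto
  ultimately have "k = 2" using kl(3) by linarith
  then show ?thesis using kl by simp
qed

lemma line_plane_meet:
  assumes "W \<in> proj_lines R" "H \<in> proj_planes R" "\<not> W \<subseteq> H"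
  shows "W \<inter> H \<in> proj_points R"
proof -
  obtain k l where kl: "W \<inter> H \<in> subspaces4 R k" "sum4 W H \<in> subspaces4 R l" "k + l = 2 + 3"
    using subspaces4_modular[OF assms(1,2)] .
  have "l \<le> 4" using subspaces4_le_4 kl by blast
  moreover have "k \<le> 2" using subspaces4_mono[OF _ kl(1) assms(1)] by auto
  moreover have "k \<noteq> 2"
    using subspaces4_subset_eq[of "W \<inter> H" W 2] kl(1) assms by auto
  ultimately have "k = 1" using kl(3) by linarith
  then show ?thesis using kl by simp
qed

lemma points_Int:
  assumes "p \<in> proj_points R" "p' \<in> proj_points R" "v \<in> p" "v \<in> p'" "v \<noteq> \<zero>\<^bsub>V4\<^esub>"
  shows "p = p'"
proof -
  have "v \<in> carrier V4" using assms subspaces4_carrier by blast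
  then obtain p0 where "p0 \<in> proj_points R" "\<And>U. lin U \<Longrightarrow> v \<in> U \<Longrightarrow> p0 \<subseteq> U"
    using point_through_vector assms(5) by metis
  then show ?thesis
    using subspaces4_subset_eq[of p0 p 1] subspaces4_subset_eq[of p0 p' 1] assms subspaces4_lin by blast
qed

text \<open>The nonzero vectors of \<open>U\<close> are partitioned by the points in
  \<open>U\<close>, each having \<open>q - 1\<close> of them. This is the origin of the factor
  \<open>1 + q + ... + q^k\<close> in the recursion.\<close>

lemma card_points_in:
  assumes U: "U \<in> subspaces4 R k"
  shows "card {p \<in> proj_points R. p \<subseteq> U} = (\<Sum>i<k. card (carrier R) ^ i)"
proof -
  let ?q = "card (carrier R)" and ?P = "{p \<in> proj_points R. p \<subseteq> U}" and ?z = "\<zero>\<^bsub>V4\<^esub>"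
  have fin: "finite ?P" using finite_subspaces4[of 1] by simp
  have z: "?z \<in> W" if "W \<in> subspaces4 R j" for W j using that by (simp add: subspaces4_iff lin_def)
  have "U - {?z} = (\<Union>p\<in>?P. p - {?z})"
  proof (intro equalityI subsetI)
    fix v assume v: "v \<in> U - {?z}"
    then have "v \<in> carrier V4" "v \<noteq> ?z" using subspaces4_carrier[OF U] by auto
    then obtain p where "p \<in> proj_points R" "v \<in> p" "\<And>U. lin U \<Longrightarrow> v \<in> U \<Longrightarrow> p \<subseteq> U"
      using point_through_vector by metis
    then show "v \<in> (\<Union>p\<in>?P. p - {?z})" using v subspaces4_lin[OF U] by auto
  qed auto
  moreover have "card (\<Union>p\<in>?P. p - {?z}) = (\<Sum>p\<in>?P. card (p - {?z}))"
  proof (intro card_UN_disjoint ballI impI)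
    fix p p' assume "p \<in> ?P" "p' \<in> ?P" "p \<noteq> p'"
    then show "(p - {?z}) \<inter> (p' - {?z}) = {}" using points_Int[of p p'] by auto
  qed (use fin in \<open>auto simp: subspaces4_iff lin_finite\<close>)
  moreover have "card (p - {?z}) = ?q - 1" if "p \<in> ?P" for p
    using that z[of p 1] by (subst card_Diff_singleton) (auto simp: subspaces4_iff)
  moreover have "card (U - {?z}) = ?q ^ k - 1"
    using z[OF U] U by (subst card_Diff_singleton) (auto simp: subspaces4_iff)
  ultimately have "card ?P * (?q - 1) = ?q ^ k - 1" by simp
  moreover have "(\<Sum>i<k. ?q ^ i) * (?q - 1) = ?q ^ k - 1"
  proof -
    \<comment> \<open>The geometric sum is evaluated over the integers to avoid truncated
      subtraction.\<close>
    have "int ((\<Sum>i<k. ?q ^ i) * (?q - 1)) = int (?q ^ k - 1)"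
      using card_carrier_ge_2 power_diff_1_eq[of "int ?q" k]
      by (simp add: of_nat_diff mult.commute)
    then show ?thesis by (simp only: of_nat_eq_iff)
  qed
  ultimately have "card ?P * (?q - 1) = (\<Sum>i<k. ?q ^ i) * (?q - 1)" by simp
  then show ?thesis using card_carrier_ge_2 by simp
qed

section \<open>Collinear and coplanar sets of projective points\<close>

definition collin :: "(nat \<Rightarrow> 'a) set set \<Rightarrow> bool" where
  "collin X \<longleftrightarrow> (\<exists>W\<in>proj_lines R. \<forall>p\<in>X. p \<subseteq> W)"

definition coplan :: "(nat \<Rightarrow> 'a) set set \<Rightarrow> bool" where
  "coplan X \<longleftrightarrow> (\<exists>W\<in>proj_planes R. \<forall>p\<in>X. p \<subseteq> W)"

lemma collin_mono: "collin Y \<Longrightarrow> X \<subseteq> Y \<Longrightarrow> collin X"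
  by (auto simp: collin_def)

lemma coplan_mono: "coplan Y \<Longrightarrow> X \<subseteq> Y \<Longrightarrow> coplan X"
  by (auto simp: coplan_def)

lemma collin_pair:
  assumes "p \<in> proj_points R" "p' \<in> proj_points R"
  shows "collin {p, p'}"
proof (cases "p = p'")
  case True
  then show ?thesis
    using subspaces4_extend[OF assms(1)] by (auto simp: collin_def numeral_2_eq_2)
next
  case False
  then show ?thesis
    using points_span_line[OF assms False] sum4_subspaces4_upper[OF assms] by (auto simp: collin_def)
qed

lemma line_in_plane:
  assumes "W \<in> proj_lines R"
  obtains H where "H \<in> proj_planes R" "W \<subseteq> H"
proof -
  obtain H where "H \<in> subspaces4 R (Suc 2)" "W \<subseteq> H" by (rule subspaces4_extend[OF assms]) simp
  then show ?thesis using that by (simp add: numeral_3_eq_3 numeral_2_eq_2)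
qed

lemma collin_coplan: "collin X \<Longrightarrow> coplan X"
  unfolding collin_def coplan_def by (meson line_in_plane order_trans)

text \<open>A line and a point off it span a plane; if the point is on the line, any plane through
  the line serves.\<close>

lemma coplan_insert:
  assumes "collin X" "p \<in> proj_points R"
  shows "coplan (insert p X)"
proof -
  obtain W where W: "W \<in> proj_lines R" "\<forall>p\<in>X. p \<subseteq> W" using assms by (auto simp: collin_def)
  show ?thesis
  proof (cases "p \<subseteq> W")
    case True
    obtain H where "H \<in> proj_planes R" "W \<subseteq> H" using line_in_plane[OF W(1)] .
    then show ?thesis using W True unfolding coplan_def by blast
  next
    case False
    have "sum4 W p \<in> proj_planes R"
      using sum4_point[OF W(1) assms(2) False] by (simp add: numeral_3_eq_3 numeral_2_eq_2)
    moreover have "\<forall>x\<in>insert p X. x \<subseteq> sum4 W p"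
      using W sum4_subspaces4_upper[OF W(1) assms(2)] by blast
    ultimately show ?thesis unfolding coplan_def by blast
  qed
qed

text \<open>Two different planes meet in a line, and that line would contain all of
  \<open>X\<close>.\<close>

lemma plane_unique:
  assumes "\<not> collin X" "H \<in> proj_planes R" "H' \<in> proj_planes R"
    "\<forall>p\<in>X. p \<subseteq> H" "\<forall>p\<in>X. p \<subseteq> H'"
  shows "H = H'"
proof (rule ccontr)
  assume "H \<noteq> H'"
  then have "H \<inter> H' \<in> proj_lines R" by (rule planes_meet[OF assms(2,3)])
  moreover have "\<forall>p\<in>X. p \<subseteq> H \<inter> H'" using assms(4,5) by simp
  ultimately show False using assms(1) unfolding collin_def by blast
qed

end

section \<open>Planar spaces\<close>

text \<open>One predicate for both families of subsets: \<open>covered L\<close> is collinearity and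
  \<open>covered H\<close> is coplanarity inside a planar space, to be compared with
  \<open>collin\<close> and \<open>coplan\<close> of the images.\<close>

definition covered :: "'p set set \<Rightarrow> 'p set \<Rightarrow> bool" where
  "covered L Q \<longleftrightarrow> (\<exists>l\<in>L. Q \<subseteq> l)"

lemma covered_mono: "covered L Q \<Longrightarrow> Q' \<subseteq> Q \<Longrightarrow> covered L Q'"
  by (auto simp: covered_def)

lemma two_elements:
  assumes "2 \<le> card Q" obtains x y where "x \<in> Q" "y \<in> Q" "x \<noteq> y"
proof -
  have "finite Q" using assms by (intro card_ge_0_finite) simp
  moreover have "\<not> card Q \<le> 1" using assms by simp
  ultimately show ?thesis using that card_le_Suc0_iff_eq[of Q] by auto
qed

definition full_lines :: "'p set set \<Rightarrow> 'p \<Rightarrow> 'p set set" where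
  "full_lines L x = {l \<in> L. x \<in> l \<and> 3 \<le> card l}"

definition full_planes :: "'p set set \<Rightarrow> 'p \<Rightarrow> 'p set set" where
  "full_planes H x = {h \<in> H. x \<in> h \<and> 4 \<le> card h}"

context
  fixes P :: "'p set" and L H
  assumes planar: "planar_space (P, L, H)"
begin

lemmas planar_conj = planar[unfolded planar_space.simps]

lemmas planar_linear = conjunct1[OF planar_conj]
  and planar_plane_ex1 = conjunct1[OF conjunct2[OF conjunct2[OF planar_conj]]]
  and planar_subspaces = conjunct1[OF conjunct2[OF conjunct2[OF conjunct2[OF planar_conj]]]]

lemma planar_finite: "finite P"
  using planar by (simp add: linear_space_def)

lemma planar_line_subset: "l \<in> L \<Longrightarrow> l \<subseteq> P" and planar_plane_subset: "h \<in> H \<Longrightarrow> h \<subseteq> P"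
  using planar by (auto simp: linear_space_def)

lemma planar_line_card: "l \<in> L \<Longrightarrow> 2 \<le> card l"
  using planar by (auto simp: linear_space_def)

lemma planar_line_exists:
  assumes "x \<in> P" "y \<in> P" "x \<noteq> y" obtains l where "l \<in> L" "x \<in> l" "y \<in> l"
proof -
  have "\<exists>!l. l \<in> L \<and> x \<in> l \<and> y \<in> l"
    using planar_linear assms unfolding linear_space_def by simp
  then show ?thesis using that by blast
qed

lemma planar_line_unique:
  assumes "l \<in> L" "l' \<in> L" "x \<in> l" "y \<in> l" "x \<in> l'" "y \<in> l'" "x \<noteq> y"
  shows "l = l'"
proof -
  have "x \<in> P" "y \<in> P" using assms planar_line_subset by blast+
  then have "\<exists>!l. l \<in> L \<and> x \<in> l \<and> y \<in> l"
    using planar_linear assms(7) unfolding linear_space_def by simp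
  then show ?thesis using assms by blast
qed

lemma planar_covered_pair: "x \<in> P \<Longrightarrow> y \<in> P \<Longrightarrow> x \<noteq> y \<Longrightarrow> covered L {x, y}"
  using planar_line_exists[of x y] by (auto simp: covered_def)

lemma planar_plane_exists:
  assumes "x \<in> P" "y \<in> P" "z \<in> P" "noncollinear3 L x y z"
  obtains h where "h \<in> H" "{x, y, z} \<subseteq> h"
proof -
  have "\<exists>!h. h \<in> H \<and> {x, y, z} \<subseteq> h"
    using planar_plane_ex1 assms by simp
  then show ?thesis using that by blast
qed

lemma planar_plane_unique:
  assumes "noncollinear3 L x y z" "h \<in> H" "h' \<in> H" "{x, y, z} \<subseteq> h" "{x, y, z} \<subseteq> h'"
  shows "h = h'"
proof -
  have "x \<in> P" "y \<in> P" "z \<in> P" using assms planar_plane_subset by blast+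
  then have "\<exists>!h. h \<in> H \<and> {x, y, z} \<subseteq> h"
    using planar_plane_ex1 assms(1) by simp
  then show ?thesis using assms by blast
qed

lemma planar_line_in_plane:
  assumes "h \<in> H" "l \<in> L" "x \<in> h" "x \<in> l" "y \<in> h" "y \<in> l" "x \<noteq> y"
  shows "l \<subseteq> h"
  by (rule planar_subspaces[rule_format, of h l x y]) (simp_all add: assms)

lemma noncollinear3_from_line:
  assumes "l \<in> L" "x \<in> l" "y \<in> l" "x \<noteq> y" "z \<notin> l"
  shows "noncollinear3 L x y z"
  using assms planar_line_unique[of l _ x y] unfolding noncollinear3_def by blast

text \<open>Two points of \<open>Q\<close> determine a line, and some point of \<open>Q\<close> is
  off that line.\<close>

lemma not_covered_noncollinear3:
  assumes "Q \<subseteq> P" "2 \<le> card Q" "\<not> covered L Q"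
  obtains x y z where "x \<in> Q" "y \<in> Q" "z \<in> Q" "noncollinear3 L x y z"
proof -
  obtain x y where xy: "x \<in> Q" "y \<in> Q" "x \<noteq> y" using two_elements assms(2) by blast
  then obtain l where l: "l \<in> L" "x \<in> l" "y \<in> l" using planar_line_exists assms(1) by blast
  then obtain z where "z \<in> Q" "z \<notin> l" using assms(3) by (auto simp: covered_def)
  with xy l show ?thesis using that noncollinear3_from_line by metis
qed

lemma planar_planes_eq:
  assumes "Q \<subseteq> P" "2 \<le> card Q" "\<not> covered L Q" "h \<in> H" "h' \<in> H" "Q \<subseteq> h" "Q \<subseteq> h'"
  shows "h = h'"
proof -
  obtain x y z where xyz: "x \<in> Q" "y \<in> Q" "z \<in> Q" "noncollinear3 L x y z"
    using not_covered_noncollinear3[OF assms(1-3)] .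
  show ?thesis
    by (rule planar_plane_unique[OF xyz(4) assms(4,5)]) (use xyz assms(6,7) in auto)
qed

lemma planar_plane_noncollinear:
  assumes "x \<in> P" "y \<in> P" "z \<in> P" "noncollinear3 L x y z" "h \<in> H"
  obtains a b c where "a \<in> h" "b \<in> h" "c \<in> h" "noncollinear3 L a b c"
proof -
  have "\<exists>x\<in>P. \<exists>y\<in>P. \<exists>z\<in>P. noncollinear3 L x y z" using assms by blast
  then have "\<forall>h\<in>H. \<exists>x\<in>h. \<exists>y\<in>h. \<exists>z\<in>h. noncollinear3 L x y z"
    using planar by (simp split: if_splits)
  then show ?thesis using assms that by blast
qed

lemma planar_plane_collinear:
  assumes "\<And>x y z. x \<in> P \<Longrightarrow> y \<in> P \<Longrightarrow> z \<in> P \<Longrightarrow> \<not> noncollinear3 L x y z"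
  shows "H = {P}"
proof -
  have "\<not> (\<exists>x\<in>P. \<exists>y\<in>P. \<exists>z\<in>P. noncollinear3 L x y z)" using assms by blast
  then show ?thesis using planar by (simp split: if_splits)
qed

text \<open>If the points are not all collinear, the smaller plane contains a noncollinear triple,
  which determines its plane; otherwise \<open>P\<close> is the only plane.\<close>

lemma planar_plane_antichain:
  assumes "h \<in> H" "h' \<in> H" "h \<subseteq> h'" shows "h = h'"
proof (cases "\<exists>x\<in>P. \<exists>y\<in>P. \<exists>z\<in>P. noncollinear3 L x y z")
  case True
  then obtain a b c where abc: "a \<in> h" "b \<in> h" "c \<in> h" "noncollinear3 L a b c"
    using planar_plane_noncollinear assms(1) by metis
  show ?thesis
    by (rule planar_plane_unique[OF abc(4) assms(1,2)]) (use abc assms(3) in auto)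
next
  case False
  then have "H = {P}" using planar_plane_collinear by blast
  with assms show ?thesis by simp
qed

lemma planar_line_antichain:
  assumes "l \<in> L" "l' \<in> L" "l \<subseteq> l'" shows "l = l'"
proof -
  obtain x y where "x \<in> l" "y \<in> l" "x \<noteq> y" using two_elements planar_line_card assms(1) by blast
  then show ?thesis using planar_line_unique assms by blast
qed

text \<open>A plane different from \<open>P\<close> shows that the points are not all collinear, so
  every plane contains a noncollinear triple. For \<open>P\<close> itself the bound can fail: it is
  the only plane of a space with at most one point.\<close>

lemma planar_plane_card:
  assumes "h \<in> H" "h \<noteq> P" shows "2 \<le> card h"
proof -
  obtain x y z where "x \<in> P" "y \<in> P" "z \<in> P" "noncollinear3 L x y z"
    using planar_plane_collinear assms by blast
  then obtain a b c where abc: "a \<in> h" "b \<in> h" "c \<in> h" "noncollinear3 L a b c"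
    using planar_plane_noncollinear assms(1) by metis
  have "card {a, b} \<le> card h"
    using abc assms planar_plane_subset planar_finite finite_subset by (intro card_mono) blast+
  then show ?thesis using abc by (auto simp: noncollinear3_def)
qed

lemma planar_line_point_plane:
  assumes "l \<in> L" "z \<in> P" "z \<notin> l" obtains h where "h \<in> H" "z \<in> h" "l \<subseteq> h"
proof -
  obtain x y where xy: "x \<in> l" "y \<in> l" "x \<noteq> y" using two_elements planar_line_card assms(1) by blast
  then have P: "x \<in> P" "y \<in> P" using planar_line_subset assms by blast+
  obtain h where h: "h \<in> H" "{x, y, z} \<subseteq> h"
    using planar_plane_exists[OF P assms(2) noncollinear3_from_line[OF assms(1) xy assms(3)]] .
  then have "l \<subseteq> h" using planar_line_in_plane[of h l x y] xy assms by blast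
  then show ?thesis using that h by blast
qed

lemma planar_lines_plane:
  assumes "l \<in> L" "l' \<in> L" "l \<noteq> l'" "x \<in> l" "x \<in> l'" obtains h where "h \<in> H" "l \<subseteq> h" "l' \<subseteq> h"
proof -
  obtain a b where "a \<in> l'" "b \<in> l'" "a \<noteq> b" using two_elements planar_line_card assms(2) by blast
  then obtain z where z: "z \<in> l'" "z \<noteq> x" by metis
  then have zl: "z \<notin> l" using planar_line_unique[of l l' x z] assms by blast
  moreover have "z \<in> P" using z assms planar_line_subset by blast
  ultimately obtain h where h: "h \<in> H" "z \<in> h" "l \<subseteq> h" using planar_line_point_plane assms by blast
  then have "l' \<subseteq> h" using planar_line_in_plane[of h l' x z] z assms by blast
  then show ?thesis using that h by blast
qed

section \<open>Full lines and full planes through one point\<close>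

lemma full_plane_card:
  assumes "3 \<le> card l" "h \<in> H" "z \<in> h" "l \<subseteq> h" "z \<notin> l"
  shows "4 \<le> card h"
proof -
  have fin: "finite h" using assms planar_plane_subset planar_finite finite_subset by blast
  then have "card (insert z l) \<le> card h" using assms by (intro card_mono) auto
  moreover have "finite l" using fin assms finite_subset by blast
  ultimately show ?thesis using assms by simp
qed

lemma finite_planes: "finite H"
  using planar_plane_subset planar_finite by (intro finite_subset[of H "Pow P"]) auto

lemma finite_lines: "finite L"
  using planar_line_subset planar_finite by (intro finite_subset[of L "Pow P"]) auto

lemma finite_full: "finite (full_lines L x)" "finite (full_planes H x)"
  using finite_lines finite_planes by (auto simp: full_lines_def full_planes_def)

lemma four_full_planes:
  assumes "{a, b, c, d} \<subseteq> full_planes H x" "distinct [a, b, c, d]" shows "4 \<le> card (full_planes H x)"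
  using card_mono[OF finite_full(2) assms(1)] assms(2) by auto

text \<open>The points of \<open>h\<close> other than \<open>x\<close> are off \<open>l\<close>, and
  each of them spans a full plane with \<open>l\<close>. No single plane through \<open>l\<close>
  contains \<open>h\<close>, so there are at least two such planes; together with \<open>h\<close>
  and \<open>h'\<close> they are four full planes through \<open>x\<close>.\<close>

lemma at_most_one_transversal_plane:
  assumes l: "l \<in> full_lines L x" and h: "h \<in> full_planes H x" "h' \<in> full_planes H x"
    "\<not> l \<subseteq> h" "\<not> l \<subseteq> h'" and le: "card (full_planes H x) \<le> 3"
  shows "h = h'"
proof (rule ccontr)
  assume ne: "h \<noteq> h'"
  have lL: "l \<in> L" "x \<in> l" "3 \<le> card l" using l by (auto simp: full_lines_def)
  have hH: "h \<in> H" "x \<in> h" "4 \<le> card h" using h by (auto simp: full_planes_def)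
  have zl: "z \<notin> l" if "z \<in> h" "z \<noteq> x" for z
    using planar_line_in_plane[of h l x z] that h lL hH by blast
  have ex: "\<exists>g. g \<in> full_planes H x \<and> z \<in> g \<and> l \<subseteq> g" if z: "z \<in> h" "z \<noteq> x" for z
  proof -
    have "z \<in> P" using planar_plane_subset hH z by blast
    then obtain g where g: "g \<in> H" "z \<in> g" "l \<subseteq> g"
      by (rule planar_line_point_plane[OF lL(1) _ zl[OF z]])
    then have "4 \<le> card g" using full_plane_card[OF lL(3)] zl[OF z] by simp
    with g lL show ?thesis by (auto simp: full_planes_def)
  qed
  obtain a b where "a \<in> h" "b \<in> h" "a \<noteq> b" by (rule two_elements[of h]) (use hH in simp)
  then obtain z where "z \<in> h" "z \<noteq> x" by metis
  then obtain g where g: "g \<in> full_planes H x" "z \<in> g" "l \<subseteq> g" using ex by blast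
  have "\<not> h \<subseteq> g" using planar_plane_antichain[of h g] g h hH by (auto simp: full_planes_def)
  then obtain z' where z': "z' \<in> h" "z' \<notin> g" by blast
  then have "z' \<noteq> x" using g lL by blast
  with z' obtain g' where g': "g' \<in> full_planes H x" "z' \<in> g'" "l \<subseteq> g'" using ex by blast
  have "distinct [g, g', h, h']" using ne g g' z' h by auto
  then have "4 \<le> card (full_planes H x)" using g g' h by (intro four_full_planes[of g g' h h']) auto
  with le show False by simp
qed

text \<open>If \<open>h\<close> contained neither line, a point \<open>z\<close> of \<open>h\<close>
  outside their common plane \<open>g\<close> would span one plane with \<open>l\<close> and another
  with \<open>l'\<close>, and these two, \<open>g\<close> and \<open>h\<close> would be four full
  planes through \<open>x\<close>.\<close>

lemma plane_contains_full_line: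
  assumes l: "l \<in> full_lines L x" "l' \<in> full_lines L x" "l \<noteq> l'" and h: "h \<in> full_planes H x"
    and le: "card (full_planes H x) \<le> 3"
  shows "l \<subseteq> h \<or> l' \<subseteq> h"
proof (rule ccontr)
  assume n: "\<not> (l \<subseteq> h \<or> l' \<subseteq> h)"
  have lL: "l \<in> L" "x \<in> l" "3 \<le> card l" "l' \<in> L" "x \<in> l'" "3 \<le> card l'" using l by (auto simp: full_lines_def)
  have hH: "h \<in> H" "x \<in> h" "4 \<le> card h" using h by (auto simp: full_planes_def)
  obtain g where g: "g \<in> H" "l \<subseteq> g" "l' \<subseteq> g"
    by (rule planar_lines_plane[OF lL(1,4) l(3) lL(2,5)])
  have "\<not> h \<subseteq> g" using planar_plane_antichain[of h g] g n hH by auto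
  then obtain z where z: "z \<in> h" "z \<notin> g" by blast
  then have zP: "z \<in> P" "z \<notin> l" "z \<notin> l'" using planar_plane_subset hH g by blast+
  obtain g1 where g1: "g1 \<in> H" "z \<in> g1" "l \<subseteq> g1" by (rule planar_line_point_plane[OF lL(1) zP(1,2)])
  obtain g2 where g2: "g2 \<in> H" "z \<in> g2" "l' \<subseteq> g2" by (rule planar_line_point_plane[OF lL(4) zP(1,3)])
  have card_g: "4 \<le> card g"
  proof -
    have "\<not> l' \<subseteq> l" using planar_line_antichain[of l' l] lL l by auto
    then obtain w where "w \<in> l'" "w \<notin> l" by blast
    then show ?thesis using full_plane_card[of l g w] lL g by blast
  qed
  \<comment> \<open>Two distinct lines through a point lie in only one plane, so equality would give
    \<open>g1 = g\<close> although \<open>z\<close> is outside \<open>g\<close>.\<close>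
  have "g1 \<noteq> g2"
  proof
    assume eq: "g1 = g2"
    have "\<not> covered L (l \<union> l')"
    proof
      assume "covered L (l \<union> l')"
      then obtain m where "m \<in> L" "l \<subseteq> m" "l' \<subseteq> m" by (auto simp: covered_def)
      then have "l = m" "l' = m" using planar_line_antichain lL by blast+
      then show False using l by simp
    qed
    moreover have "l \<union> l' \<subseteq> P" using lL planar_line_subset by auto
    moreover have "2 \<le> card (l \<union> l')"
      using card_mono[of "l \<union> l'" l] lL planar_finite calculation(2) finite_subset by fastforce
    ultimately have "g1 = g" using planar_planes_eq[of "l \<union> l'" g1 g] g1 g2 g eq by blast
    then show False using z g1 by simp
  qed
  then have "distinct [g, g1, g2, h]" using g g1 g2 z n by auto
  moreover have "{g, g1, g2, h} \<subseteq> full_planes H x"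
    using g g1 g2 h lL card_g full_plane_card[of l g1 z] full_plane_card[of l' g2 z] zP
    by (auto simp: full_planes_def)
  ultimately have "4 \<le> card (full_planes H x)" by (intro four_full_planes)
  with le show False by simp
qed

end

text \<open>Lines and planes are antichains, hence they are the maximal covered sets and are
  determined by coverage. Testing sets with two or more points is enough: every line is such a set,
  and so is every plane unless all points are collinear, in which case \<open>P\<close> is the only
  plane on both sides.\<close>

lemma planar_eqI:
  assumes pl: "planar_space (P, L, H)" "planar_space (P, L', H')"
    and eq: "\<And>Q. Q \<subseteq> P \<Longrightarrow> 2 \<le> card Q \<Longrightarrow>
      (covered L Q \<longleftrightarrow> covered L' Q) \<and> (covered H Q \<longleftrightarrow> covered H' Q)"
  shows "L = L' \<and> H = H'"
proof -
  have L: "L1 \<subseteq> L2" if pl: "planar_space (P, L1, H1)" "planar_space (P, L2, H2)"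
    and eq: "\<And>Q. Q \<subseteq> P \<Longrightarrow> 2 \<le> card Q \<Longrightarrow> covered L1 Q \<longleftrightarrow> covered L2 Q" for L1 L2 H1 H2
  proof
    fix l assume l: "l \<in> L1"
    note lP = planar_line_subset[OF pl(1) l] planar_line_card[OF pl(1) l]
    then obtain m where m: "m \<in> L2" "l \<subseteq> m" using eq[of l] l by (auto simp: covered_def)
    note mP = planar_line_subset[OF pl(2) m(1)] planar_line_card[OF pl(2) m(1)]
    then obtain l' where l': "l' \<in> L1" "m \<subseteq> l'" using eq[of m] m by (auto simp: covered_def)
    then have "l = l'" using planar_line_antichain[OF pl(1) l l'(1)] m by blast
    then show "l \<in> L2" using m l' by auto
  qed
  have LL: "L = L'" using L[OF pl] L[OF pl(2,1)] eq by blast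
  have HH: "H1 \<subseteq> H2" if pl: "planar_space (P, L, H1)" "planar_space (P, L, H2)"
    and eq: "\<And>Q. Q \<subseteq> P \<Longrightarrow> 2 \<le> card Q \<Longrightarrow> covered H1 Q \<longleftrightarrow> covered H2 Q" for H1 H2
  proof (cases "\<exists>x\<in>P. \<exists>y\<in>P. \<exists>z\<in>P. noncollinear3 L x y z")
    case False
    then show ?thesis using planar_plane_collinear[OF pl(1)] planar_plane_collinear[OF pl(2)] by blast
  next
    case True
    have card: "2 \<le> card h" if h: "planar_space (P, L, H0)" "h \<in> H0" for h H0
    proof -
      obtain a b c where abc: "a \<in> h" "b \<in> h" "c \<in> h" "noncollinear3 L a b c"
        using planar_plane_noncollinear[OF h(1)] h(2) True by metis
      have "card {a, b} \<le> card h"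
        using abc planar_plane_subset[OF h] planar_finite[OF h(1)] finite_subset
        by (intro card_mono) blast+
      then show ?thesis using abc by (auto simp: noncollinear3_def)
    qed
    show ?thesis
    proof
      fix h assume h: "h \<in> H1"
      note lP = planar_plane_subset[OF pl(1) h] card[OF pl(1) h]
      then obtain m where m: "m \<in> H2" "h \<subseteq> m" using eq[of h] h by (auto simp: covered_def)
      note mP = planar_plane_subset[OF pl(2) m(1)] card[OF pl(2) m(1)]
      then obtain h' where h': "h' \<in> H1" "m \<subseteq> h'" using eq[of m] m by (auto simp: covered_def)
      then have "h = h'" using planar_plane_antichain[OF pl(1) h h'(1)] m by blast
      then show "h \<in> H2" using m h' by auto
    qed
  qed
  have "H = H'" using HH[of H H'] HH[of H' H] pl eq LL by blast
  with LL show ?thesis by simp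
qed

section \<open>Realizations\<close>

context finite_field4
begin

text \<open>Sets with fewer than two points are ignored: the empty set lies on a projective line, but on
  no line of a space with at most one point. Hence the empty space has one realization.\<close>

definition matches :: "'p set \<Rightarrow> 'p set set \<Rightarrow> 'p set set \<Rightarrow> ('p \<Rightarrow> (nat \<Rightarrow> 'a) set) \<Rightarrow> bool" where
  "matches P L H \<sigma> \<longleftrightarrow> (\<forall>Q\<subseteq>P. 2 \<le> card Q \<longrightarrow>
     (covered L Q \<longleftrightarrow> collin (\<sigma> ` Q)) \<and> (covered H Q \<longleftrightarrow> coplan (\<sigma> ` Q)))"

definition inj_maps :: "'p set \<Rightarrow> ('p \<Rightarrow> (nat \<Rightarrow> 'a) set) set" where
  "inj_maps P = {\<sigma> \<in> P \<rightarrow>\<^sub>E proj_points R. inj_on \<sigma> P}"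

definition realizations :: "'p set \<Rightarrow> 'p set set \<Rightarrow> 'p set set \<Rightarrow> ('p \<Rightarrow> (nat \<Rightarrow> 'a) set) set" where
  "realizations P L H = {\<sigma> \<in> inj_maps P. matches P L H \<sigma>}"

lemma finite_inj_maps: "finite P \<Longrightarrow> finite (inj_maps P)"
  unfolding inj_maps_def
  by (rule finite_subset[of _ "P \<rightarrow>\<^sub>E proj_points R"])
    (blast, simp add: finite_PiE finite_subspaces4 del: One_nat_def)

lemma finite_realizations: "finite P \<Longrightarrow> finite (realizations P L H)"
  unfolding realizations_def by (rule finite_subset[OF _ finite_inj_maps]) blast

lemma matchesD:
  assumes "matches P L H \<sigma>" "Q \<subseteq> P" "2 \<le> card Q"
  shows "covered L Q \<longleftrightarrow> collin (\<sigma> ` Q)" "covered H Q \<longleftrightarrow> coplan (\<sigma> ` Q)"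
  using assms by (auto simp: matches_def)

lemma two_points_if_not_collin:
  assumes "\<And>x. x \<in> Q \<Longrightarrow> \<sigma> x \<in> proj_points R" "inj_on \<sigma> Q" "\<not> collin (\<sigma> ` Q)"
  obtains x y where "x \<in> Q" "y \<in> Q" "x \<noteq> y"
proof -
  have "\<exists>x\<in>Q. \<exists>y\<in>Q. x \<noteq> y"
  proof (rule ccontr)
    assume *: "\<not> (\<exists>x\<in>Q. \<exists>y\<in>Q. x \<noteq> y)"
    have "Q \<noteq> {}"
    proof
      assume "Q = {}"
      \<comment> \<open>The empty set is collinear as soon as there is a line at all; one is
        obtained by extending a point, itself found outside the zero subspace.\<close>
      obtain p where "p \<in> proj_points R"
        by (rule point_outside[of "{\<zero>\<^bsub>V4\<^esub>}" 0]) (auto simp: subspaces4_iff lin_def)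
      then obtain W where "W \<in> subspaces4 R (Suc 1)" by (rule subspaces4_extend) simp
      then have "W \<in> proj_lines R" by (simp add: numeral_2_eq_2)
      with \<open>Q = {}\<close> show False using assms(3) by (auto simp: collin_def)
    qed
    then obtain x where x: "x \<in> Q" by blast
    then have "\<sigma> ` Q \<subseteq> {\<sigma> x, \<sigma> x}" using * by auto
    then show False using assms(3) collin_mono[OF collin_pair[OF assms(1)[OF x] assms(1)[OF x]]] by simp
  qed
  then show ?thesis using that by blast
qed

lemma noncollinear_triple:
  assumes "\<And>x. x \<in> Q \<Longrightarrow> \<sigma> x \<in> proj_points R" "inj_on \<sigma> Q" "\<not> collin (\<sigma> ` Q)"
  obtains x y z where "x \<in> Q" "y \<in> Q" "z \<in> Q" "\<not> collin (\<sigma> ` {x, y, z})" "x \<noteq> y" "x \<noteq> z" "y \<noteq> z"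
proof -
  obtain x y where xy: "x \<in> Q" "y \<in> Q" "x \<noteq> y" using two_points_if_not_collin[OF assms] by blast
  then have pts: "\<sigma> x \<in> proj_points R" "\<sigma> y \<in> proj_points R" "\<sigma> x \<noteq> \<sigma> y"
    using assms by (auto simp: inj_on_def)
  let ?W = "sum4 (\<sigma> x) (\<sigma> y)"
  have W: "?W \<in> proj_lines R" using points_span_line[OF pts] .
  then obtain z where z: "z \<in> Q" "\<not> \<sigma> z \<subseteq> ?W" using assms(3) unfolding collin_def by blast
  have "\<not> collin (\<sigma> ` {x, y, z})"
  proof
    assume "collin (\<sigma> ` {x, y, z})"
    then obtain W' where "W' \<in> proj_lines R" "\<sigma> x \<subseteq> W'" "\<sigma> y \<subseteq> W'" "\<sigma> z \<subseteq> W'"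
      by (auto simp: collin_def)
    then show False using line_unique[OF pts, of W'] z by simp
  qed
  moreover have "x \<noteq> z" "y \<noteq> z" using z sum4_subspaces4_upper[OF pts(1,2)] by auto
  ultimately show ?thesis using that xy z by blast
qed

text \<open>The space is pulled back from projective space: its lines are the traces of projective
  lines with at least two points, and its planes are the noncollinear traces of projective
  planes.\<close>

lemma type_exists:
  fixes P :: "'p set"
  assumes fin: "finite P" and \<sigma>: "\<sigma> \<in> inj_maps P"
  obtains L H where "planar_space (P, L, H)" "matches P L H \<sigma>"
proof -
  have pt: "\<sigma> x \<in> proj_points R" if "x \<in> P" for x using \<sigma> that by (auto simp: inj_maps_def)
  have inj: "inj_on \<sigma> P" using \<sigma> by (simp add: inj_maps_def)
  have ne: "\<sigma> x \<noteq> \<sigma> y" if "x \<in> P" "y \<in> P" "x \<noteq> y" for x y using that inj by (auto simp: inj_on_def)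
  define pre where "pre W = {x \<in> P. \<sigma> x \<subseteq> W}" for W
  define L where "L = {l. 2 \<le> card l \<and> (\<exists>W\<in>proj_lines R. l = pre W)}"
  \<comment> \<open>A collinear set lies on many projective planes with different traces, so
    collinear traces must not count as planes; if everything is collinear, the convention
    \<open>H = {P}\<close> takes over.\<close>
  define H where "H = (if collin (\<sigma> ` P) then {P}
    else {h. \<not> collin (\<sigma> ` h) \<and> (\<exists>W\<in>proj_planes R. h = pre W)})"
  have pre_sub: "pre W \<subseteq> P" for W by (auto simp: pre_def)
  have covL: "covered L Q \<longleftrightarrow> collin (\<sigma> ` Q)" if Q: "Q \<subseteq> P" "2 \<le> card Q" for Q
  proof
    assume "collin (\<sigma> ` Q)"
    then obtain W where W: "W \<in> proj_lines R" "\<forall>p\<in>\<sigma> ` Q. p \<subseteq> W" by (auto simp: collin_def)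
    then have "Q \<subseteq> pre W" using Q by (auto simp: pre_def)
    moreover have "2 \<le> card (pre W)"
      using card_mono[OF finite_subset[OF pre_sub fin] \<open>Q \<subseteq> pre W\<close>] Q by simp
    ultimately show "covered L Q" using W by (auto simp: covered_def L_def)
  qed (auto simp: covered_def L_def collin_def pre_def)
  have nc: "noncollinear3 L x y z \<longleftrightarrow> x \<noteq> y \<and> x \<noteq> z \<and> y \<noteq> z \<and> \<not> collin (\<sigma> ` {x, y, z})"
    if "x \<in> P" "y \<in> P" "z \<in> P" for x y z
  proof (cases "x \<noteq> y \<and> x \<noteq> z \<and> y \<noteq> z")
    case True
    then have "card {x, y, z} = 3" by auto
    then have "covered L {x, y, z} \<longleftrightarrow> collin (\<sigma> ` {x, y, z})" using covL[of "{x, y, z}"] that by simp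
    then show ?thesis unfolding noncollinear3_def covered_def by simp
  next
    case False
    then show ?thesis unfolding noncollinear3_def by blast
  qed
  have line_eq: "l = pre (sum4 (\<sigma> x) (\<sigma> y))"
    if l: "l \<in> L" "x \<in> l" "y \<in> l" "x \<noteq> y" for l x y
  proof -
    obtain W where W: "W \<in> proj_lines R" "l = pre W" using l by (auto simp: L_def)
    have xy: "x \<in> P" "y \<in> P" "\<sigma> x \<subseteq> W" "\<sigma> y \<subseteq> W" using W l by (auto simp: pre_def)
    then show ?thesis
      using line_unique[OF pt[OF xy(1)] pt[OF xy(2)] ne[OF xy(1,2) l(4)] W(1) xy(3,4)] W by simp
  qed
  have lin: "linear_space P L"
    unfolding linear_space_def
  proof (intro conjI ballI impI)
    show "L \<subseteq> Pow P" using pre_sub by (auto simp: L_def)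
  next
    fix x y assume xy: "x \<in> P" "y \<in> P" "x \<noteq> y"
    have "covered L {x, y}" using covL[of "{x, y}"] xy collin_pair[OF pt pt] by simp
    then show "\<exists>!l. l \<in> L \<and> x \<in> l \<and> y \<in> l" using line_eq[of _ x y] xy by (auto simp: covered_def)
  qed (use fin in \<open>auto simp: L_def\<close>)
  have H_sub: "H \<subseteq> Pow P" using pre_sub by (auto simp: H_def)
  have planes: "\<exists>!h. h \<in> H \<and> {x, y, z} \<subseteq> h" if xyz: "x \<in> P" "y \<in> P" "z \<in> P" "noncollinear3 L x y z" for x y z
  proof -
    have c: "\<not> collin (\<sigma> ` {x, y, z})" using nc xyz by auto
    have cP: "\<not> collin (\<sigma> ` P)" using c collin_mono xyz by (metis image_mono insert_subset empty_subsetI)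
    have "coplan (insert (\<sigma> z) (\<sigma> ` {x, y}))"
      using coplan_insert[of "\<sigma> ` {x, y}" "\<sigma> z"] collin_pair[OF pt pt] xyz pt by simp
    then obtain W where W: "W \<in> proj_planes R" "\<forall>p\<in>\<sigma> ` {x, y, z}. p \<subseteq> W" by (auto simp: coplan_def)
    then have sub: "{x, y, z} \<subseteq> pre W" using xyz by (auto simp: pre_def)
    then have "\<not> collin (\<sigma> ` pre W)" using c collin_mono[OF _ image_mono[OF sub]] by auto
    then have H: "pre W \<in> H" using W cP by (auto simp: H_def)
    \<comment> \<open>Here noncollinearity of the three images enters: it makes the projective plane
      through them unique.\<close>
    have uniq: "h = pre W" if h: "h \<in> H" "{x, y, z} \<subseteq> h" for h
    proof -
      obtain W' where W': "W' \<in> proj_planes R" "h = pre W'" using h cP by (auto simp: H_def)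
      then have "\<forall>p\<in>\<sigma> ` {x, y, z}. p \<subseteq> W'" using h by (auto simp: pre_def)
      then have "W' = W" by (rule plane_unique[OF c W'(1) W(1) _ W(2)])
      with W' show ?thesis by simp
    qed
    show ?thesis
    proof (rule ex1I[of _ "pre W"])
      show "pre W \<in> H \<and> {x, y, z} \<subseteq> pre W" using H sub ..
      show "h = pre W" if "h \<in> H \<and> {x, y, z} \<subseteq> h" for h
        using that by (elim conjE) (rule uniq)
    qed
  qed
  have sub: "l \<subseteq> h" if hl: "h \<in> H" "l \<in> L" "x \<in> h \<inter> l" "y \<in> h \<inter> l" "x \<noteq> y" for h l x y
  proof (cases "collin (\<sigma> ` P)")
    case True
    then show ?thesis using hl lin by (auto simp: H_def linear_space_def)
  next
    case False
    then obtain W where W: "W \<in> proj_planes R" "h = pre W" using hl by (auto simp: H_def)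
    have l: "l = pre (sum4 (\<sigma> x) (\<sigma> y))" using line_eq hl by simp
    have "sum4 (\<sigma> x) (\<sigma> y) \<subseteq> W"
      using sum4_least[OF subspaces4_lin[OF W(1)]] W hl by (auto simp: pre_def)
    then show ?thesis using l W by (auto simp: pre_def)
  qed
  have last: "if \<exists>x\<in>P. \<exists>y\<in>P. \<exists>z\<in>P. noncollinear3 L x y z
      then \<forall>h\<in>H. \<exists>x\<in>h. \<exists>y\<in>h. \<exists>z\<in>h. noncollinear3 L x y z else H = {P}"
  proof (cases "collin (\<sigma> ` P)")
    case True
    have "\<not> noncollinear3 L x y z" if "x \<in> P" "y \<in> P" "z \<in> P" for x y z
      using collin_mono[OF True, of "\<sigma> ` {x, y, z}"] that nc by auto
    then show ?thesis using True by (auto simp: H_def)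
  next
    case False
    have tr: "\<exists>x\<in>Q. \<exists>y\<in>Q. \<exists>z\<in>Q. noncollinear3 L x y z" if Q: "Q \<subseteq> P" "\<not> collin (\<sigma> ` Q)" for Q
    proof -
      have "\<And>x. x \<in> Q \<Longrightarrow> \<sigma> x \<in> proj_points R" "inj_on \<sigma> Q" using Q pt inj inj_on_subset by blast+
      then obtain x y z where "x \<in> Q" "y \<in> Q" "z \<in> Q" "\<not> collin (\<sigma> ` {x, y, z})" "x \<noteq> y" "x \<noteq> z" "y \<noteq> z"
        using noncollinear_triple Q(2) by blast
      moreover from this have "noncollinear3 L x y z" using nc[of x y z] Q by auto
      ultimately show ?thesis by blast
    qed
    have "\<exists>x\<in>h. \<exists>y\<in>h. \<exists>z\<in>h. noncollinear3 L x y z" if "h \<in> H" for h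
      using tr[of h] that H_sub False by (auto simp: H_def)
    then show ?thesis using tr[of P] False by auto
  qed
  have "planar_space (P, L, H)"
    unfolding planar_space.simps
    by (intro conjI ballI impI) (fact lin H_sub last | erule (3) planes | erule (4) sub)+
  moreover have "matches P L H \<sigma>" unfolding matches_def
  proof (intro allI impI conjI)
    fix Q assume Q: "Q \<subseteq> P" "2 \<le> card Q"
    then show "covered L Q \<longleftrightarrow> collin (\<sigma> ` Q)" by (rule covL)
    show "covered H Q \<longleftrightarrow> coplan (\<sigma> ` Q)"
    proof (cases "collin (\<sigma> ` P)")
      case True
      then have "coplan (\<sigma> ` Q)" by (rule coplan_mono[OF collin_coplan image_mono[OF Q(1)]])
      then show ?thesis using True Q by (auto simp: covered_def H_def)
    next
      case False
      show ?thesis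
      proof
        assume "covered H Q"
        then show "coplan (\<sigma> ` Q)" using False by (auto simp: covered_def H_def coplan_def pre_def)
      next
        assume cop: "coplan (\<sigma> ` Q)"
        \<comment> \<open>A collinear \<open>Q\<close> need not span a plane. Since not everything
          is collinear, a point off its line can be added, and the larger set is noncollinear but
          still coplanar.\<close>
        have "\<exists>Q'. Q \<subseteq> Q' \<and> Q' \<subseteq> P \<and> \<not> collin (\<sigma> ` Q') \<and> coplan (\<sigma> ` Q')"
        proof (cases "collin (\<sigma> ` Q)")
          case True
          obtain a b where ab: "a \<in> Q" "b \<in> Q" "a \<noteq> b" using two_elements[OF Q(2)] .
          then have abP: "a \<in> P" "b \<in> P" using Q by auto
          obtain W where W: "W \<in> proj_lines R" "\<forall>p\<in>\<sigma> ` Q. p \<subseteq> W" using True by (auto simp: collin_def)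
          have "\<not> (\<forall>p\<in>\<sigma> ` P. p \<subseteq> W)" using False W(1) by (metis collin_def)
          then obtain z where z: "z \<in> P" "\<not> \<sigma> z \<subseteq> W" by auto
          have "\<not> collin (\<sigma> ` insert z Q)"
          proof
            assume "collin (\<sigma> ` insert z Q)"
            then obtain W' where W': "W' \<in> proj_lines R" "\<forall>p\<in>\<sigma> ` insert z Q. p \<subseteq> W'" by (auto simp: collin_def)
            note u = line_unique[OF pt[OF abP(1)] pt[OF abP(2)] ne[OF abP ab(3)]]
            have "W = sum4 (\<sigma> a) (\<sigma> b)" by (rule u) (use W ab in auto)
            moreover have "W' = sum4 (\<sigma> a) (\<sigma> b)" by (rule u) (use W' ab in auto)
            ultimately have "W = W'" by simp
            then show False using z W' by auto
          qed
          moreover have "coplan (\<sigma> ` insert z Q)" using coplan_insert[OF True pt[OF z(1)]] by simp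
          ultimately show ?thesis using z Q by blast
        qed (use cop Q in blast)
        then obtain Q' where Q': "Q \<subseteq> Q'" "Q' \<subseteq> P" "\<not> collin (\<sigma> ` Q')" "coplan (\<sigma> ` Q')" by blast
        then obtain W where W: "W \<in> proj_planes R" "\<forall>p\<in>\<sigma> ` Q'. p \<subseteq> W" by (auto simp: coplan_def)
        then have "Q' \<subseteq> pre W" using Q' by (auto simp: pre_def)
        then have "\<not> collin (\<sigma> ` pre W)" using Q'(3) collin_mono[OF _ image_mono[of Q' "pre W" \<sigma>]] by auto
        then have "pre W \<in> H" using W False by (auto simp: H_def)
        then show "covered H Q" using \<open>Q' \<subseteq> pre W\<close> Q' by (auto simp: covered_def)
      qed
    qed
  qed
  ultimately show ?thesis by (rule that)
qed

end

section \<open>Extending a realization by a point of small index\<close>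

definition proper_planes :: "'p set set \<Rightarrow> 'p set set \<Rightarrow> 'p \<Rightarrow> 'p set set" where
  "proper_planes L H x = {h \<in> full_planes H x. \<not> covered L (h - {x})}"

text \<open>The dimension of the projective subspace of admissible positions of \<open>x\<close>. A full plane meeting the
  other points in a collinear set imposes no condition, which is why only proper planes count.\<close>

definition freedom :: "'p set set \<Rightarrow> 'p set set \<Rightarrow> 'p \<Rightarrow> nat" where
  "freedom L H x =
     (if full_lines L x = {} then 3 - card (proper_planes L H x)
      else if card (full_lines L x) = 1 \<and> (\<forall>l\<in>full_lines L x. \<forall>h\<in>proper_planes L H x. l \<subseteq> h) then 1
      else 0)"

definition removable :: "'p set set \<Rightarrow> 'p set set \<Rightarrow> 'p \<Rightarrow> bool" where
  "removable L H x \<longleftrightarrow> \<not> (full_plane_index H x \<ge> 4 \<or> full_line_index L x \<ge> 3 \<or>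
     (full_plane_index H x = 3 \<and> full_line_index L x = 0))"

lemma full_line_index_eq: "full_line_index L x = card (full_lines L x)"
  by (simp add: full_line_index_def full_lines_def)

lemma full_plane_index_eq: "full_plane_index H x = card (full_planes H x)"
  by (simp add: full_plane_index_def full_planes_def)

context finite_field4
begin

text \<open>Positions occupied by other points are included on purpose: then the set is all of a
  projective subspace, and the occupied positions are subtracted afterwards.\<close>

definition extensions ::
    "'p set set \<Rightarrow> 'p set set \<Rightarrow> 'p \<Rightarrow> ('p \<Rightarrow> (nat \<Rightarrow> 'a) set) \<Rightarrow> (nat \<Rightarrow> 'a) set set" where
  "extensions L H x \<sigma> = {p \<in> proj_points R.
     (\<forall>l\<in>full_lines L x. collin (insert p (\<sigma> ` (l - {x})))) \<and>
     (\<forall>h\<in>full_planes H x. coplan (insert p (\<sigma> ` (h - {x}))))}"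

text \<open>For a fixed realization \<open>\<sigma>\<close> of the deleted space, full lines and
  proper planes through \<open>x\<close> become projective lines \<open>WL\<close> and planes
  \<open>WH\<close> that the new point must lie on. The type of the deleted space determines how
  these meet. Without full lines there are at most two planes, and they are distinct. With one full
  line, all planes contain it except at most one, which cuts it in a point. Two full lines meet in a
  point that lies on every plane.\<close>

lemma card_extensions:
  fixes P :: "'p set"
  assumes pl: "planar_space (P, L, H)" and x: "x \<in> P" and rem: "removable L H x"
    and \<sigma>: "\<sigma> \<in> realizations (P - {x}) L H"
  shows "card (extensions L H x \<sigma>) = (\<Sum>i<Suc (freedom L H x). card (carrier R) ^ i)"
proof -
  let ?FL = "full_lines L x" and ?FH = "full_planes H x" and ?PH = "proper_planes L H x"
  let ?q = "card (carrier R)"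
  have le: "card ?FL \<le> 2" "card ?FH \<le> 3" "?FL = {} \<Longrightarrow> card ?FH \<le> 2"
    using rem by (auto simp: removable_def full_line_index_eq full_plane_index_eq)
  note fin = finite_full[OF pl, of x]
  have finP: "finite P" using planar_finite[OF pl] .
  have PHsub: "?PH \<subseteq> ?FH" by (auto simp: proper_planes_def)
  have m: "matches (P - {x}) L H \<sigma>" and pt: "\<And>y. y \<in> P - {x} \<Longrightarrow> \<sigma> y \<in> proj_points R"
    and inj: "inj_on \<sigma> (P - {x})" using \<sigma> by (auto simp: realizations_def inj_maps_def)
  have ne: "\<sigma> y \<noteq> \<sigma> z" if "y \<in> P - {x}" "z \<in> P - {x}" "y \<noteq> z" for y z
    using that inj by (auto simp: inj_on_def)
  have FL: "l \<in> L" "x \<in> l" "3 \<le> card l" "l - {x} \<subseteq> P - {x}" "2 \<le> card (l - {x})" if "l \<in> ?FL" for l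
    using that planar_line_subset[OF pl] by (auto simp: full_lines_def)
  have FH: "h \<in> H" "x \<in> h" "4 \<le> card h" "h - {x} \<subseteq> P - {x}" "2 \<le> card (h - {x})" if "h \<in> ?FH" for h
    using that planar_plane_subset[OF pl] by (auto simp: full_planes_def)
  have two_pts: thesis if A: "A \<subseteq> P - {x}" "2 \<le> card A"
    and *: "\<And>a b. a \<in> A \<Longrightarrow> b \<in> A \<Longrightarrow> \<sigma> a \<in> proj_points R \<Longrightarrow> \<sigma> b \<in> proj_points R \<Longrightarrow>
      \<sigma> a \<noteq> \<sigma> b \<Longrightarrow> thesis"
    for A thesis
  proof -
    obtain a b where ab: "a \<in> A" "b \<in> A" "a \<noteq> b" using two_elements[OF A(2)] .
    then have "a \<in> P - {x}" "b \<in> P - {x}" using A(1) by auto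
    then show ?thesis using *[OF ab(1,2) pt pt ne] ab(3) by blast
  qed
  have "\<exists>W\<in>proj_lines R. (\<forall>y\<in>l - {x}. \<sigma> y \<subseteq> W) \<and>
      (\<forall>p\<in>proj_points R. collin (insert p (\<sigma> ` (l - {x}))) \<longleftrightarrow> p \<subseteq> W)" if l: "l \<in> ?FL" for l
  proof -
    have "collin (\<sigma> ` (l - {x}))"
      using matchesD(1)[OF m FL(4,5)[OF l]] FL(1)[OF l] by (auto simp: covered_def)
    then obtain W where W: "W \<in> proj_lines R" "\<forall>y\<in>l - {x}. \<sigma> y \<subseteq> W" by (auto simp: collin_def)
    obtain a b where ab: "a \<in> l - {x}" "b \<in> l - {x}" "\<sigma> a \<in> proj_points R" "\<sigma> b \<in> proj_points R" "\<sigma> a \<noteq> \<sigma> b"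
      by (rule two_pts[OF FL(4,5)[OF l]])
    have "p \<subseteq> W" if "collin (insert p (\<sigma> ` (l - {x})))" for p
    proof -
      obtain W' where W': "W' \<in> proj_lines R" "\<forall>y\<in>l - {x}. \<sigma> y \<subseteq> W'" "p \<subseteq> W'"
        using \<open>collin (insert p (\<sigma> ` (l - {x})))\<close> by (auto simp: collin_def)
      have "W = W'" using line_unique[OF ab(3-5)] W W' ab(1,2) by metis
      with W' show ?thesis by simp
    qed
    moreover have "collin (insert p (\<sigma> ` (l - {x})))" if "p \<subseteq> W" for p
      using W that unfolding collin_def by blast
    ultimately show ?thesis using W by blast
  qed
  then obtain WL where WL: "\<And>l. l \<in> ?FL \<Longrightarrow> WL l \<in> proj_lines R"
    "\<And>l y. l \<in> ?FL \<Longrightarrow> y \<in> l - {x} \<Longrightarrow> \<sigma> y \<subseteq> WL l"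
    "\<And>l p. l \<in> ?FL \<Longrightarrow> p \<in> proj_points R \<Longrightarrow> collin (insert p (\<sigma> ` (l - {x}))) \<longleftrightarrow> p \<subseteq> WL l"
    by metis
  have "\<exists>W\<in>proj_planes R. (\<forall>y\<in>h - {x}. \<sigma> y \<subseteq> W) \<and>
      (\<forall>p\<in>proj_points R. coplan (insert p (\<sigma> ` (h - {x}))) \<longleftrightarrow> p \<subseteq> W)" if h: "h \<in> ?PH" for h
  proof -
    have hF: "h \<in> ?FH" "\<not> covered L (h - {x})" using h by (auto simp: proper_planes_def)
    have "coplan (\<sigma> ` (h - {x}))"
      using matchesD(2)[OF m FH(4,5)[OF hF(1)]] FH(1)[OF hF(1)] by (auto simp: covered_def)
    then obtain W where W: "W \<in> proj_planes R" "\<forall>y\<in>h - {x}. \<sigma> y \<subseteq> W" by (auto simp: coplan_def)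
    have nc: "\<not> collin (\<sigma> ` (h - {x}))" using matchesD(1)[OF m FH(4,5)[OF hF(1)]] hF(2) by simp
    have "p \<subseteq> W" if "coplan (insert p (\<sigma> ` (h - {x})))" for p
    proof -
      obtain W' where W': "W' \<in> proj_planes R" "\<forall>y\<in>h - {x}. \<sigma> y \<subseteq> W'" "p \<subseteq> W'"
        using \<open>coplan (insert p (\<sigma> ` (h - {x})))\<close> by (auto simp: coplan_def)
      have "W = W'" by (rule plane_unique[OF nc W(1) W'(1)]) (use W W' in auto)
      with W' show ?thesis by simp
    qed
    moreover have "coplan (insert p (\<sigma> ` (h - {x})))" if "p \<subseteq> W" for p
      using W that unfolding coplan_def by blast
    ultimately show ?thesis using W by blast
  qed
  then obtain WH where WH: "\<And>h. h \<in> ?PH \<Longrightarrow> WH h \<in> proj_planes R"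
    "\<And>h y. h \<in> ?PH \<Longrightarrow> y \<in> h - {x} \<Longrightarrow> \<sigma> y \<subseteq> WH h"
    "\<And>h p. h \<in> ?PH \<Longrightarrow> p \<in> proj_points R \<Longrightarrow> coplan (insert p (\<sigma> ` (h - {x}))) \<longleftrightarrow> p \<subseteq> WH h"
    by metis
  \<comment> \<open>Without \<open>x\<close> such a plane is collinear, and a line together with any
    point is coplanar.\<close>
  have improper: "coplan (insert p (\<sigma> ` (h - {x})))" if "h \<in> ?FH" "h \<notin> ?PH" "p \<in> proj_points R" for h p
    using that coplan_insert matchesD(1)[OF m FH(4,5)[OF that(1)]] by (auto simp: proper_planes_def)
  have e1: "(\<forall>l\<in>?FL. collin (insert p (\<sigma> ` (l - {x})))) \<longleftrightarrow> (\<forall>l\<in>?FL. p \<subseteq> WL l)"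
    if p: "p \<in> proj_points R" for p
    using WL(3)[OF _ p] by (intro ball_cong) simp_all
  have e2: "(\<forall>h\<in>?FH. coplan (insert p (\<sigma> ` (h - {x})))) \<longleftrightarrow> (\<forall>h\<in>?PH. p \<subseteq> WH h)"
    if p: "p \<in> proj_points R" for p
    using WH(3)[OF _ p] improper[OF _ _ p] PHsub by (metis subsetD)
  have ext: "extensions L H x \<sigma> = {p \<in> proj_points R. (\<forall>l\<in>?FL. p \<subseteq> WL l) \<and> (\<forall>h\<in>?PH. p \<subseteq> WH h)}"
    unfolding extensions_def by (rule Collect_cong) (metis e1 e2)
  \<comment> \<open>Every case below only has to name a subspace of the right vector dimension, one
    more than the projective one, that cuts out the admissible positions.\<close>
  have count: ?thesis if "U \<in> subspaces4 R (Suc (freedom L H x))"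
    "\<And>p. p \<in> proj_points R \<Longrightarrow> p \<subseteq> U \<longleftrightarrow> (\<forall>l\<in>?FL. p \<subseteq> WL l) \<and> (\<forall>h\<in>?PH. p \<subseteq> WH h)" for U
  proof -
    have "extensions L H x \<sigma> = {p \<in> proj_points R. p \<subseteq> U}" unfolding ext using that(2) by blast
    then show ?thesis using card_points_in[OF that(1)] by simp
  qed
  \<comment> \<open>A proper plane is still determined by its points other than
    \<open>x\<close>.\<close>
  have merge: "h1 = h2" if h: "h1 \<in> ?PH" "h2 \<in> H" "h1 - {x} \<subseteq> h2" for h1 h2
  proof -
    have hF: "h1 \<in> ?FH" "\<not> covered L (h1 - {x})" using h by (auto simp: proper_planes_def)
    show ?thesis
      by (rule planar_planes_eq[OF pl _ FH(5)[OF hF(1)] hF(2) FH(1)[OF hF(1)] h(2) _ h(3)])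
        (use FH(4)[OF hF(1)] in auto)
  qed
  \<comment> \<open>Otherwise the points of \<open>l\<close> and \<open>h\<close> other than
    \<open>x\<close> would have coplanar images. As \<open>\<sigma>\<close> is strong they would lie
    in one plane of the space, which is \<open>h\<close> by \<open>merge\<close>.\<close>
  have transversal: "\<not> WL l \<subseteq> WH h" if l: "l \<in> ?FL" and h: "h \<in> ?PH" and n: "\<not> l \<subseteq> h" for l h
  proof
    assume sub: "WL l \<subseteq> WH h"
    have hF: "h \<in> ?FH" using h PHsub by auto
    let ?Q = "(l - {x}) \<union> (h - {x})"
    have Q: "?Q \<subseteq> P - {x}" using FL(4)[OF l] FH(4)[OF hF] by blast
    have "card (h - {x}) \<le> card ?Q" by (intro card_mono finite_subset[OF Q]) (use finP in auto)
    then have Q2: "2 \<le> card ?Q" using FH(5)[OF hF] by simp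
    have "\<forall>p\<in>\<sigma> ` ?Q. p \<subseteq> WH h" using WL(2)[OF l] WH(2)[OF h] sub by blast
    then have "coplan (\<sigma> ` ?Q)" using WH(1)[OF h] unfolding coplan_def by blast
    then have "covered H ?Q" using matchesD(2)[OF m Q Q2] by simp
    then obtain g where g: "g \<in> H" "l - {x} \<subseteq> g" "h - {x} \<subseteq> g" by (auto simp: covered_def)
    then have "h = g" using merge[OF h] by blast
    then show False using n g FL(2)[OF l] FH(2)[OF hF] by blast
  qed
  have contained: "WL l \<subseteq> WH h" if l: "l \<in> ?FL" and h: "h \<in> ?PH" and n: "l \<subseteq> h" for l h
  proof -
    obtain a b where ab: "a \<in> l - {x}" "b \<in> l - {x}" "\<sigma> a \<in> proj_points R" "\<sigma> b \<in> proj_points R" "\<sigma> a \<noteq> \<sigma> b"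
      by (rule two_pts[OF FL(4,5)[OF l]])
    have "WL l = sum4 (\<sigma> a) (\<sigma> b)"
      by (rule line_unique[OF ab(3-5) WL(1)[OF l]]) (use WL(2)[OF l] ab in auto)
    moreover have "\<sigma> a \<subseteq> WH h" "\<sigma> b \<subseteq> WH h" using WH(2)[OF h] ab n by auto
    ultimately show ?thesis using sum4_least[OF subspaces4_lin[OF WH(1)[OF h]]] by simp
  qed
  consider (0) "card ?FL = 0" | (1) "card ?FL = 1" | (2) "card ?FL = 2" using le(1) by linarith
  then show ?thesis
  proof cases
    case 0
    then have FL0: "?FL = {}" using fin by simp
    then have fr: "freedom L H x = 3 - card ?PH" by (simp add: freedom_def)
    have "card ?PH \<le> 2" using card_mono[OF fin(2) PHsub] le(3)[OF FL0] by simp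
    then consider (a) "card ?PH = 0" | (b) "card ?PH = 1" | (c) "card ?PH = 2" by linarith
    then show ?thesis
    proof cases
      case a
      then have "?PH = {}" using finite_subset[OF PHsub fin(2)] by simp
      then show ?thesis using fr FL0 subspaces4_4 subspaces4_carrier
        by (intro count[of "carrier V4"]) auto
    next
      case b
      then obtain h where h: "?PH = {h}" by (auto simp: card_1_singleton_iff)
      then show ?thesis using fr FL0 WH(1)[of h]
        by (intro count[of "WH h"]) (auto simp: eval_nat_numeral)
    next
      case c
      then obtain h h' where h: "?PH = {h, h'}" "h \<noteq> h'" by (auto simp: card_2_iff)
      then have hP: "h \<in> ?PH" "h' \<in> ?PH" by auto
      \<comment> \<open>Equal images would put the points of both planes other than \<open>x\<close>
        into one plane of the space, and \<open>merge\<close> would identify both with it.\<close>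
      have "WH h \<noteq> WH h'"
      proof
        assume eq: "WH h = WH h'"
        have hF: "h \<in> ?FH" "h' \<in> ?FH" using hP PHsub by auto
        let ?Q = "(h' - {x}) \<union> (h - {x})"
        have Q: "?Q \<subseteq> P - {x}" using FH(4)[OF hF(1)] FH(4)[OF hF(2)] by blast
        have "card (h - {x}) \<le> card ?Q" by (intro card_mono finite_subset[OF Q]) (use finP in auto)
        then have Q2: "2 \<le> card ?Q" using FH(5)[OF hF(1)] by simp
        have "\<forall>p\<in>\<sigma> ` ?Q. p \<subseteq> WH h" using WH(2)[OF hP(1)] WH(2)[OF hP(2)] eq by blast
        then have "coplan (\<sigma> ` ?Q)" using WH(1)[OF hP(1)] unfolding coplan_def by blast
        then have "covered H ?Q" using matchesD(2)[OF m Q Q2] by simp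
        then obtain g where g: "g \<in> H" "h' - {x} \<subseteq> g" "h - {x} \<subseteq> g" by (auto simp: covered_def)
        then have "h = g" "h' = g" using merge hP by blast+
        then show False using h by simp
      qed
      then have "WH h \<inter> WH h' \<in> proj_lines R" using planes_meet WH(1) hP by blast
      then show ?thesis using fr FL0 h
        by (intro count[of "WH h \<inter> WH h'"]) (auto simp: eval_nat_numeral)
    qed
  next
    case 1
    then obtain l where l: "?FL = {l}" by (auto simp: card_1_singleton_iff)
    then have lF: "l \<in> ?FL" by simp
    show ?thesis
    proof (cases "\<forall>h\<in>?PH. l \<subseteq> h")
      case True
      then have fr: "freedom L H x = 1" using 1 l by (simp add: freedom_def)
      show ?thesis
      proof (rule count[of "WL l"])
        show "WL l \<in> subspaces4 R (Suc (freedom L H x))" using fr WL(1)[OF lF] by (simp add: eval_nat_numeral)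
        show "p \<subseteq> WL l \<longleftrightarrow> (\<forall>l\<in>?FL. p \<subseteq> WL l) \<and> (\<forall>h\<in>?PH. p \<subseteq> WH h)" for p
          unfolding l using contained[OF lF] True by (simp, meson order_trans)
      qed
    next
      case False
      then obtain h where h: "h \<in> ?PH" "\<not> l \<subseteq> h" by blast
      have fr: "freedom L H x = 0" using 1 l h by (auto simp: freedom_def)
      \<comment> \<open>At most one full plane fails to contain \<open>l\<close>, and
        \<open>h\<close> is already one, so no further plane constrains the line.\<close>
      have other: "l \<subseteq> h'" if "h' \<in> ?PH" "h' \<noteq> h" for h'
        using at_most_one_transversal_plane[OF pl lF _ _ h(2) _ le(2)] that h(1) PHsub by (metis subsetD)
      have "WL l \<inter> WH h \<in> proj_points R"
        using line_plane_meet[OF WL(1)[OF lF] WH(1)[OF h(1)] transversal[OF lF h]] .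
      moreover have "p \<subseteq> WL l \<inter> WH h \<longleftrightarrow> (\<forall>l\<in>?FL. p \<subseteq> WL l) \<and> (\<forall>h\<in>?PH. p \<subseteq> WH h)" for p
      proof
        assume p: "p \<subseteq> WL l \<inter> WH h"
        have "p \<subseteq> WH h'" if "h' \<in> ?PH" for h'
        proof (cases "h' = h")
          case False
          then show ?thesis using contained[OF lF that other[OF that]] p by (meson le_inf_iff order_trans)
        qed (use p in simp)
        then show "(\<forall>l\<in>?FL. p \<subseteq> WL l) \<and> (\<forall>h\<in>?PH. p \<subseteq> WH h)" using p by (simp add: l)
      qed (use h in \<open>simp add: l\<close>)
      ultimately show ?thesis using fr by (intro count[of "WL l \<inter> WH h"]) auto
    qed
  next
    case 2
    then obtain l l' where l: "?FL = {l, l'}" "l \<noteq> l'" by (auto simp: card_2_iff)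
    then have lF: "l \<in> ?FL" "l' \<in> ?FL" by auto
    have fr: "freedom L H x = 0" using 2 l by (auto simp: freedom_def)
    let ?Q = "(l - {x}) \<union> (l' - {x})"
    have Q: "?Q \<subseteq> P - {x}" using FL(4)[OF lF(1)] FL(4)[OF lF(2)] by blast
    have "card (l - {x}) \<le> card ?Q" by (intro card_mono finite_subset[OF Q]) (use finP in auto)
    then have Q2: "2 \<le> card ?Q" using FL(5)[OF lF(1)] by simp
    \<comment> \<open>A common image would make the remaining points of both lines collinear in the
      space; each line has two such points, so both would be the same line.\<close>
    have neW: "WL l \<noteq> WL l'"
    proof
      assume eq: "WL l = WL l'"
      have "\<forall>p\<in>\<sigma> ` ?Q. p \<subseteq> WL l" using WL(2)[OF lF(1)] WL(2)[OF lF(2)] eq by blast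
      then have "collin (\<sigma> ` ?Q)" using WL(1)[OF lF(1)] unfolding collin_def by blast
      then have "covered L ?Q" using matchesD(1)[OF m Q Q2] by simp
      then obtain g where g: "g \<in> L" "l - {x} \<subseteq> g" "l' - {x} \<subseteq> g" by (auto simp: covered_def)
      have "k = g" if k: "k \<in> ?FL" "k - {x} \<subseteq> g" for k
      proof -
        obtain a b where "a \<in> k - {x}" "b \<in> k - {x}" "a \<noteq> b" using two_elements[OF FL(5)[OF k(1)]] .
        then show ?thesis using planar_line_unique[OF pl FL(1)[OF k(1)] g(1), of a b] k by blast
      qed
      then show False using g lF l by blast
    qed
    \<comment> \<open>In the space the two lines meet in \<open>x\<close> and so span a plane. The
      deleted space still records this, which makes \<open>WL l\<close> and \<open>WL l'\<close>
      coplanar and hence concurrent.\<close>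
    obtain g where g: "g \<in> H" "l \<subseteq> g" "l' \<subseteq> g"
      by (rule planar_lines_plane[OF pl FL(1)[OF lF(1)] FL(1)[OF lF(2)] l(2) FL(2)[OF lF(1)] FL(2)[OF lF(2)]])
    have "covered H ?Q" using g by (auto simp: covered_def)
    then have "coplan (\<sigma> ` ?Q)" using matchesD(2)[OF m Q Q2] by simp
    then obtain W where W: "W \<in> proj_planes R" "\<forall>y\<in>?Q. \<sigma> y \<subseteq> W" by (auto simp: coplan_def)
    have "WL k \<subseteq> W" if k: "k \<in> ?FL" "k - {x} \<subseteq> ?Q" for k
    proof -
      obtain a b where ab: "a \<in> k - {x}" "b \<in> k - {x}" "\<sigma> a \<in> proj_points R" "\<sigma> b \<in> proj_points R" "\<sigma> a \<noteq> \<sigma> b"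
        by (rule two_pts[OF FL(4,5)[OF k(1)]])
      have "WL k = sum4 (\<sigma> a) (\<sigma> b)"
        by (rule line_unique[OF ab(3-5) WL(1)[OF k(1)]]) (use WL(2)[OF k(1)] ab in auto)
      moreover have "\<sigma> a \<subseteq> W" "\<sigma> b \<subseteq> W" using W(2) ab k by auto
      ultimately show ?thesis using sum4_least[OF subspaces4_lin[OF W(1)]] by simp
    qed
    then have sub: "WL l \<subseteq> W" "WL l' \<subseteq> W" using lF by auto
    have "WL l \<inter> WL l' \<in> proj_points R"
      using lines_meet[OF WL(1)[OF lF(1)] WL(1)[OF lF(2)] neW W(1) sub] .
    moreover have "p \<subseteq> WL l \<inter> WL l' \<longleftrightarrow> (\<forall>l\<in>?FL. p \<subseteq> WL l) \<and> (\<forall>h\<in>?PH. p \<subseteq> WH h)" for p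
    proof
      assume p: "p \<subseteq> WL l \<inter> WL l'"
      \<comment> \<open>Every full plane contains one of the two lines, so the meeting point
        satisfies its condition automatically.\<close>
      have "p \<subseteq> WH h" if h: "h \<in> ?PH" for h
      proof -
        have "h \<in> ?FH" using h PHsub by blast
        then have "l \<subseteq> h \<or> l' \<subseteq> h" using plane_contains_full_line[OF pl lF l(2) _ le(2)] by blast
        then show ?thesis using contained[OF lF(1) h] contained[OF lF(2) h] p
          by (meson le_inf_iff order_trans)
      qed
      then show "(\<forall>l\<in>?FL. p \<subseteq> WL l) \<and> (\<forall>h\<in>?PH. p \<subseteq> WH h)" using p by (simp add: l)
    qed (simp add: l)
    ultimately show ?thesis using fr by (intro count[of "WL l \<inter> WL l'"]) auto
  qed
qed

end

section \<open>The recursion for the numbers of realizations\<close>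

text \<open>Comparison along a map \<open>\<psi>\<close> allows the points to be renamed after a
  deletion; \<open>\<psi> = id\<close> compares two spaces on the same points.\<close>

definition same_type ::
    "'p set \<Rightarrow> 'p set set \<Rightarrow> 'p set set \<Rightarrow> ('p \<Rightarrow> 'r) \<Rightarrow> 'r set set \<Rightarrow> 'r set set \<Rightarrow> bool" where
  "same_type P' L' H' \<psi> L H \<longleftrightarrow> (\<forall>Q\<subseteq>P'. 2 \<le> card Q \<longrightarrow>
     (covered L' Q \<longleftrightarrow> covered L (\<psi> ` Q)) \<and> (covered H' Q \<longleftrightarrow> covered H (\<psi> ` Q)))"

definition transports ::
    "'p set \<Rightarrow> ('p \<Rightarrow> 'r) \<Rightarrow> 'r set set \<Rightarrow> 'r set set \<Rightarrow> ('p set set \<times> 'p set set) set" where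
  "transports P' \<psi> L H = {(L', H'). planar_space (P', L', H') \<and> same_type P' L' H' \<psi> L H}"

definition degenerates :: "'p set \<Rightarrow> 'p set set \<Rightarrow> 'p set set \<Rightarrow> 'p set set \<Rightarrow> 'p set set \<Rightarrow> bool" where
  "degenerates P L H L' H' \<longleftrightarrow> (\<forall>Q\<subseteq>P. 2 \<le> card Q \<longrightarrow>
     (covered L Q \<longrightarrow> covered L' Q) \<and> (covered H Q \<longrightarrow> covered H' Q))"

text \<open>The types that a realization of the deleted space can acquire when \<open>x\<close> is
  put at a free admissible position: unchanged away from \<open>x\<close>, and at least as dependent
  as before. The space itself is among them.\<close>

definition specializations ::
    "'p set \<Rightarrow> 'p set set \<Rightarrow> 'p set set \<Rightarrow> 'p \<Rightarrow> ('p set set \<times> 'p set set) set" where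
  "specializations P L H x = {(L', H'). planar_space (P, L', H') \<and>
     same_type (P - {x}) L' H' id L H \<and> degenerates P L H L' H'}"

text \<open>The combinatorial counterpart of occupied admissible positions: in every realization of
  the deleted space exactly these points sit at a position admissible for \<open>x\<close>.\<close>

definition collisions :: "'p set \<Rightarrow> 'p set set \<Rightarrow> 'p set set \<Rightarrow> 'p \<Rightarrow> 'p set" where
  "collisions P L H x = {y \<in> P - {x}. (\<forall>l\<in>full_lines L x. covered L (insert y (l - {x}))) \<and>
     (\<forall>h\<in>full_planes H x. covered H (insert y (h - {x})))}"

definition free_types :: "nat \<Rightarrow> (nat set set \<times> nat set set) set" where
  "free_types n = {(L, H). planar_space ({..<n}, L, H) \<and> (\<forall>Q\<subseteq>{..<n}. card Q = 4 \<longrightarrow> \<not> covered H Q)}"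

lemma finite_planar_pairs: "finite P \<Longrightarrow> finite {(L, H). planar_space (P, L, H)}"
  by (rule finite_subset[of _ "Pow (Pow P) \<times> Pow (Pow P)"])
     (auto simp del: planar_space.simps dest: planar_line_subset planar_plane_subset)

lemma card_le_2_subset_pair:
  assumes "finite A" "card A \<le> 2" "A \<subseteq> B" "c \<in> B"
  obtains a b where "a \<in> B" "b \<in> B" "A \<subseteq> {a, b}"
proof -
  consider "card A = 0" | "card A = 1" | "card A = 2" using assms(2) by linarith
  then show ?thesis
  proof cases
    case 1 then show ?thesis using assms that[of c c] by simp
  next
    case 2 then obtain a where "A = {a}" by (auto simp: card_1_singleton_iff)
    then show ?thesis using assms that[of a a] by simp
  next
    case 3 then obtain a b where "A = {a, b}" by (auto simp: card_2_iff)
    then show ?thesis using assms that[of a b] by simp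
  qed
qed

context finite_field4
begin

definition nreal :: "'p set \<Rightarrow> 'p set set \<Rightarrow> 'p set set \<Rightarrow> nat" where
  "nreal P L H = card (realizations P L H)"

lemma inj_maps_pt: "\<sigma> \<in> inj_maps P \<Longrightarrow> x \<in> P \<Longrightarrow> \<sigma> x \<in> proj_points R"
  by (auto simp: inj_maps_def)

lemma inj_maps_inj: "\<sigma> \<in> inj_maps P \<Longrightarrow> inj_on \<sigma> P"
  by (simp add: inj_maps_def)

section \<open>Counting injective maps by type\<close>

lemma matches_cong:
  assumes "\<And>y. y \<in> P \<Longrightarrow> \<sigma> y = \<tau> y" shows "matches P L H \<sigma> \<longleftrightarrow> matches P L H \<tau>"
proof -
  have "\<sigma> ` Q = \<tau> ` Q" if "Q \<subseteq> P" for Q using that assms by (intro image_cong) auto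
  then show ?thesis unfolding matches_def by (metis (no_types, lifting))
qed

lemma inj_maps_relabel:
  assumes "\<sigma> \<in> inj_maps P" "bij_betw \<psi> P' P"
  shows "restrict (\<sigma> \<circ> \<psi>) P' \<in> inj_maps P'"
proof -
  have "inj_on (\<sigma> \<circ> \<psi>) P'" using assms by (intro comp_inj_on) (auto simp: bij_betw_def inj_maps_def)
  moreover have "\<psi> y \<in> P" if "y \<in> P'" for y using that assms by (auto simp: bij_betw_def)
  ultimately show ?thesis using assms by (auto simp: inj_maps_def)
qed

lemma matches_relabel:
  assumes "matches P L H \<sigma>" "bij_betw \<psi> P' P" "same_type P' L' H' \<psi> L H"
  shows "matches P' L' H' (restrict (\<sigma> \<circ> \<psi>) P')"
  unfolding matches_def
proof (intro allI impI)
  fix Q assume Q: "Q \<subseteq> P'" "2 \<le> card Q"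
  have "inj_on \<psi> Q" using assms(2) Q inj_on_subset by (auto simp: bij_betw_def)
  then have "card (\<psi> ` Q) = card Q" by (rule card_image)
  moreover have "\<psi> ` Q \<subseteq> P" using assms(2) Q by (auto simp: bij_betw_def)
  moreover have "restrict (\<sigma> \<circ> \<psi>) P' ` Q = \<sigma> ` (\<psi> ` Q)" using Q by (auto simp: image_iff subset_iff)
  ultimately show "(covered L' Q \<longleftrightarrow> collin (restrict (\<sigma> \<circ> \<psi>) P' ` Q)) \<and>
      (covered H' Q \<longleftrightarrow> coplan (restrict (\<sigma> \<circ> \<psi>) P' ` Q))"
    using matchesD[OF assms(1), of "\<psi> ` Q"] assms(3) Q unfolding same_type_def by simp
qed

text \<open>Composition with \<open>\<psi>\<close> injects realizations into realizations; the
  inverse of \<open>\<psi>\<close> later gives the other inequality.\<close>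

lemma nreal_relabel_le:
  assumes "finite P'" "bij_betw \<psi> P' P" "same_type P' L' H' \<psi> L H"
  shows "nreal P L H \<le> nreal P' L' H'"
  unfolding nreal_def
proof (rule card_inj_on_le)
  let ?f = "\<lambda>\<sigma>. restrict (\<sigma> \<circ> \<psi>) P'"
  show "finite (realizations P' L' H')" using assms finite_realizations by blast
  show "?f ` realizations P L H \<subseteq> realizations P' L' H'"
    using inj_maps_relabel[OF _ assms(2)] matches_relabel[OF _ assms(2,3)]
    by (auto simp: realizations_def)
  show "inj_on ?f (realizations P L H)"
  proof (rule inj_onI)
    fix \<sigma> \<tau> assume st: "\<sigma> \<in> realizations P L H" "\<tau> \<in> realizations P L H" and eq: "?f \<sigma> = ?f \<tau>"
    have ext: "\<sigma> \<in> P \<rightarrow>\<^sub>E proj_points R" "\<tau> \<in> P \<rightarrow>\<^sub>E proj_points R"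
      using st unfolding realizations_def inj_maps_def by simp_all
    show "\<sigma> = \<tau>"
    proof (rule PiE_ext[OF ext])
      fix y assume "y \<in> P"
      then obtain z where z: "z \<in> P'" "y = \<psi> z" using assms(2) by (auto simp: bij_betw_def)
      have "?f \<sigma> z = ?f \<tau> z" by (simp add: eq)
      then show "\<sigma> y = \<tau> y" using z by simp
    qed
  qed
qed

lemma same_type_inverse:
  assumes "bij_betw \<psi> P' P" "same_type P' L' H' \<psi> L H"
  shows "same_type P L H (the_inv_into P' \<psi>) L' H'"
  unfolding same_type_def
proof (intro allI impI)
  let ?i = "the_inv_into P' \<psi>"
  have inj: "inj_on \<psi> P'" and im: "\<psi> ` P' = P" using assms(1) by (auto simp: bij_betw_def)
  fix Q assume Q: "Q \<subseteq> P" "2 \<le> card Q"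
  have sub: "?i ` Q \<subseteq> P'" using Q im the_inv_into_into[OF inj _ subset_refl] by blast
  have roundtrip: "\<psi> ` (?i ` Q) = Q"
    using f_the_inv_into_f[OF inj] Q im by (force simp: image_image)
  have "inj_on \<psi> (?i ` Q)" using inj sub inj_on_subset by blast
  then have "card Q = card (?i ` Q)" using card_image roundtrip by metis
  then show "(covered L Q \<longleftrightarrow> covered L' (?i ` Q)) \<and> (covered H Q \<longleftrightarrow> covered H' (?i ` Q))"
    using assms(2) sub Q roundtrip unfolding same_type_def by simp
qed

lemma nreal_relabel:
  assumes "finite P'" "bij_betw \<psi> P' P" "same_type P' L' H' \<psi> L H"
  shows "nreal P L H = nreal P' L' H'"
proof (rule antisym)
  show "nreal P L H \<le> nreal P' L' H'" by (rule nreal_relabel_le[OF assms])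
  show "nreal P' L' H' \<le> nreal P L H"
  proof (rule nreal_relabel_le)
    show "finite P" using assms bij_betw_finite by blast
    show "bij_betw (the_inv_into P' \<psi>) P P'" by (rule bij_betw_the_inv_into[OF assms(2)])
  qed (rule same_type_inverse[OF assms(2,3)])
qed

text \<open>Every injective map has exactly one type, by \<open>type_exists\<close> and
  \<open>planar_eqI\<close>. A set of maps whose membership depends on the type only is therefore a
  disjoint union of sets of realizations.\<close>

lemma card_by_type:
  fixes P :: "'p set"
  assumes "finite P" "X \<subseteq> inj_maps P" "G \<subseteq> {(L, H). planar_space (P, L, H)}"
    and 1: "\<And>\<sigma> L H. \<sigma> \<in> X \<Longrightarrow> planar_space (P, L, H) \<Longrightarrow> matches P L H \<sigma> \<Longrightarrow> (L, H) \<in> G"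
    and 2: "\<And>\<sigma> L H. (L, H) \<in> G \<Longrightarrow> \<sigma> \<in> inj_maps P \<Longrightarrow> matches P L H \<sigma> \<Longrightarrow> \<sigma> \<in> X"
  shows "card X = (\<Sum>(L, H)\<in>G. nreal P L H)"
proof -
  have finG: "finite G" using finite_subset[OF assms(3) finite_planar_pairs[OF assms(1)]] .
  have "X = (\<Union>g\<in>G. realizations P (fst g) (snd g))"
  proof (intro equalityI subsetI)
    fix \<sigma> assume s: "\<sigma> \<in> X"
    then obtain L H where LH: "planar_space (P, L, H)" "matches P L H \<sigma>"
      using type_exists[OF assms(1)] assms(2) by blast
    then have "(L, H) \<in> G" using 1 s by blast
    moreover have "\<sigma> \<in> realizations P L H" using LH s assms(2) by (auto simp: realizations_def)
    ultimately show "\<sigma> \<in> (\<Union>g\<in>G. realizations P (fst g) (snd g))" by force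
  qed (use 2 in \<open>auto simp: realizations_def\<close>)
  then have "card X = (\<Sum>g\<in>G. card (realizations P (fst g) (snd g)))"
  proof (simp only:, intro card_UN_disjoint ballI impI)
    fix g g' assume g: "g \<in> G" "g' \<in> G" "g \<noteq> g'"
    show "realizations P (fst g) (snd g) \<inter> realizations P (fst g') (snd g') = {}"
    proof (rule ccontr)
      assume "\<not> ?thesis"
      then obtain \<sigma> where "matches P (fst g) (snd g) \<sigma>" "matches P (fst g') (snd g') \<sigma>"
        by (auto simp: realizations_def)
      note m = matchesD[OF this(1)] matchesD[OF this(2)]
      have "fst g = fst g' \<and> snd g = snd g'"
        by (rule planar_eqI[of P]) (use g assms(3) m in \<open>auto simp del: planar_space.simps\<close>)
      with g show False by (simp add: prod_eq_iff)
    qed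
  qed (use finG finite_realizations[OF assms(1)] in auto)
  then show ?thesis by (simp add: nreal_def split_def)
qed

text \<open>There is at most one transport, by \<open>planar_eqI\<close>. If there is none, there is
  no realization either, since the type of a relabelled realization would be one. Summing over the
  possibly empty set thus avoids constructing the deleted space.\<close>

lemma nreal_transports:
  fixes P' :: "'p set" and P :: "'r set"
  assumes "finite P'" "bij_betw \<psi> P' P"
  shows "nreal P L H = (\<Sum>(L', H')\<in>transports P' \<psi> L H. nreal P' L' H')"
proof (cases "transports P' \<psi> L H = {}")
  case True
  have "realizations P L H = {}"
  proof (rule ccontr)
    assume "realizations P L H \<noteq> {}"
    then obtain \<sigma> where s: "\<sigma> \<in> inj_maps P" "matches P L H \<sigma>" by (auto simp: realizations_def)
    let ?\<tau> = "restrict (\<sigma> \<circ> \<psi>) P'"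
    have "?\<tau> \<in> inj_maps P'" by (rule inj_maps_relabel[OF s(1) assms(2)])
    then obtain L' H' where LH: "planar_space (P', L', H')" "matches P' L' H' ?\<tau>"
      using type_exists[OF assms(1)] by metis
    have "same_type P' L' H' \<psi> L H" unfolding same_type_def
    proof (intro allI impI)
      fix Q assume Q: "Q \<subseteq> P'" "2 \<le> card Q"
      have "inj_on \<psi> Q" using assms(2) Q inj_on_subset by (auto simp: bij_betw_def)
      then have c: "card (\<psi> ` Q) = card Q" by (rule card_image)
      have sub: "\<psi> ` Q \<subseteq> P" using assms(2) Q by (auto simp: bij_betw_def)
      have "?\<tau> ` Q = \<sigma> ` (\<psi> ` Q)" using Q by (auto simp: image_iff subset_iff)
      then show "(covered L' Q \<longleftrightarrow> covered L (\<psi> ` Q)) \<and> (covered H' Q \<longleftrightarrow> covered H (\<psi> ` Q))"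
        using matchesD[OF s(2) sub] matchesD[OF LH(2) Q] Q c by simp
    qed
    then show False using LH True by (auto simp: transports_def simp del: planar_space.simps)
  qed
  then show ?thesis using True by (simp add: nreal_def)
next
  case False
  then obtain L' H' where LH: "(L', H') \<in> transports P' \<psi> L H" by auto
  have "g = (L', H')" if "g \<in> transports P' \<psi> L H" for g
  proof -
    obtain L1 H1 where g: "g = (L1, H1)" by (cases g)
    have "L1 = L' \<and> H1 = H'"
      by (rule planar_eqI[of P']) (use that g LH in \<open>auto simp: transports_def same_type_def simp del: planar_space.simps\<close>)
    with g show ?thesis by simp
  qed
  then have "transports P' \<psi> L H = {(L', H')}" using LH by blast
  moreover have "nreal P L H = nreal P' L' H'"
    using LH by (intro nreal_relabel[OF assms]) (auto simp: transports_def)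
  ultimately show ?thesis by simp
qed

text \<open>Pairs of a realization of the deleted space and an admissible position are counted in
  two ways: as a product by \<open>card_extensions\<close>, and by splitting off the occupied
  positions and sorting the remaining pairs, which are maps on \<open>P\<close>, by type. Solving
  for the type \<open>(L, H)\<close> gives the recursion.\<close>

theorem nreal_recursion:
  fixes P :: "'p set" and P' :: "'r set"
  assumes pl: "planar_space (P, L, H)" and x: "x \<in> P" and rem: "removable L H x"
    and P': "finite P'" "bij_betw \<psi> P' (P - {x})"
  shows "int (nreal P L H) =
     (\<Sum>(L', H')\<in>transports P' \<psi> L H. int (nreal P' L' H')) *
       ((\<Sum>i<Suc (freedom L H x). int (card (carrier R)) ^ i) - int (card (collisions P L H x)))
     - (\<Sum>(L', H')\<in>specializations P L H x - {(L, H)}. int (nreal P L' H'))"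
proof -
  let ?S = "realizations (P - {x}) L H" and ?C = "collisions P L H x"
  let ?N = "\<Sum>i<Suc (freedom L H x). card (carrier R) ^ i"
  let ?FL = "full_lines L x" and ?FH = "full_planes H x"
  have finP: "finite P" using planar_finite[OF pl] .
  have FL: "l \<in> L" "x \<in> l" "l - {x} \<subseteq> P - {x}" "2 \<le> card (l - {x})" "l \<subseteq> P" "2 \<le> card l" if "l \<in> ?FL" for l
    using that planar_line_subset[OF pl] by (auto simp: full_lines_def)
  have FH: "h \<in> H" "x \<in> h" "h - {x} \<subseteq> P - {x}" "2 \<le> card (h - {x})" "h \<subseteq> P" "2 \<le> card h" if "h \<in> ?FH" for h
    using that planar_plane_subset[OF pl] by (auto simp: full_planes_def)
  have finS: "finite ?S" using finite_realizations finP by blast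
  have finE: "finite (extensions L H x \<sigma>)" for \<sigma>
    unfolding extensions_def using finite_subspaces4[of 1] by simp
  define Z where "Z = Sigma ?S (extensions L H x)"
  define Z1 where "Z1 = {(\<sigma>, p) \<in> Z. p \<in> \<sigma> ` (P - {x})}"
  define X where "X = {\<tau> \<in> inj_maps P. matches (P - {x}) L H \<tau> \<and>
      (\<forall>l\<in>?FL. collin (\<tau> ` l)) \<and> (\<forall>h\<in>?FH. coplan (\<tau> ` h))}"
  have finZ: "finite Z" unfolding Z_def using finS finE by blast
  have cardZ: "card Z = card ?S * ?N"
    unfolding Z_def using finS finE card_extensions[OF pl x rem] by (simp add: card_SigmaI)
  \<comment> \<open>Whether the image of an existing point is admissible is a question about
    coverage in the deleted space, hence the same for all realizations.\<close>
  have fibre: "{p \<in> extensions L H x \<sigma>. p \<in> \<sigma> ` (P - {x})} = \<sigma> ` ?C" if s: "\<sigma> \<in> ?S" for \<sigma>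
  proof -
    have m: "matches (P - {x}) L H \<sigma>" and inj: "\<sigma> \<in> inj_maps (P - {x})"
      using s by (auto simp: realizations_def)
    have "\<sigma> y \<in> extensions L H x \<sigma> \<longleftrightarrow> y \<in> ?C" if y: "y \<in> P - {x}" for y
    proof -
      have c: "2 \<le> card (insert y A)" if "A \<subseteq> P - {x}" "2 \<le> card A" for A
        using that finP card_mono[of "insert y A" A] finite_subset[OF that(1)]
        by (metis finite_Diff finite_insert le_trans subset_insertI)
      have 1: "collin (insert (\<sigma> y) (\<sigma> ` (l - {x}))) \<longleftrightarrow> covered L (insert y (l - {x}))" if "l \<in> ?FL" for l
        using matchesD(1)[OF m _ c[OF FL(3,4)[OF that]]] FL(3)[OF that] y by simp
      have 2: "coplan (insert (\<sigma> y) (\<sigma> ` (h - {x}))) \<longleftrightarrow> covered H (insert y (h - {x}))" if "h \<in> ?FH" for h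
        using matchesD(2)[OF m _ c[OF FH(3,4)[OF that]]] FH(3)[OF that] y by simp
      show ?thesis
        unfolding extensions_def collisions_def using 1 2 y inj_maps_pt[OF inj y] by simp
    qed
    moreover have "?C \<subseteq> P - {x}" by (auto simp: collisions_def)
    ultimately show ?thesis by blast
  qed
  have "Z1 = Sigma ?S (\<lambda>\<sigma>. \<sigma> ` ?C)"
    unfolding Z1_def Z_def using fibre by blast
  moreover have "card (\<sigma> ` ?C) = card ?C" if "\<sigma> \<in> ?S" for \<sigma>
    using that by (intro card_image inj_on_subset[OF inj_maps_inj[of \<sigma> "P - {x}"]])
      (auto simp: realizations_def collisions_def)
  moreover have "finite ?C" using finP by (auto simp: collisions_def)
  ultimately have cardZ1: "card Z1 = card ?S * card ?C"
    using finS by (simp add: card_SigmaI)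
  have restr_m: "matches (P - {x}) L H (restrict \<tau> (P - {x})) \<longleftrightarrow> matches (P - {x}) L H \<tau>" for \<tau>
    by (rule matches_cong) simp
  have im: "insert (\<tau> x) (\<sigma> ` (A - {x})) = \<tau> ` A" 
    if "x \<in> A" "A \<subseteq> P" "\<And>y. y \<in> P - {x} \<Longrightarrow> \<sigma> y = \<tau> y" for \<sigma> \<tau> :: "'p \<Rightarrow> (nat \<Rightarrow> 'a) set" and A
  proof -
    have "\<sigma> ` (A - {x}) = \<tau> ` (A - {x})" using that by (intro image_cong) auto
    then show ?thesis using that(1) by auto
  qed
  have ext_iff: "\<tau> x \<in> extensions L H x \<sigma> \<longleftrightarrow> (\<forall>l\<in>?FL. collin (\<tau> ` l)) \<and> (\<forall>h\<in>?FH. coplan (\<tau> ` h))"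
    if "\<tau> x \<in> proj_points R" "\<And>y. y \<in> P - {x} \<Longrightarrow> \<sigma> y = \<tau> y" for \<sigma> \<tau> :: "'p \<Rightarrow> (nat \<Rightarrow> 'a) set"
    unfolding extensions_def
    using that im[OF FL(2) FL(5), of _ \<sigma> \<tau>] im[OF FH(2) FH(5), of _ \<sigma> \<tau>] by simp
  \<comment> \<open>A pair with unoccupied position is the same as an injective map on all of
    \<open>P\<close>.\<close>
  have "bij_betw (\<lambda>(\<sigma>, p). \<sigma>(x := p)) (Z - Z1) X"
  proof (rule bij_betw_byWitness[where f' = "\<lambda>\<tau>. (restrict \<tau> (P - {x}), \<tau> x)"])
    show "\<forall>a\<in>Z - Z1. (\<lambda>\<tau>. (restrict \<tau> (P - {x}), \<tau> x)) ((\<lambda>(\<sigma>, p). \<sigma>(x := p)) a) = a"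
    proof
      fix a assume a: "a \<in> Z - Z1"
      obtain \<sigma> p where ap: "a = (\<sigma>, p)" by (cases a)
      then have "\<sigma> \<in> extensional (P - {x})"
        using a by (auto simp: Z_def realizations_def inj_maps_def PiE_def)
      then have "restrict (\<sigma>(x := p)) (P - {x}) = \<sigma>" by (auto simp: fun_eq_iff restrict_def extensional_def)
      then show "(\<lambda>\<tau>. (restrict \<tau> (P - {x}), \<tau> x)) ((\<lambda>(\<sigma>, p). \<sigma>(x := p)) a) = a" by (simp add: ap)
    qed
    show "\<forall>\<tau>\<in>X. (\<lambda>(\<sigma>, p). \<sigma>(x := p)) (restrict \<tau> (P - {x}), \<tau> x) = \<tau>"
      using x by (auto simp: X_def inj_maps_def PiE_def extensional_def fun_eq_iff restrict_def)
    show "(\<lambda>(\<sigma>, p). \<sigma>(x := p)) ` (Z - Z1) \<subseteq> X"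
    proof (clarify)
      fix \<sigma> p assume a: "(\<sigma>, p) \<in> Z" "(\<sigma>, p) \<notin> Z1"
      let ?t = "\<sigma>(x := p)"
      have s: "\<sigma> \<in> inj_maps (P - {x})" "matches (P - {x}) L H \<sigma>" "p \<in> extensions L H x \<sigma>"
        "p \<notin> \<sigma> ` (P - {x})"
        using a by (auto simp: Z_def Z1_def realizations_def)
      have p: "p \<in> proj_points R" using s(3) by (simp add: extensions_def)
      have "?t \<in> P \<rightarrow>\<^sub>E proj_points R"
        using s(1) p x by (auto simp: inj_maps_def PiE_def extensional_def)
      moreover have "inj_on ?t P"
      proof -
        have "inj_on ?t (insert x (P - {x}))"
          using s(1,4) by (subst inj_on_insert) (auto simp: inj_maps_def inj_on_def)
        then show ?thesis using x by (simp add: insert_absorb)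
      qed
      moreover have "matches (P - {x}) L H ?t"
        using s(2) matches_cong[of "P - {x}" ?t \<sigma> L H] by simp
      moreover have "(\<forall>l\<in>?FL. collin (?t ` l)) \<and> (\<forall>h\<in>?FH. coplan (?t ` h))"
        using ext_iff[of ?t \<sigma>] s(3) p by simp
      ultimately show "?t \<in> X" by (simp add: X_def inj_maps_def)
    qed
    show "(\<lambda>\<tau>. (restrict \<tau> (P - {x}), \<tau> x)) ` X \<subseteq> Z - Z1"
    proof clarify
      fix \<tau> assume t: "\<tau> \<in> X"
      let ?r = "restrict \<tau> (P - {x})"
      have ti: "\<tau> \<in> inj_maps P" using t by (simp add: X_def)
      have "?r \<in> inj_maps (P - {x})" using ti by (auto simp: inj_maps_def inj_on_def)
      moreover have "matches (P - {x}) L H ?r" using t restr_m by (simp add: X_def)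
      moreover have "\<tau> x \<in> extensions L H x ?r"
        using ext_iff[of \<tau> ?r] t inj_maps_pt[OF ti x] by (simp add: X_def)
      moreover have "\<tau> x \<notin> ?r ` (P - {x})"
        using inj_maps_inj[OF ti] x by (auto simp: inj_on_def)
      ultimately show "(?r, \<tau> x) \<in> Z - Z1" by (simp add: Z_def Z1_def realizations_def)
    qed
  qed
  then have "card (Z - Z1) = card X" by (rule bij_betw_same_card)
  moreover have "card (Z - Z1) = card Z - card Z1" "card Z1 \<le> card Z"
    using finZ by (auto simp: Z1_def intro!: card_Diff_subset card_mono finite_subset[OF _ finZ])
  ultimately have "card X + card Z1 = card Z" by simp
  then have "int (card X) + int (card ?S * card ?C) = int (card ?S * ?N)"
    unfolding cardZ cardZ1 by (metis of_nat_add)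
  then have cardX: "int (card X) = int (card ?S) * (int ?N - int (card ?C))"
    by (simp add: right_diff_distrib del: sum.lessThan_Suc)
  have X_types: "card X = (\<Sum>(L', H')\<in>specializations P L H x. nreal P L' H')"
  proof (rule card_by_type[OF finP])
    show "X \<subseteq> inj_maps P" by (auto simp: X_def)
    show "specializations P L H x \<subseteq> {(L, H). planar_space (P, L, H)}"
      by (auto simp: specializations_def simp del: planar_space.simps)
  next
    fix \<tau> L' H' assume t: "\<tau> \<in> X" and pl': "planar_space (P, L', H')" and m': "matches P L' H' \<tau>"
    have ti: "\<tau> \<in> inj_maps P" and m: "matches (P - {x}) L H \<tau>" using t by (auto simp: X_def)
    have st: "same_type (P - {x}) L' H' id L H" unfolding same_type_def
    proof (intro allI impI)
      fix Q assume Q: "Q \<subseteq> P - {x}" "2 \<le> card Q"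
      then have "Q \<subseteq> P" by auto
      then show "(covered L' Q \<longleftrightarrow> covered L (id ` Q)) \<and> (covered H' Q \<longleftrightarrow> covered H (id ` Q))"
        using matchesD[OF m' _ Q(2)] matchesD[OF m Q] by simp
    qed
    \<comment> \<open>A line avoiding \<open>x\<close> is controlled by the deleted space, a full
      line through \<open>x\<close> by admissibility, and at most two points are always
      collinear.\<close>
    have line: "collin (\<tau> ` l)" if l: "l \<in> L" for l
    proof -
      note lP = planar_line_subset[OF pl l] planar_line_card[OF pl l]
      have fl: "finite l" using lP finP finite_subset by blast
      consider "x \<notin> l" | "l \<in> ?FL" | "card l \<le> 2"
        unfolding full_lines_def using l by (cases "card l \<le> 2") auto
      then show ?thesis
      proof cases
        case 1
        then have "l \<subseteq> P - {x}" using lP by auto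
        moreover have "covered L l" using l by (auto simp: covered_def)
        ultimately show ?thesis using matchesD(1)[OF m _ lP(2)] by simp
      next
        case 2 then show ?thesis using t by (simp add: X_def)
      next
        case 3
        then obtain a b where ab: "a \<in> P" "b \<in> P" "l \<subseteq> {a, b}"
          by (rule card_le_2_subset_pair[OF fl _ lP(1) x])
        then have "\<tau> ` l \<subseteq> {\<tau> a, \<tau> b}" by blast
        then show ?thesis
          by (rule collin_mono[OF collin_pair[OF inj_maps_pt[OF ti ab(1)] inj_maps_pt[OF ti ab(2)]]])
      qed
    qed
    \<comment> \<open>As for lines, except that a plane through \<open>x\<close> with at most two
      further points is coplanar in any case.\<close>
    have plane: "coplan (\<tau> ` h)" if h: "h \<in> H" for h
    proof -
      note hP = planar_plane_subset[OF pl h]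
      have fh: "finite h" using hP finP finite_subset by blast
      consider "x \<notin> h" | "h \<in> ?FH" | "x \<in> h" "card (h - {x}) \<le> 2"
        unfolding full_planes_def using h fh by (cases "x \<in> h"; cases "card h \<le> 3") auto
      then show ?thesis
      proof cases
        case 1
        \<comment> \<open>Missing \<open>x\<close>, the plane differs from \<open>P\<close>; hence
          it has two points, and \<open>matches\<close> applies to it.\<close>
        then have "h \<subseteq> P - {x}" "h \<noteq> P" using hP x by auto
        moreover have "covered H h" using h by (auto simp: covered_def)
        ultimately show ?thesis using matchesD(2)[OF m _ planar_plane_card[OF pl h]] by simp
      next
        case 2 then show ?thesis using t by (simp add: X_def)
      next
        case 3
        have "h - {x} \<subseteq> P" "finite (h - {x})" using hP fh by auto
        then obtain a b where ab: "a \<in> P" "b \<in> P" "h - {x} \<subseteq> {a, b}"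
          by (metis card_le_2_subset_pair[OF _ 3(2) _ x])
        then have "\<tau> ` h \<subseteq> insert (\<tau> x) {\<tau> a, \<tau> b}" by blast
        moreover have "coplan (insert (\<tau> x) {\<tau> a, \<tau> b})"
          by (intro coplan_insert collin_pair inj_maps_pt[OF ti] ab x)
        ultimately show ?thesis by (rule coplan_mono[rotated])
      qed
    qed
    have "degenerates P L H L' H'" unfolding degenerates_def
    proof (intro allI impI conjI)
      fix Q assume Q: "Q \<subseteq> P" "2 \<le> card Q"
      show "covered L' Q" if "covered L Q"
        using matchesD(1)[OF m' Q] that line collin_mono[OF _ image_mono[of Q _ \<tau>]] by (auto simp: covered_def)
      show "covered H' Q" if "covered H Q"
        using matchesD(2)[OF m' Q] that plane coplan_mono[OF _ image_mono[of Q _ \<tau>]] by (auto simp: covered_def)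
    qed
    then show "(L', H') \<in> specializations P L H x"
      using pl' st by (simp add: specializations_def del: planar_space.simps)
  next
    fix \<tau> L' H' assume LH: "(L', H') \<in> specializations P L H x" and ti: "\<tau> \<in> inj_maps P"
      and m': "matches P L' H' \<tau>"
    have st: "same_type (P - {x}) L' H' id L H" and dg: "degenerates P L H L' H'"
      using LH by (auto simp: specializations_def)
    have "matches (P - {x}) L H \<tau>" unfolding matches_def
    proof (intro allI impI)
      fix Q assume Q: "Q \<subseteq> P - {x}" "2 \<le> card Q"
      then have "Q \<subseteq> P" by auto
      then show "(covered L Q \<longleftrightarrow> collin (\<tau> ` Q)) \<and> (covered H Q \<longleftrightarrow> coplan (\<tau> ` Q))"
        using matchesD[OF m' _ Q(2)] st Q unfolding same_type_def by simp
    qed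
    moreover have "collin (\<tau> ` l)" if "l \<in> ?FL" for l
      using dg FL[OF that] matchesD(1)[OF m', of l] by (auto simp: degenerates_def covered_def)
    moreover have "coplan (\<tau> ` h)" if "h \<in> ?FH" for h
      using dg FH[OF that] matchesD(2)[OF m', of h] by (auto simp: degenerates_def covered_def)
    ultimately show "\<tau> \<in> X" using ti by (simp add: X_def)
  qed
  \<comment> \<open>This summand is isolated so that the identity can be solved for it.\<close>
  have self: "(L, H) \<in> specializations P L H x"
    using pl by (auto simp: specializations_def same_type_def degenerates_def simp del: planar_space.simps)
  have finG: "finite (specializations P L H x)"
    by (rule finite_subset[OF _ finite_planar_pairs[OF finP]])
      (auto simp: specializations_def simp del: planar_space.simps)
  have "int (card X) = (\<Sum>(L', H')\<in>specializations P L H x. int (nreal P L' H'))"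
    unfolding X_types by (simp add: split_def)
  also have "\<dots> = int (nreal P L H) + (\<Sum>(L', H')\<in>specializations P L H x - {(L, H)}. int (nreal P L' H'))"
    by (subst sum.remove[OF finG self]) simp
  finally have "int (nreal P L H) = int (card X) - (\<Sum>(L', H')\<in>specializations P L H x - {(L, H)}. int (nreal P L' H'))"
    by simp
  moreover have "int (card ?S) = (\<Sum>(L', H')\<in>transports P' \<psi> L H. int (nreal P' L' H'))"
    using nreal_transports[OF P'] by (simp add: nreal_def split_def)
  ultimately show ?thesis using cardX by simp
qed

text \<open>The sets ignored by \<open>matches\<close> have at most one point. With two points
  available each of them lies in a pair of distinct points, which is collinear and coplanar both in
  the space and in the image.\<close>

lemma num_realizations_eq:
  assumes pl: "planar_space (P, L, H)" and two: "2 \<le> card P"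
  shows "num_realizations R (P, L, H) = nreal P L H"
proof -
  have "strong_realizations R (P, L, H) = realizations P L H"
  proof (intro equalityI subsetI)
    fix \<sigma> assume "\<sigma> \<in> strong_realizations R (P, L, H)"
    then show "\<sigma> \<in> realizations P L H"
      by (simp add: realizations_def inj_maps_def matches_def covered_def collin_def coplan_def)
  next
    fix \<sigma> assume s: "\<sigma> \<in> realizations P L H"
    then have inj: "\<sigma> \<in> inj_maps P" and m: "matches P L H \<sigma>" by (auto simp: realizations_def)
    have *: "(covered L Q \<longleftrightarrow> collin (\<sigma> ` Q)) \<and> (covered H Q \<longleftrightarrow> coplan (\<sigma> ` Q))" if Q: "Q \<subseteq> P" for Q
    proof (cases "2 \<le> card Q")
      case True
      then show ?thesis using matchesD[OF m Q] by simp
    next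
      case False
      have finQ: "finite Q" using Q planar_finite[OF pl] finite_subset by blast
      obtain a b where ab: "a \<in> P" "b \<in> P" "a \<noteq> b" using two_elements[OF two] .
      have "\<exists>c d. c \<in> P \<and> d \<in> P \<and> c \<noteq> d \<and> Q \<subseteq> {c, d}"
      proof (cases "Q = {}")
        case True then show ?thesis using ab by blast
      next
        case ne: False
        then have "card Q = 1" using False finQ by (metis One_nat_def Suc_1 card_0_eq le_SucI not_less_eq_eq antisym le0)
        then obtain c where "Q = {c}" by (auto simp: card_1_singleton_iff)
        then show ?thesis using ab Q by (cases "c = a") auto
      qed
      then obtain c d where cd: "c \<in> P" "d \<in> P" "c \<noteq> d" "Q \<subseteq> {c, d}" by blast
      have sub: "{c, d} \<subseteq> P" "2 \<le> card {c, d}" using cd by auto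
      have 1: "covered L {c, d}" by (rule planar_covered_pair[OF pl cd(1-3)])
      then have 2: "collin (\<sigma> ` {c, d})" using matchesD(1)[OF m sub] by simp
      then have 3: "coplan (\<sigma> ` {c, d})" by (rule collin_coplan)
      then have 4: "covered H {c, d}" using matchesD(2)[OF m sub] by simp
      note im = image_mono[OF cd(4), of \<sigma>]
      show ?thesis
        using covered_mono[OF 1 cd(4)] covered_mono[OF 4 cd(4)] collin_mono[OF 2 im] coplan_mono[OF 3 im] by simp
    qed
    then show "\<sigma> \<in> strong_realizations R (P, L, H)" using inj
      by (simp add: inj_maps_def covered_def collin_def coplan_def)
  qed
  then show ?thesis by (simp add: num_realizations_def nreal_def)
qed

lemma nreal_iso:
  assumes pl: "planar_space (P, L, H)" and iso: "pspace_iso (P, L, H) (P', L', H')"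
  shows "nreal P L H = nreal P' L' H'"
proof -
  obtain \<phi> where \<phi>: "bij_betw \<phi> P P'" "(\<lambda>l. \<phi> ` l) ` L = L'" "(\<lambda>h. \<phi> ` h) ` H = H'" using iso by auto
  have inj: "inj_on \<phi> P" using \<phi> by (simp add: bij_betw_def)
  have img: "\<phi> ` Q \<subseteq> \<phi> ` l \<longleftrightarrow> Q \<subseteq> l" if "Q \<subseteq> P" "l \<subseteq> P" for Q l
  proof (intro iffI subsetI)
    fix t assume sub: "\<phi> ` Q \<subseteq> \<phi> ` l" and t: "t \<in> Q"
    then have "\<phi> t \<in> \<phi> ` l" by (meson imageI subsetD)
    then show "t \<in> l" using inj_on_image_mem_iff[OF inj _ that(2)] that(1) t by (meson subsetD)
  qed (use that in blast)
  have *: "covered M Q \<longleftrightarrow> covered ((\<lambda>l. \<phi> ` l) ` M) (\<phi> ` Q)" if "Q \<subseteq> P" "\<And>l. l \<in> M \<Longrightarrow> l \<subseteq> P" for M Q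
    using that by (simp add: covered_def img cong: bex_cong)
  have "same_type P L H \<phi> L' H'"
    unfolding same_type_def
    using * planar_line_subset[OF pl] planar_plane_subset[OF pl] \<phi>(2,3) by (metis (no_types, lifting))
  then show ?thesis using nreal_relabel[OF planar_finite[OF pl] \<phi>(1)] by simp
qed

text \<open>A list without repetitions is an injective map on its positions, and whether it has
  coplanar quadruples depends on its type only.\<close>

lemma num_arcs_eq: "num_arcs R n = (\<Sum>(L, H)\<in>free_types n. nreal {..<n} L H)"
proof -
  define X where "X = {\<sigma> \<in> inj_maps {..<n}. \<forall>Q\<subseteq>{..<n}. card Q = 4 \<longrightarrow> \<not> coplan (\<sigma> ` Q)}"
  have "bij_betw (\<lambda>xs. \<lambda>i\<in>{..<n}. xs ! i) (ordered_arcs R n) X"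
  proof (rule bij_betw_byWitness[where f' = "\<lambda>\<sigma>. map \<sigma> [0..<n]"])
    show "\<forall>xs\<in>ordered_arcs R n. map (\<lambda>i\<in>{..<n}. xs ! i) [0..<n] = xs"
      by (auto simp: ordered_arcs_def intro!: nth_equalityI)
    show "\<forall>\<sigma>\<in>X. (\<lambda>i\<in>{..<n}. map \<sigma> [0..<n] ! i) = \<sigma>"
      by (auto simp: X_def inj_maps_def PiE_def extensional_def fun_eq_iff restrict_def)
    show "(\<lambda>xs. \<lambda>i\<in>{..<n}. xs ! i) ` ordered_arcs R n \<subseteq> X"
    proof clarify
      fix xs assume "xs \<in> ordered_arcs R n"
      then have xs: "length xs = n" "distinct xs" "set xs \<subseteq> proj_points R"
        "\<And>T. T \<subseteq> set xs \<Longrightarrow> card T = 4 \<Longrightarrow> \<not> coplan T"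
        by (auto simp: ordered_arcs_def coplan_def)
      let ?s = "\<lambda>i\<in>{..<n}. xs ! i"
      have inj: "inj_on ?s {..<n}" using xs by (auto simp: inj_on_def nth_eq_iff_index_eq)
      have im: "?s i \<in> set xs" if "i < n" for i using that xs by simp
      have "?s \<in> {..<n} \<rightarrow>\<^sub>E proj_points R" using xs by auto
      moreover have "\<not> coplan (?s ` Q)" if Q: "Q \<subseteq> {..<n}" "card Q = 4" for Q
      proof (rule xs(4))
        show "?s ` Q \<subseteq> set xs"
        proof (rule image_subsetI)
          fix i assume "i \<in> Q"
          then show "?s i \<in> set xs" using im Q(1) by blast
        qed
        show "card (?s ` Q) = 4" using card_image[OF inj_on_subset[OF inj Q(1)]] Q by simp
      qed
      ultimately show "?s \<in> X" using inj by (simp add: X_def inj_maps_def)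
    qed
    show "(\<lambda>\<sigma>. map \<sigma> [0..<n]) ` X \<subseteq> ordered_arcs R n"
    proof clarify
      fix \<sigma> assume s: "\<sigma> \<in> X"
      then have i: "\<sigma> \<in> inj_maps {..<n}" by (simp add: X_def)
      have inj: "inj_on \<sigma> {..<n}" using inj_maps_inj[OF i] .
      have set: "set (map \<sigma> [0..<n]) = \<sigma> ` {..<n}" by (simp add: atLeast0LessThan)
      have d: "distinct (map \<sigma> [0..<n])" using inj by (simp add: distinct_map atLeast0LessThan)
      have np: "\<not> coplan T" if T: "T \<subseteq> \<sigma> ` {..<n}" "card T = 4" for T
      proof -
        obtain Q where Q: "Q \<subseteq> {..<n}" "T = \<sigma> ` Q" using T(1) by (auto simp: subset_image_iff)
        then have "card Q = 4" using card_image[OF inj_on_subset[OF inj Q(1)]] T by simp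
        then show ?thesis using s Q by (simp add: X_def)
      qed
      have "\<sigma> ` {..<n} \<subseteq> proj_points R" using inj_maps_pt[OF i] by blast
      then show "map \<sigma> [0..<n] \<in> ordered_arcs R n"
        unfolding ordered_arcs_def using d np set by (simp add: coplan_def)
    qed
  qed
  then have "num_arcs R n = card X" by (simp add: num_arcs_def bij_betw_same_card)
  also have "\<dots> = (\<Sum>(L, H)\<in>free_types n. nreal {..<n} L H)"
  proof (rule card_by_type)
    show "X \<subseteq> inj_maps {..<n}" by (auto simp: X_def)
    show "free_types n \<subseteq> {(L, H). planar_space ({..<n}, L, H)}"
      by (auto simp: free_types_def simp del: planar_space.simps)
  next
    fix \<sigma> L H assume "\<sigma> \<in> X" "planar_space ({..<n}, L, H)" "matches {..<n} L H \<sigma>"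
    then show "(L, H) \<in> free_types n"
      using matchesD(2)[of "{..<n}" L H \<sigma>] by (simp add: X_def free_types_def del: planar_space.simps)
  next
    fix \<sigma> L H assume "(L, H) \<in> free_types n" "\<sigma> \<in> inj_maps {..<n}" "matches {..<n} L H \<sigma>"
    then show "\<sigma> \<in> X"
      using matchesD(2)[of "{..<n}" L H \<sigma>] by (simp add: X_def free_types_def del: planar_space.simps)
  qed simp
  finally show ?thesis .
qed

end

section \<open>Total recursive functions\<close>

definition decidable :: "nat \<Rightarrow> (nat list \<Rightarrow> bool) \<Rightarrow> bool" where
  "decidable k P \<longleftrightarrow> total_recursive k (\<lambda>xs. of_bool (P xs))"

text \<open>These rules follow the structure of a term. Arguments are addressed as \<open>hd\<close>
  of iterated \<open>tl\<close>, because then entering a bounded sum or quantifier prepends the new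
  variable and shifts all others by one \<open>tl\<close>.\<close>

named_theorems rec_intros

lemma rec_cong: "total_recursive k f \<Longrightarrow> (\<And>xs. length xs = k \<Longrightarrow> g xs = f xs) \<Longrightarrow> total_recursive k g"
  by (rule total_recursive.restrict)

lemma dec_cong: "decidable k P \<Longrightarrow> (\<And>xs. length xs = k \<Longrightarrow> Q xs \<longleftrightarrow> P xs) \<Longrightarrow> decidable k Q"
  unfolding decidable_def by (erule rec_cong) simp

text \<open>With the composition rules it suffices to treat a function at plain variables; arbitrary
  recursive arguments follow.\<close>

lemma rec_comp1:
  assumes "total_recursive 1 (\<lambda>xs. f (hd xs))" "total_recursive k a"
  shows "total_recursive k (\<lambda>xs. f (a xs))"
  using total_recursive.comp[of "[a]" "\<lambda>xs. f (hd xs)" k] assms by simp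

lemma rec_comp2:
  assumes "total_recursive 2 (\<lambda>xs. f (hd xs) (hd (tl xs)))" "total_recursive k a" "total_recursive k b"
  shows "total_recursive k (\<lambda>xs. f (a xs) (b xs))"
  using total_recursive.comp[of "[a, b]" "\<lambda>xs. f (hd xs) (hd (tl xs))" k] assms
  by (auto simp: numeral_2_eq_2)

lemma rec_comp3:
  assumes "total_recursive 3 (\<lambda>xs. f (hd xs) (hd (tl xs)) (hd (tl (tl xs))))"
    "total_recursive k a" "total_recursive k b" "total_recursive k c"
  shows "total_recursive k (\<lambda>xs. f (a xs) (b xs) (c xs))"
  using total_recursive.comp[of "[a, b, c]" "\<lambda>xs. f (hd xs) (hd (tl xs)) (hd (tl (tl xs)))" k] assms
  by (auto simp: numeral_3_eq_3)

lemma rec_comp4: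
  assumes "total_recursive 4 (\<lambda>xs. f (hd xs) (hd (tl xs)) (hd (tl (tl xs))) (hd (tl (tl (tl xs)))))"
    "total_recursive k a" "total_recursive k b" "total_recursive k c" "total_recursive k d"
  shows "total_recursive k (\<lambda>xs. f (a xs) (b xs) (c xs) (d xs))"
  using total_recursive.comp[of "[a, b, c, d]" "\<lambda>xs. f (hd xs) (hd (tl xs)) (hd (tl (tl xs))) (hd (tl (tl (tl xs))))" k] assms
  by (auto simp: eval_nat_numeral)

lemmas dec_comp2 = rec_comp2[of "\<lambda>x y. of_bool (P x y)" for P, folded decidable_def]
lemmas dec_comp3 = rec_comp3[of "\<lambda>x y z. of_bool (P x y z)" for P, folded decidable_def]
lemmas dec_comp4 = rec_comp4[of "\<lambda>x y z w. of_bool (P x y z w)" for P, folded decidable_def]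

lemma nth_as_hd: "i < length xs \<Longrightarrow> xs ! i = hd ((tl ^^ i) xs)"
proof (induction i arbitrary: xs)
  case (Suc i)
  then show ?case by (cases xs) (auto simp: funpow_Suc_right simp del: funpow.simps)
qed (simp add: hd_conv_nth)

lemma rec_hd_tl: "i < k \<Longrightarrow> total_recursive k (\<lambda>xs. hd ((tl ^^ i) xs))"
  by (rule rec_cong[OF total_recursive.proj[of i k]]) (simp_all add: nth_as_hd[symmetric])

text \<open>The variables of the calculus, counted from the innermost binder. Ten indices
  accommodate the nesting depth of the predicates below.\<close>

lemmas rec_var [rec_intros] = rec_hd_tl[of 0, simplified]
  rec_hd_tl[of 1, simplified]
  rec_hd_tl[of 2, unfolded numeral_nat funpow.simps comp_def id_def]
  rec_hd_tl[of 3, unfolded numeral_nat funpow.simps comp_def id_def]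
  rec_hd_tl[of 4, unfolded numeral_nat funpow.simps comp_def id_def]
  rec_hd_tl[of 5, unfolded numeral_nat funpow.simps comp_def id_def]
  rec_hd_tl[of 6, unfolded numeral_nat funpow.simps comp_def id_def]
  rec_hd_tl[of 7, unfolded numeral_nat funpow.simps comp_def id_def]
  rec_hd_tl[of 8, unfolded numeral_nat funpow.simps comp_def id_def]
  rec_hd_tl[of 9, unfolded numeral_nat funpow.simps comp_def id_def]

lemma rec_Suc [rec_intros]: "total_recursive k a \<Longrightarrow> total_recursive k (\<lambda>xs. Suc (a xs))"
  by (rule rec_comp1[of Suc, OF rec_cong[OF total_recursive.succ]]) (auto simp: length_Suc_conv)

lemma rec_const [rec_intros]: "total_recursive k (\<lambda>xs. c)"
  by (induction c) (auto intro: total_recursive.zero rec_Suc)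

lemma rec_prim:
  assumes "total_recursive k f" "total_recursive (k + 2) (\<lambda>xs. g (hd xs) (hd (tl xs)) (tl (tl xs)))"
  shows "total_recursive (Suc k) (\<lambda>xs. rec_nat (f (tl xs)) (\<lambda>i r. g i r (tl xs)) (hd xs))"
  using total_recursive.prim_rec[OF assms] by simp

text \<open>Substitution of a computed value for the first argument, as a composition with
  \<open>a\<close> and with all projections.\<close>

lemma rec_cons:
  assumes f: "total_recursive (Suc k) (\<lambda>ys. f (hd ys) (tl ys))" and a: "total_recursive k a"
  shows "total_recursive k (\<lambda>xs. f (a xs) xs)"
proof (rule rec_cong)
  let ?fs = "a # map (\<lambda>i xs. xs ! i) [0..<k]"
  show "total_recursive k (\<lambda>xs. (\<lambda>ys. f (hd ys) (tl ys)) (map (\<lambda>f. f xs) ?fs))"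
    using f a by (intro total_recursive.comp) (auto intro: total_recursive.proj)
  show "f (a xs) xs = (\<lambda>ys. f (hd ys) (tl ys)) (map (\<lambda>f. f xs) ?fs)" if "length xs = k" for xs
  proof -
    have "map (\<lambda>i. xs ! i) [0..<k] = xs" using that map_nth by blast
    then show ?thesis by (simp add: comp_def)
  qed
qed

text \<open>Primitive recursion in the form used below: the number of iterations is itself a
  recursive function of the parameters.\<close>

lemma rec_iterate:
  assumes "total_recursive k f" "total_recursive (Suc (Suc k)) (\<lambda>xs. g (hd xs) (hd (tl xs)) (tl (tl xs)))"
    "total_recursive k a"
  shows "total_recursive k (\<lambda>xs. rec_nat (f xs) (\<lambda>i r. g i r xs) (a xs))"
  by (rule rec_cons[OF rec_prim[of k f g] assms(3)]) (use assms in auto)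

lemma rec_tl:
  assumes "total_recursive k f"
  shows "total_recursive (Suc k) (\<lambda>xs. f (tl xs))"
proof (rule rec_cong)
  let ?fs = "map (\<lambda>i xs. xs ! Suc i) [0..<k]"
  show "total_recursive (Suc k) (\<lambda>xs. f (map (\<lambda>f. f xs) ?fs))"
    using assms by (intro total_recursive.comp) (auto intro: total_recursive.proj)
  show "f (tl xs) = f (map (\<lambda>f. f xs) ?fs)" if "length xs = Suc k" for xs
  proof -
    have "map (\<lambda>i. xs ! Suc i) [0..<k] = tl xs" using that by (intro nth_equalityI) (auto simp: nth_tl)
    then show ?thesis by (simp add: comp_def)
  qed
qed

section \<open>Arithmetic and decidable predicates\<close>

lemma rec_add [rec_intros]:
  "total_recursive k a \<Longrightarrow> total_recursive k b \<Longrightarrow> total_recursive k (\<lambda>xs. a xs + b xs)"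
proof (rule rec_cong[OF rec_iterate[of k b "\<lambda>i r xs. Suc r" a]])
  show "total_recursive (Suc (Suc k)) (\<lambda>xs. Suc (hd (tl xs)))" by (intro rec_intros) auto
  show "a xs + b xs = rec_nat (b xs) (\<lambda>i r. Suc r) (a xs)" for xs
    by (induction "a xs" arbitrary: a) (auto, metis add_Suc old.nat.simps(7))
qed auto

lemma rec_mult [rec_intros]:
  "total_recursive k a \<Longrightarrow> total_recursive k b \<Longrightarrow> total_recursive k (\<lambda>xs. a xs * b xs)"
proof (rule rec_cong[OF rec_iterate[of k "\<lambda>xs. 0" "\<lambda>i r xs. r + b xs" a]])
  assume "total_recursive k b"
  then show "total_recursive (Suc (Suc k)) (\<lambda>xs. hd (tl xs) + b (tl (tl xs)))"
    by (intro rec_intros rec_tl[of _ "\<lambda>xs. b (tl xs)"] rec_tl) auto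
  have "m * n = rec_nat 0 (\<lambda>i r. r + n) m" for m n :: nat by (induction m) auto
  then show "a xs * b xs = rec_nat 0 (\<lambda>i r. r + b xs) (a xs)" for xs .
qed (auto intro: rec_intros)

lemma rec_power [rec_intros]:
  "total_recursive k a \<Longrightarrow> total_recursive k b \<Longrightarrow> total_recursive k (\<lambda>xs. a xs ^ b xs)"
proof (rule rec_cong[OF rec_iterate[of k "\<lambda>xs. 1" "\<lambda>i r xs. a xs * r" b]])
  assume "total_recursive k a"
  then show "total_recursive (Suc (Suc k)) (\<lambda>xs. a (tl (tl xs)) * hd (tl xs))"
    by (intro rec_intros rec_tl[of _ "\<lambda>xs. a (tl xs)"] rec_tl) auto
  have "m ^ n = rec_nat 1 (\<lambda>i r. m * r) n" for m n :: nat by (induction n) auto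
  then show "a xs ^ b xs = rec_nat 1 (\<lambda>i r. a xs * r) (b xs)" for xs .
qed (auto intro: rec_intros)

text \<open>Truncated subtraction iterates the predecessor, which in turn is a recursion that
  returns its counter.\<close>

lemma rec_diff [rec_intros]:
  assumes a: "total_recursive k a" and b: "total_recursive k b"
  shows "total_recursive k (\<lambda>xs. a xs - b xs)"
proof -
  have pred: "total_recursive 1 (\<lambda>xs. hd xs - 1)"
  proof (rule rec_cong[OF rec_iterate[of 1 "\<lambda>xs. 0" "\<lambda>i r xs. i" hd]])
    show "hd xs - 1 = rec_nat 0 (\<lambda>i r. i) (hd xs)" for xs :: "nat list" by (cases "hd xs") auto
  qed (auto intro!: rec_intros)
  show ?thesis
  proof (rule rec_cong[OF rec_iterate[of k a "\<lambda>i r xs. r - 1" b]])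
    show "total_recursive (Suc (Suc k)) (\<lambda>xs. hd (tl xs) - 1)"
      by (rule rec_comp1[OF pred]) (auto intro!: rec_intros)
    have "m - n = rec_nat m (\<lambda>i r. r - 1) n" for m n :: nat by (induction n) auto
    then show "a xs - b xs = rec_nat (a xs) (\<lambda>i r. r - 1) (b xs)" for xs .
  qed (use a b in auto)
qed

text \<open>Bounded quantifiers, quotients, projections of pairs and cardinalities are all reduced
  to such sums below.\<close>

lemma rec_sum [rec_intros]:
  assumes "total_recursive k a" "total_recursive (Suc k) (\<lambda>xs. f (hd xs) (tl xs))"
  shows "total_recursive k (\<lambda>xs. \<Sum>i<a xs. f i xs)"
proof (rule rec_cong[OF rec_iterate[of k "\<lambda>xs. 0" "\<lambda>i r xs. r + f i xs" a]])
  \<comment> \<open>The summand sees the counter and the parameters; the accumulator in second place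
    is skipped by a choice of projections.\<close>
  have "total_recursive (Suc (Suc k)) (\<lambda>xs. (\<lambda>ys. f (hd ys) (tl ys)) (map (\<lambda>f. f xs)
      ((\<lambda>xs. xs ! 0) # map (\<lambda>i xs. xs ! (i + 2)) [0..<k])))"
    using assms(2) by (intro total_recursive.comp) (auto intro: total_recursive.proj)
  then have "total_recursive (Suc (Suc k)) (\<lambda>xs. f (hd xs) (tl (tl xs)))"
  proof (rule rec_cong)
    fix xs :: "nat list" assume l: "length xs = Suc (Suc k)"
    have "map (\<lambda>i. xs ! (i + 2)) [0..<k] = tl (tl xs)" using l by (intro nth_equalityI) (auto simp: nth_tl)
    moreover have "xs ! 0 = hd xs" using l by (cases xs) auto
    ultimately show "f (hd xs) (tl (tl xs)) = (\<lambda>ys. f (hd ys) (tl ys)) (map (\<lambda>f. f xs)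
      ((\<lambda>xs. xs ! 0) # map (\<lambda>i xs. xs ! (i + 2)) [0..<k]))" by (simp add: comp_def)
  qed
  then show "total_recursive (Suc (Suc k)) (\<lambda>xs. hd (tl xs) + f (hd xs) (tl (tl xs)))"
    by (intro rec_intros) auto
  have "(\<Sum>i<n. g i) = rec_nat 0 (\<lambda>i r. r + g i) n" for g and n :: nat by (induction n) auto
  then show "(\<Sum>i<a xs. f i xs) = rec_nat 0 (\<lambda>i r. r + f i xs) (a xs)" for xs .
qed (use assms in \<open>auto intro: rec_intros\<close>)

lemma dec_less [rec_intros]:
  "total_recursive k a \<Longrightarrow> total_recursive k b \<Longrightarrow> decidable k (\<lambda>xs. a xs < b xs)"
  unfolding decidable_def
  \<comment> \<open>With truncated subtraction \<open>1 - (1 - d)\<close> is 0 for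
    \<open>d = 0\<close> and 1 otherwise.\<close>
  by (rule rec_cong[of _ "\<lambda>xs. 1 - (1 - (b xs - a xs))"]) (auto intro!: rec_intros)

lemma dec_not [rec_intros]: "decidable k P \<Longrightarrow> decidable k (\<lambda>xs. \<not> P xs)"
  unfolding decidable_def
  by (rule rec_cong[of _ "\<lambda>xs. 1 - of_bool (P xs)"]) (auto intro!: rec_intros)

lemma dec_conj [rec_intros]: "decidable k P \<Longrightarrow> decidable k Q \<Longrightarrow> decidable k (\<lambda>xs. P xs \<and> Q xs)"
  unfolding decidable_def
  by (rule rec_cong[of _ "\<lambda>xs. of_bool (P xs) * of_bool (Q xs)"]) (auto intro!: rec_intros)

lemma dec_disj [rec_intros]: "decidable k P \<Longrightarrow> decidable k Q \<Longrightarrow> decidable k (\<lambda>xs. P xs \<or> Q xs)"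
  by (rule dec_cong[of _ "\<lambda>xs. \<not> (\<not> P xs \<and> \<not> Q xs)"], intro rec_intros) auto

lemma dec_imp [rec_intros]: "decidable k P \<Longrightarrow> decidable k Q \<Longrightarrow> decidable k (\<lambda>xs. P xs \<longrightarrow> Q xs)"
  by (rule dec_cong[of _ "\<lambda>xs. \<not> P xs \<or> Q xs"], intro rec_intros) auto

lemma dec_iff [rec_intros]: "decidable k P \<Longrightarrow> decidable k Q \<Longrightarrow> decidable k (\<lambda>xs. P xs \<longleftrightarrow> Q xs)"
  by (rule dec_cong[of _ "\<lambda>xs. (P xs \<longrightarrow> Q xs) \<and> (Q xs \<longrightarrow> P xs)"], intro rec_intros) auto

lemma dec_le [rec_intros]:
  "total_recursive k a \<Longrightarrow> total_recursive k b \<Longrightarrow> decidable k (\<lambda>xs. a xs \<le> b xs)"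
  by (rule dec_cong[of _ "\<lambda>xs. \<not> b xs < a xs"], intro rec_intros) auto

lemma dec_eq [rec_intros]:
  "total_recursive k a \<Longrightarrow> total_recursive k b \<Longrightarrow> decidable k (\<lambda>xs. a xs = b xs)"
  by (rule dec_cong[of _ "\<lambda>xs. a xs \<le> b xs \<and> b xs \<le> a xs"], intro rec_intros) auto

lemma rec_of_bool [rec_intros]: "decidable k P \<Longrightarrow> total_recursive k (\<lambda>xs. of_bool (P xs))"
  by (simp add: decidable_def)

lemma dec_const [rec_intros]: "decidable k (\<lambda>xs. c)"
  unfolding decidable_def by (rule rec_const)

lemma rec_if [rec_intros]:
  "decidable k P \<Longrightarrow> total_recursive k a \<Longrightarrow> total_recursive k b \<Longrightarrow>
    total_recursive k (\<lambda>xs. if P xs then a xs else b xs)"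
  by (rule rec_cong[of _ "\<lambda>xs. of_bool (P xs) * a xs + of_bool (\<not> P xs) * b xs"]) (auto intro!: rec_intros)

lemma dec_ex_less [rec_intros]:
  assumes "total_recursive k a" "decidable (Suc k) (\<lambda>xs. P (hd xs) (tl xs))"
  shows "decidable k (\<lambda>xs. \<exists>i<a xs. P i xs)"
proof (rule dec_cong)
  show "decidable k (\<lambda>xs. \<not> (\<Sum>i<a xs. of_bool (P i xs)) = (0 :: nat))"
    by (intro rec_intros) (use assms in auto)
  show "(\<exists>i<a xs. P i xs) \<longleftrightarrow> \<not> (\<Sum>i<a xs. of_bool (P i xs)) = (0 :: nat)" for xs
    by (simp only: sum_eq_0_iff finite_lessThan of_bool_eq_0_iff) auto
qed

lemma dec_all_less [rec_intros]:
  assumes "total_recursive k a" "decidable (Suc k) (\<lambda>xs. P (hd xs) (tl xs))"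
  shows "decidable k (\<lambda>xs. \<forall>i<a xs. P i xs)"
  by (rule dec_cong[of _ "\<lambda>xs. \<not> (\<exists>i<a xs. \<not> P i xs)"], intro rec_intros) (use assms in auto)

text \<open>For \<open>y > 0\<close> the quotient counts the \<open>i\<close> with
  \<open>(i + 1) * y\<close> at most \<open>x\<close>, and all of these are below \<open>x\<close>.
  For \<open>y = 0\<close> the count would be \<open>x\<close>, so this case is set to 0
  separately.\<close>

lemma rec_div [rec_intros]:
  assumes "total_recursive k a" "total_recursive k b"
  shows "total_recursive k (\<lambda>xs. a xs div b xs)"
proof -
  have "total_recursive 2 (\<lambda>xs. hd xs div hd (tl xs))"
  proof (rule rec_cong)
    show "total_recursive 2 (\<lambda>xs. if hd (tl xs) = 0 then 0
        else \<Sum>i<hd xs. of_bool (Suc i * hd (tl xs) \<le> hd xs))"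
      by (intro rec_intros) auto
    have "x div y = (\<Sum>i<x. of_bool (Suc i * y \<le> x))" if "y > 0" for x y :: nat
    proof -
      have "{..<x} \<inter> {i. Suc i * y \<le> x} = {..<x div y}"
      proof (intro equalityI subsetI)
        fix i assume "i \<in> {..<x div y}"
        then have "Suc i \<le> x div y" by simp
        then have "Suc i * y \<le> x" using that by (simp add: less_eq_div_iff_mult_less_eq)
        moreover have "Suc i \<le> Suc i * y" using that by (simp del: mult_Suc)
        ultimately show "i \<in> {..<x} \<inter> {i. Suc i * y \<le> x}" by auto
      qed (use that in \<open>auto simp: less_eq_div_iff_mult_less_eq Suc_le_eq[symmetric] simp del: mult_Suc\<close>)
      then show ?thesis by (simp add: sum.If_cases of_bool_def)
    qed
    then show "hd xs div hd (tl xs) = (if hd (tl xs) = 0 then 0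
        else \<Sum>i<hd xs. of_bool (Suc i * hd (tl xs) \<le> hd xs))" for xs by simp
  qed
  then show ?thesis using assms by (rule rec_comp2)
qed

lemma rec_mod [rec_intros]:
  assumes "total_recursive k a" "total_recursive k b"
  shows "total_recursive k (\<lambda>xs. a xs mod b xs)"
  by (rule rec_cong[of _ "\<lambda>xs. a xs - b xs * (a xs div b xs)"], intro rec_intros)
    (use assms in \<open>auto simp: minus_mult_div_eq_mod\<close>)

section \<open>Coded pairs and coded finite sets\<close>

lemma rec_prod_encode [rec_intros]:
  assumes "total_recursive k a" "total_recursive k b"
  shows "total_recursive k (\<lambda>xs. prod_encode (a xs, b xs))"
  by (rule rec_cong[of _ "\<lambda>xs. (a xs + b xs) * Suc (a xs + b xs) div 2 + a xs"], intro rec_intros)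
    (use assms in \<open>auto simp: prod_encode_def triangle_def\<close>)

definition pfst :: "nat \<Rightarrow> nat" where "pfst c = fst (prod_decode c)"
definition psnd :: "nat \<Rightarrow> nat" where "psnd c = snd (prod_decode c)"

lemma pfst_prod_encode [simp]: "pfst (prod_encode (a, b)) = a"
  and psnd_prod_encode [simp]: "psnd (prod_encode (a, b)) = b"
  and prod_encode_pfst_psnd [simp]: "prod_encode (pfst c, psnd c) = c"
  by (simp_all add: pfst_def psnd_def)

lemma pfst_le: "pfst c \<le> c" and psnd_le: "psnd c \<le> c"
  using le_prod_encode_1[of "pfst c" "psnd c"] le_prod_encode_2[of "psnd c" "pfst c"] by simp_all

text \<open>Both components are bounded by the code, so inverting the pairing is a bounded double
  sum in which only the right pair contributes.\<close>

lemma rec_pfst [rec_intros]: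
  assumes "total_recursive k a" shows "total_recursive k (\<lambda>xs. pfst (a xs))"
proof -
  have "total_recursive 1 (\<lambda>xs. pfst (hd xs))"
  proof (rule rec_cong)
    show "total_recursive 1 (\<lambda>xs. \<Sum>i<Suc (hd xs). \<Sum>j<Suc (hd xs). of_bool (prod_encode (i, j) = hd xs) * i)"
      by (intro rec_intros) auto
    have "pfst c = (\<Sum>i<Suc c. \<Sum>j<Suc c. of_bool (prod_encode (i, j) = c) * i)" for c
    proof -
      have "(prod_encode (i, j) = c) \<longleftrightarrow> i = pfst c \<and> j = psnd c" for i j by auto
      then have "(\<Sum>j<Suc c. of_bool (prod_encode (i, j) = c) * i) =
          (\<Sum>j<Suc c. if j = psnd c then (if i = pfst c then i else 0) else 0)" for i
        by (intro sum.cong refl) (simp add: of_bool_def)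
      also have "\<dots> i = (if i = pfst c then i else 0)" for i
        using psnd_le[of c] by (subst sum.delta) simp_all
      finally have "(\<Sum>i<Suc c. \<Sum>j<Suc c. of_bool (prod_encode (i, j) = c) * i) =
          (\<Sum>i<Suc c. if i = pfst c then i else 0)" by (simp only:)
      also have "\<dots> = pfst c" using pfst_le[of c] by (subst sum.delta) simp_all
      finally show ?thesis by simp
    qed
    then show "pfst (hd xs) = (\<Sum>i<Suc (hd xs). \<Sum>j<Suc (hd xs). of_bool (prod_encode (i, j) = hd xs) * i)"
      for xs :: "nat list" .
  qed
  then show ?thesis using assms by (rule rec_comp1)
qed

lemma rec_psnd [rec_intros]:
  assumes "total_recursive k a" shows "total_recursive k (\<lambda>xs. psnd (a xs))"
proof -
  have "total_recursive 1 (\<lambda>xs. psnd (hd xs))"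
  proof (rule rec_cong)
    show "total_recursive 1 (\<lambda>xs. \<Sum>j<Suc (hd xs). of_bool (prod_encode (pfst (hd xs), j) = hd xs) * j)"
      by (intro rec_intros) auto
    have "psnd c = (\<Sum>j<Suc c. of_bool (prod_encode (pfst c, j) = c) * j)" for c
    proof -
      have "(prod_encode (pfst c, j) = c) \<longleftrightarrow> j = psnd c" for j
        by (metis prod_encode_pfst_psnd psnd_prod_encode)
      then have "(\<Sum>j<Suc c. of_bool (prod_encode (pfst c, j) = c) * j) =
          (\<Sum>j<Suc c. if j = psnd c then j else 0)"
        by (intro sum.cong refl) (auto simp: of_bool_def)
      also have "\<dots> = psnd c"
        using psnd_le[of c] by (simp add: sum.delta le_imp_less_Suc del: sum.lessThan_Suc)
      finally show ?thesis by simp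
    qed
    then show "psnd (hd xs) = (\<Sum>j<Suc (hd xs). of_bool (prod_encode (pfst (hd xs), j) = hd xs) * j)"
      for xs :: "nat list" .
  qed
  then show ?thesis using assms by (rule rec_comp1)
qed

text \<open>An element \<open>x\<close> accounts for a summand \<open>2^x\<close> of the code. This
  turns quantifiers over a coded set into bounded ones.\<close>

lemma set_decode_less: "x \<in> set_decode c \<Longrightarrow> x < c"
proof (rule ccontr)
  assume x: "x \<in> set_decode c" "\<not> x < c"
  have "c < 2 ^ c" by simp
  also have "(2::nat) ^ c \<le> 2 ^ x" using x by simp
  finally show False using x by (simp add: set_decode_def)
qed

lemma dec_mem [rec_intros]:
  assumes "total_recursive k a" "total_recursive k b"
  shows "decidable k (\<lambda>xs. a xs \<in> set_decode (b xs))"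
  by (rule dec_cong[of _ "\<lambda>xs. (b xs div 2 ^ a xs) mod 2 = 1"], intro rec_intros)
    (use assms in \<open>auto simp: set_decode_def odd_iff_mod_2_eq_one\<close>)

lemma dec_ball [rec_intros]:
  assumes "total_recursive k a" "decidable (Suc k) (\<lambda>xs. P (hd xs) (tl xs))"
  shows "decidable k (\<lambda>xs. \<forall>i\<in>set_decode (a xs). P i xs)"
proof (rule dec_cong)
  have "total_recursive (Suc k) (\<lambda>xs. a (tl xs))" using assms(1) by (rule rec_tl)
  then show "decidable k (\<lambda>xs. \<forall>i<a xs. i \<in> set_decode (a xs) \<longrightarrow> P i xs)"
    by (intro rec_intros) (use assms in auto)
qed (use set_decode_less in blast)

lemma dec_bex [rec_intros]:
  assumes "total_recursive k a" "decidable (Suc k) (\<lambda>xs. P (hd xs) (tl xs))"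
  shows "decidable k (\<lambda>xs. \<exists>i\<in>set_decode (a xs). P i xs)"
  by (rule dec_cong[of _ "\<lambda>xs. \<not> (\<forall>i\<in>set_decode (a xs). \<not> P i xs)"], intro rec_intros)
    (use assms in auto)

lemma dec_subset [rec_intros]:
  assumes "total_recursive k a" "total_recursive k b"
  shows "decidable k (\<lambda>xs. set_decode (a xs) \<subseteq> set_decode (b xs))"
proof -
  have "decidable 2 (\<lambda>xs. \<forall>i\<in>set_decode (hd xs). i \<in> set_decode (hd (tl xs)))"
    by (intro rec_intros) auto
  then have "decidable 2 (\<lambda>xs. set_decode (hd xs) \<subseteq> set_decode (hd (tl xs)))"
    by (rule dec_cong) auto
  then show ?thesis using assms by (rule dec_comp2)
qed

lemma rec_card [rec_intros]:
  assumes "total_recursive k a"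
  shows "total_recursive k (\<lambda>xs. card (set_decode (a xs)))"
proof -
  have "total_recursive 1 (\<lambda>xs. \<Sum>i<hd xs. of_bool (i \<in> set_decode (hd xs)))"
    by (intro rec_intros) auto
  then have "total_recursive 1 (\<lambda>xs. card (set_decode (hd xs)))"
  proof (rule rec_cong)
    fix xs :: "nat list"
    have "{..<hd xs} \<inter> {i. i \<in> set_decode (hd xs)} = set_decode (hd xs)" using set_decode_less by auto
    then show "card (set_decode (hd xs)) = (\<Sum>i<hd xs. of_bool (i \<in> set_decode (hd xs)))"
      by (simp add: sum.If_cases of_bool_def)
  qed
  then show ?thesis using assms by (rule rec_comp1)
qed

section \<open>Deciding the expansion steps\<close>

definition dsets :: "nat \<Rightarrow> nat set set" where "dsets b = set_decode ` set_decode b"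

definition pts :: "nat \<Rightarrow> nat set" where "pts c = set_decode (pfst c)"
definition lns :: "nat \<Rightarrow> nat set set" where "lns c = dsets (pfst (psnd c))"
definition pls :: "nat \<Rightarrow> nat set set" where "pls c = dsets (psnd (psnd c))"

abbreviation pspace_decode :: "nat \<Rightarrow> nat pspace" where
  "pspace_decode c \<equiv> (pts c, lns c, pls c)"

lemma set_encode_dsets: "set_encode (set_encode ` dsets b) = b"
  by (simp add: dsets_def image_image)

text \<open>Every number decodes to some triple and is recovered from it, so spaces can be counted
  through their codes without repetition.\<close>

lemma pspace_code_decode: "pspace_code (pspace_decode c) = c"
  by (simp add: pts_def lns_def pls_def set_encode_dsets)

lemma pspace_decode_eq_iff: "pspace_decode c = pspace_decode c' \<longleftrightarrow> c = c'"
  by (metis pspace_code_decode)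

lemma dsets_encode:
  assumes "finite L" "\<And>l. l \<in> L \<Longrightarrow> finite l" shows "dsets (set_encode (set_encode ` L)) = L"
proof -
  have "set_decode (set_encode l) = l" if "l \<in> L" for l using assms that by simp
  then show ?thesis using assms by (simp add: dsets_def image_image)
qed

lemma pspace_decode_code:
  assumes "planar_space (P, L, H)"
  shows "pspace_decode (pspace_code (P, L, H)) = (P, L, H)"
proof -
  note fin = planar_finite[OF assms]
  have "dsets (set_encode (set_encode ` L)) = L"
    using finite_lines[OF assms] planar_line_subset[OF assms] fin
    by (intro dsets_encode) (auto intro: finite_subset)
  moreover have "dsets (set_encode (set_encode ` H)) = H"
    using finite_planes[OF assms] planar_plane_subset[OF assms] fin
    by (intro dsets_encode) (auto intro: finite_subset)
  ultimately show ?thesis using fin by (simp add: pts_def lns_def pls_def)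
qed

lemma inj_set_decode: "inj set_decode"
  by (metis injI set_decode_inverse)

lemma set_decode_eq_iff: "set_decode a = set_decode b \<longleftrightarrow> a = b"
  by (metis set_decode_inverse)

lemma ball_dsets: "(\<forall>l\<in>dsets b. P l) \<longleftrightarrow> (\<forall>l\<in>set_decode b. P (set_decode l))"
  and bex_dsets: "(\<exists>l\<in>dsets b. P l) \<longleftrightarrow> (\<exists>l\<in>set_decode b. P (set_decode l))"
  by (simp_all add: dsets_def)

lemma card_dsets: "card {l \<in> dsets b. P l} = (\<Sum>l<b. of_bool (l \<in> set_decode b \<and> P (set_decode l)))"
proof -
  have "{l \<in> dsets b. P l} = set_decode ` ({..<b} \<inter> {l. l \<in> set_decode b \<and> P (set_decode l)})"
    using set_decode_less by (auto simp: dsets_def)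
  then have "card {l \<in> dsets b. P l} = card ({..<b} \<inter> {l. l \<in> set_decode b \<and> P (set_decode l)})"
    using card_image[OF inj_on_subset[OF inj_set_decode]] by simp
  then show ?thesis by (simp add: of_bool_def sum.If_cases)
qed

text \<open>A subset of a coded set has a code that is not larger, hence quantification over all
  subsets is bounded.\<close>

lemma all_subsets_set_decode:
  "(\<forall>Q\<subseteq>set_decode p. P Q) \<longleftrightarrow> (\<forall>q<Suc p. set_decode q \<subseteq> set_decode p \<longrightarrow> P (set_decode q))"
proof
  assume r: "\<forall>q<Suc p. set_decode q \<subseteq> set_decode p \<longrightarrow> P (set_decode q)"
  show "\<forall>Q\<subseteq>set_decode p. P Q"
  proof (intro allI impI)
    fix Q assume Q: "Q \<subseteq> set_decode p"
    then have "finite Q" using finite_subset finite_set_decode by blast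
    then have "Q = set_decode (set_encode Q)" by simp
    moreover have "set_encode Q \<le> p"
      using subset_decode_imp_le[of "set_encode Q" p] Q calculation by simp
    ultimately show "P Q" using r Q by (metis le_imp_less_Suc)
  qed
qed simp

lemma dec_covered [rec_intros]:
  assumes "total_recursive k a" "total_recursive k b"
  shows "decidable k (\<lambda>xs. covered (dsets (a xs)) (set_decode (b xs)))"
proof (rule dec_comp2[OF _ assms])
  show "decidable 2 (\<lambda>xs. covered (dsets (hd xs)) (set_decode (hd (tl xs))))"
    unfolding covered_def bex_dsets by (intro rec_intros) auto
qed

lemma dec_covered_insert [rec_intros]:
  assumes "total_recursive k a" "total_recursive k b" "total_recursive k c" "total_recursive k d"
  shows "decidable k (\<lambda>xs. covered (dsets (a xs)) (insert (b xs) (set_decode (c xs) - {d xs})))"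
proof (rule dec_comp4[OF _ assms])
  have "decidable 4 (\<lambda>xs. \<exists>l\<in>set_decode (hd xs). hd (tl xs) \<in> set_decode l \<and>
      (\<forall>z\<in>set_decode (hd (tl (tl xs))). z \<noteq> hd (tl (tl (tl xs))) \<longrightarrow> z \<in> set_decode l))"
    by (intro rec_intros) auto
  then show "decidable 4 (\<lambda>xs. covered (dsets (hd xs))
      (insert (hd (tl xs)) (set_decode (hd (tl (tl xs))) - {hd (tl (tl (tl xs)))})))"
    by (rule dec_cong) (auto simp: covered_def bex_dsets subset_iff)
qed

lemma dec_covered_remove [rec_intros]:
  assumes "total_recursive k a" "total_recursive k c" "total_recursive k d"
  shows "decidable k (\<lambda>xs. covered (dsets (a xs)) (set_decode (c xs) - {d xs}))"
proof (rule dec_comp3[OF _ assms])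
  have "decidable 3 (\<lambda>xs. \<exists>l\<in>set_decode (hd xs).
      (\<forall>z\<in>set_decode (hd (tl xs)). z \<noteq> hd (tl (tl xs)) \<longrightarrow> z \<in> set_decode l))"
    by (intro rec_intros) auto
  then show "decidable 3 (\<lambda>xs. covered (dsets (hd xs)) (set_decode (hd (tl xs)) - {hd (tl (tl xs))}))"
    by (rule dec_cong) (auto simp: covered_def bex_dsets subset_iff)
qed

lemma dec_noncollinear3 [rec_intros]:
  assumes "total_recursive k a" "total_recursive k b" "total_recursive k c" "total_recursive k d"
  shows "decidable k (\<lambda>xs. noncollinear3 (dsets (a xs)) (b xs) (c xs) (d xs))"
proof (rule dec_comp4[OF _ assms])
  have "decidable 4 (\<lambda>xs. hd (tl xs) \<noteq> hd (tl (tl xs)) \<and> hd (tl xs) \<noteq> hd (tl (tl (tl xs))) \<and>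
     hd (tl (tl xs)) \<noteq> hd (tl (tl (tl xs))) \<and>
     \<not> (\<exists>l\<in>set_decode (hd xs). hd (tl xs) \<in> set_decode l \<and> hd (tl (tl xs)) \<in> set_decode l \<and>
        hd (tl (tl (tl xs))) \<in> set_decode l))"
    by (intro rec_intros) auto
  then show "decidable 4 (\<lambda>xs. noncollinear3 (dsets (hd xs)) (hd (tl xs)) (hd (tl (tl xs))) (hd (tl (tl (tl xs)))))"
    by (rule dec_cong) (simp add: noncollinear3_def bex_dsets)
qed

lemma ex1_dsets: "(\<exists>!l. l \<in> dsets b \<and> P l) \<longleftrightarrow>
    (\<exists>l\<in>set_decode b. P (set_decode l) \<and> (\<forall>m\<in>set_decode b. P (set_decode m) \<longrightarrow> m = l))"
proof -
  have "(\<exists>!l. l \<in> dsets b \<and> P l) \<longleftrightarrow> (\<exists>l\<in>dsets b. P l \<and> (\<forall>m\<in>dsets b. P m \<longrightarrow> m = l))" by blast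
  then show ?thesis by (simp add: ball_dsets bex_dsets set_decode_eq_iff)
qed

lemma dsets_subset_Pow: "dsets b \<subseteq> Pow A \<longleftrightarrow> (\<forall>l\<in>set_decode b. set_decode l \<subseteq> A)"
  by (auto simp: dsets_def)

lemma dsets_eq_singleton:
  "dsets b = {set_decode p} \<longleftrightarrow> p \<in> set_decode b \<and> (\<forall>h\<in>set_decode b. h = p)"
proof -
  have "dsets b = {set_decode p} \<longleftrightarrow> set_decode p \<in> dsets b \<and> (\<forall>h\<in>dsets b. h = set_decode p)" by blast
  moreover have "set_decode p \<in> dsets b \<longleftrightarrow> p \<in> set_decode b"
    by (auto simp: dsets_def image_iff set_decode_eq_iff)
  ultimately show ?thesis by (simp add: ball_dsets set_decode_eq_iff)
qed

lemma dec_linear_space: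
  "decidable 2 (\<lambda>xs. linear_space (set_decode (hd xs)) (dsets (hd (tl xs))))"
  unfolding linear_space_def ex1_dsets ball_dsets dsets_subset_Pow
  by (simp only: finite_set_decode simp_thms) ((intro rec_intros; auto)+)

lemma ball_Int: "(\<forall>x\<in>A \<inter> B. P x) \<longleftrightarrow> (\<forall>x\<in>A. x \<in> B \<longrightarrow> P x)"
  by blast

text \<open>The definition with every quantifier bounded by a coded set, unique existence expressed
  through equality of codes, and the conditional split into two implications; in this form the
  closure rules apply directly.\<close>

lemma planar_space_dsets:
  "planar_space (set_decode p, dsets l, dsets h) \<longleftrightarrow>
     linear_space (set_decode p) (dsets l) \<and>
     (\<forall>g\<in>set_decode h. set_decode g \<subseteq> set_decode p) \<and>
     (\<forall>x\<in>set_decode p. \<forall>y\<in>set_decode p. \<forall>z\<in>set_decode p. noncollinear3 (dsets l) x y z \<longrightarrow>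
        (\<exists>g\<in>set_decode h. (x \<in> set_decode g \<and> y \<in> set_decode g \<and> z \<in> set_decode g) \<and>
          (\<forall>m\<in>set_decode h. x \<in> set_decode m \<and> y \<in> set_decode m \<and> z \<in> set_decode m \<longrightarrow> m = g))) \<and>
     (\<forall>g\<in>set_decode h. \<forall>m\<in>set_decode l. \<forall>x\<in>set_decode g. x \<in> set_decode m \<longrightarrow>
        (\<forall>y\<in>set_decode g. y \<in> set_decode m \<longrightarrow> x \<noteq> y \<longrightarrow> set_decode m \<subseteq> set_decode g)) \<and>
     ((\<exists>x\<in>set_decode p. \<exists>y\<in>set_decode p. \<exists>z\<in>set_decode p. noncollinear3 (dsets l) x y z) \<longrightarrow>
        (\<forall>g\<in>set_decode h. \<exists>x\<in>set_decode g. \<exists>y\<in>set_decode g. \<exists>z\<in>set_decode g. noncollinear3 (dsets l) x y z)) \<and>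
     (\<not> (\<exists>x\<in>set_decode p. \<exists>y\<in>set_decode p. \<exists>z\<in>set_decode p. noncollinear3 (dsets l) x y z) \<longrightarrow>
        p \<in> set_decode h \<and> (\<forall>g\<in>set_decode h. g = p))"
  unfolding planar_space.simps ex1_dsets ball_dsets dsets_subset_Pow dsets_eq_singleton ball_Int if_bool_eq_conj
  by (simp only: insert_subset empty_subsetI simp_thms)

lemma dec_planar_aux:
  "decidable 3 (\<lambda>xs. planar_space (set_decode (hd xs), dsets (hd (tl xs)), dsets (hd (tl (tl xs)))))"
proof -
  have lin: "decidable 3 (\<lambda>xs. linear_space (set_decode (hd xs)) (dsets (hd (tl xs))))"
    by (rule dec_comp2[OF dec_linear_space]) (auto intro!: rec_intros)
  show ?thesis unfolding planar_space_dsets by (intro rec_intros lin) auto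
qed

lemma dec_planar [rec_intros]:
  assumes "total_recursive k a" "total_recursive k b" "total_recursive k c"
  shows "decidable k (\<lambda>xs. planar_space (set_decode (a xs), dsets (b xs), dsets (c xs)))"
  by (rule dec_comp3[OF dec_planar_aux assms])

lemma ball_full_lines:
  "(\<forall>m\<in>full_lines (dsets l) x. P m) \<longleftrightarrow>
     (\<forall>m\<in>set_decode l. x \<in> set_decode m \<and> 3 \<le> card (set_decode m) \<longrightarrow> P (set_decode m))"
  by (auto simp: full_lines_def dsets_def)

lemma ball_full_planes:
  "(\<forall>g\<in>full_planes (dsets h) x. P g) \<longleftrightarrow>
     (\<forall>g\<in>set_decode h. x \<in> set_decode g \<and> 4 \<le> card (set_decode g) \<longrightarrow> P (set_decode g))"
  by (auto simp: full_planes_def dsets_def)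

lemma proper_planes_Collect:
  "proper_planes L H x = {h \<in> H. x \<in> h \<and> 4 \<le> card h \<and> \<not> covered L (h - {x})}"
  by (auto simp: proper_planes_def full_planes_def)

lemma ball_proper_planes:
  "(\<forall>g\<in>proper_planes L (dsets h) x. P g) \<longleftrightarrow>
     (\<forall>g\<in>set_decode h. x \<in> set_decode g \<and> 4 \<le> card (set_decode g) \<and>
        \<not> covered L (set_decode g - {x}) \<longrightarrow> P (set_decode g))"
  by (auto simp: proper_planes_Collect dsets_def)

lemma full_lines_empty_iff: "full_lines L x = {} \<longleftrightarrow> (\<forall>m\<in>full_lines L x. False)"
  by auto

lemma dec_removable [rec_intros]:
  assumes "total_recursive k a" "total_recursive k b" "total_recursive k c"
  shows "decidable k (\<lambda>xs. removable (dsets (a xs)) (dsets (b xs)) (c xs))"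
  unfolding removable_def full_plane_index_def full_line_index_def card_dsets
  by (rule dec_comp3[OF _ assms, of "\<lambda>a b c. \<not> (4 \<le> (\<Sum>l<b. of_bool (l \<in> set_decode b \<and> c \<in> set_decode l \<and> 4 \<le> card (set_decode l))) \<or>
     3 \<le> (\<Sum>l<a. of_bool (l \<in> set_decode a \<and> c \<in> set_decode l \<and> 3 \<le> card (set_decode l))) \<or>
     (\<Sum>l<b. of_bool (l \<in> set_decode b \<and> c \<in> set_decode l \<and> 4 \<le> card (set_decode l))) = (3::nat) \<and>
     (\<Sum>l<a. of_bool (l \<in> set_decode a \<and> c \<in> set_decode l \<and> 3 \<le> card (set_decode l))) = (0::nat))"])
    ((intro rec_intros; auto)+)

lemma rec_freedom [rec_intros]:
  assumes "total_recursive k a" "total_recursive k b" "total_recursive k c"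
  shows "total_recursive k (\<lambda>xs. freedom (dsets (a xs)) (dsets (b xs)) (c xs))"
proof (rule rec_comp3[OF _ assms])
  show "total_recursive 3 (\<lambda>xs. freedom (dsets (hd xs)) (dsets (hd (tl xs))) (hd (tl (tl xs))))"
    unfolding freedom_def full_lines_empty_iff ball_full_lines ball_proper_planes
    unfolding proper_planes_Collect full_lines_def card_dsets
    by (intro rec_intros) auto
qed

lemma dec_collisions [rec_intros]:
  assumes "total_recursive k a" "total_recursive k b" "total_recursive k c" "total_recursive k d" "total_recursive k e"
  shows "decidable k (\<lambda>xs. e xs \<in> collisions (set_decode (a xs)) (dsets (b xs)) (dsets (c xs)) (d xs))"
proof -
  have "decidable 4 (\<lambda>xs. (\<forall>m\<in>full_lines (dsets (hd xs)) (hd (tl (tl xs))).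
       covered (dsets (hd xs)) (insert (hd (tl (tl (tl xs)))) (m - {hd (tl (tl xs))}))) \<and>
     (\<forall>h\<in>full_planes (dsets (hd (tl xs))) (hd (tl (tl xs))).
       covered (dsets (hd (tl xs))) (insert (hd (tl (tl (tl xs)))) (h - {hd (tl (tl xs))}))))"
    unfolding ball_full_lines ball_full_planes by (intro rec_intros) auto
  then have "decidable k (\<lambda>xs. (\<forall>m\<in>full_lines (dsets (b xs)) (d xs).
       covered (dsets (b xs)) (insert (e xs) (m - {d xs}))) \<and>
     (\<forall>h\<in>full_planes (dsets (c xs)) (d xs). covered (dsets (c xs)) (insert (e xs) (h - {d xs}))))"
    by (rule dec_comp4[OF _ assms(2-5)])
  moreover have "decidable k (\<lambda>xs. e xs \<in> set_decode (a xs) \<and> e xs \<noteq> d xs)"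
    by (intro rec_intros assms)
  ultimately have "decidable k (\<lambda>xs. (e xs \<in> set_decode (a xs) \<and> e xs \<noteq> d xs) \<and>
     ((\<forall>m\<in>full_lines (dsets (b xs)) (d xs). covered (dsets (b xs)) (insert (e xs) (m - {d xs}))) \<and>
     (\<forall>h\<in>full_planes (dsets (c xs)) (d xs). covered (dsets (c xs)) (insert (e xs) (h - {d xs})))))"
    by (rule dec_conj[rotated])
  then show ?thesis by (rule dec_cong) (auto simp: collisions_def)
qed

section \<open>Deletions, specializations and isomorphisms of codes\<close>

definition shift :: "nat \<Rightarrow> nat \<Rightarrow> nat \<Rightarrow> nat" where
  "shift x m y = (if y = x then m else y)"

text \<open>Deleting \<open>x\<close> from a space on \<open>{..<Suc m}\<close>: the point \<open>m\<close> is renamed to \<open>x\<close>,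
  so that the remaining points are \<open>{..<m}\<close> again.\<close>

definition is_deletion :: "nat \<Rightarrow> nat \<Rightarrow> nat \<Rightarrow> bool" where
  "is_deletion c x c' \<longleftrightarrow> pts c' = {..<card (pts c) - 1} \<and>
     (lns c', pls c') \<in> transports (pts c') (shift x (card (pts c) - 1)) (lns c) (pls c)"

text \<open>The space itself is left out because its count stands on the other side of the
  recursion.\<close>

definition is_specialization :: "nat \<Rightarrow> nat \<Rightarrow> nat \<Rightarrow> bool" where
  "is_specialization c x c' \<longleftrightarrow> pts c' = pts c \<and>
     (lns c', pls c') \<in> specializations (pts c) (lns c) (pls c) x \<and> c' \<noteq> c"

lemma covered_dsets_image: "covered (dsets l) (\<psi> ` Q) \<longleftrightarrow> (\<exists>m\<in>set_decode l. \<forall>y\<in>Q. \<psi> y \<in> set_decode m)"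
  by (auto simp: covered_def bex_dsets image_subset_iff)

lemma set_decode_eq_lessThan:
  "set_decode p = {..<m} \<longleftrightarrow> (\<forall>y\<in>set_decode p. y < m) \<and> (\<forall>y<m. y \<in> set_decode p)"
  by auto

lemma dec_is_deletion [rec_intros]:
  assumes "total_recursive k a" "total_recursive k b" "total_recursive k c"
  shows "decidable k (\<lambda>xs. is_deletion (a xs) (b xs) (c xs))"
proof (rule dec_comp3[OF _ assms])
  show "decidable 3 (\<lambda>xs. is_deletion (hd xs) (hd (tl xs)) (hd (tl (tl xs))))"
    unfolding is_deletion_def transports_def mem_Collect_eq prod.case same_type_def pts_def lns_def pls_def
      all_subsets_set_decode covered_dsets_image shift_def set_decode_eq_lessThan
    by (intro rec_intros) auto
qed

lemma subset_remove_iff: "Q \<subseteq> A - {x} \<longleftrightarrow> Q \<subseteq> A \<and> x \<notin> Q"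
  by auto

lemma dec_is_specialization [rec_intros]:
  assumes "total_recursive k a" "total_recursive k b" "total_recursive k c"
  shows "decidable k (\<lambda>xs. is_specialization (a xs) (b xs) (c xs))"
proof (rule dec_comp3[OF _ assms])
  show "decidable 3 (\<lambda>xs. is_specialization (hd xs) (hd (tl xs)) (hd (tl (tl xs))))"
    unfolding is_specialization_def specializations_def mem_Collect_eq prod.case same_type_def degenerates_def
      subset_remove_iff imp_conjL image_id id_apply pts_def lns_def pls_def
      all_subsets_set_decode set_decode_eq_iff
    by (intro rec_intros) auto
qed

text \<open>A number below \<open>b^N\<close> is a sequence of \<open>N\<close> values below
  \<open>b\<close>. Both maps between point sets and walks are searched for in this form.\<close>

definition digit :: "nat \<Rightarrow> nat \<Rightarrow> nat \<Rightarrow> nat" where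
  "digit b w t = w div b ^ t mod b"

lemma rec_digit [rec_intros]:
  assumes "total_recursive k a" "total_recursive k b" "total_recursive k c"
  shows "total_recursive k (\<lambda>xs. digit (a xs) (b xs) (c xs))"
  unfolding digit_def by (intro rec_intros assms)

text \<open>A map on \<open>{..<n}\<close> is its table of values, a number with \<open>n\<close>
  digits in base \<open>n\<close>; this is where the bound comes from.\<close>

definition iso_code :: "nat \<Rightarrow> nat \<Rightarrow> nat \<Rightarrow> bool" where
  "iso_code n c c' \<longleftrightarrow> (\<exists>g<n ^ n. bij_betw (digit n g) (pts c) (pts c') \<and>
     (\<lambda>l. digit n g ` l) ` lns c = lns c' \<and> (\<lambda>h. digit n g ` h) ` pls c = pls c')"

lemma image_eq_iff: "f ` A = B \<longleftrightarrow> (\<forall>x\<in>A. \<exists>y\<in>B. f x = y) \<and> (\<forall>y\<in>B. \<exists>x\<in>A. f x = y)"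
proof
  assume "f ` A = B"
  then show "(\<forall>x\<in>A. \<exists>y\<in>B. f x = y) \<and> (\<forall>y\<in>B. \<exists>x\<in>A. f x = y)" by auto
next
  assume *: "(\<forall>x\<in>A. \<exists>y\<in>B. f x = y) \<and> (\<forall>y\<in>B. \<exists>x\<in>A. f x = y)"
  show "f ` A = B"
  proof (intro equalityI subsetI)
    show "y \<in> B" if "y \<in> f ` A" for y using that * by auto
    show "y \<in> f ` A" if "y \<in> B" for y using bspec[OF conjunct2[OF *] that] by auto
  qed
qed

lemma image_set_decode_eq:
  "\<phi> ` set_decode m = set_decode m' \<longleftrightarrow>
     (\<forall>y\<in>set_decode m. \<phi> y \<in> set_decode m') \<and> (\<forall>z\<in>set_decode m'. \<exists>y\<in>set_decode m. \<phi> y = z)"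
  unfolding image_eq_iff by simp

lemma image_dsets_eq:
  "(\<lambda>l. \<phi> ` l) ` dsets a = dsets b \<longleftrightarrow>
     (\<forall>l\<in>set_decode a. \<exists>m\<in>set_decode b. \<phi> ` set_decode l = set_decode m) \<and>
     (\<forall>m\<in>set_decode b. \<exists>l\<in>set_decode a. \<phi> ` set_decode l = set_decode m)"
  by (subst image_eq_iff) (simp only: ball_dsets bex_dsets)

lemma dec_iso_code [rec_intros]:
  assumes "total_recursive k a" "total_recursive k b" "total_recursive k c"
  shows "decidable k (\<lambda>xs. iso_code (a xs) (b xs) (c xs))"
proof (rule dec_comp3[OF _ assms])
  show "decidable 3 (\<lambda>xs. iso_code (hd xs) (hd (tl xs)) (hd (tl (tl xs))))"
    unfolding iso_code_def bij_betw_def inj_on_def pts_def lns_def pls_def image_dsets_eq image_set_decode_eq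
    by (intro rec_intros) auto
qed

section \<open>States and walks of the expansion\<close>

definition state :: "nat \<Rightarrow> nat \<Rightarrow> nat \<Rightarrow> nat \<Rightarrow> nat" where
  "state c s i y = prod_encode (c, prod_encode (s, prod_encode (i, y)))"

definition space_of :: "nat \<Rightarrow> nat" where "space_of u = pfst u"
definition sign_of :: "nat \<Rightarrow> nat" where "sign_of u = pfst (psnd u)"
definition expo_of :: "nat \<Rightarrow> nat" where "expo_of u = pfst (psnd (psnd u))"
definition label_of :: "nat \<Rightarrow> nat" where "label_of u = psnd (psnd (psnd u))"

lemma state_simps [simp]:
  "space_of (state c s i y) = c" "sign_of (state c s i y) = s"
  "expo_of (state c s i y) = i" "label_of (state c s i y) = y"
  "state (space_of u) (sign_of u) (expo_of u) (label_of u) = u"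
  by (simp_all add: state_def space_of_def sign_of_def expo_of_def label_of_def)

definition terminal :: "nat \<Rightarrow> bool" where
  "terminal c \<longleftrightarrow> (\<forall>x\<in>pts c. \<not> removable (lns c) (pls c) x)"

text \<open>Fixing the least removable point makes the expansion of a space unambiguous.\<close>

definition pivot :: "nat \<Rightarrow> nat \<Rightarrow> bool" where
  "pivot c x \<longleftrightarrow> x \<in> pts c \<and> removable (lns c) (pls c) x \<and>
     (\<forall>z<x. z \<in> pts c \<longrightarrow> \<not> removable (lns c) (pls c) z)"

text \<open>The state \<open>(c, s, i, y)\<close> stands for the summand \<open>(- 1) ^ s * q ^ i * A\<^sub>c\<close>; the labels \<open>y\<close> keep equal
  summands apart. The edges leaving a state lead to the summands of its expansion by the recursion
  at the pivot.\<close>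

definition edge :: "nat \<Rightarrow> nat \<Rightarrow> bool" where
  "edge u v \<longleftrightarrow> terminal (space_of u) \<and> v = u \<or>
     (\<exists>x\<in>pts (space_of u). pivot (space_of u) x \<and>
       (is_deletion (space_of u) x (space_of v) \<and>
          sign_of v = sign_of u \<and> expo_of u \<le> expo_of v \<and>
          expo_of v \<le> expo_of u + freedom (lns (space_of u)) (pls (space_of u)) x \<and> label_of v = 0 \<or>
        is_deletion (space_of u) x (space_of v) \<and>
          sign_of v = 1 - sign_of u \<and> expo_of v = expo_of u \<and> 0 < label_of v \<and>
          label_of v - 1 \<in> collisions (pts (space_of u)) (lns (space_of u)) (pls (space_of u)) x \<or>
        is_specialization (space_of u) x (space_of v) \<and>
          sign_of v = 1 - sign_of u \<and> expo_of v = expo_of u \<and> label_of v = 0))"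

lemma dec_edge [rec_intros]:
  assumes "total_recursive k a" "total_recursive k b"
  shows "decidable k (\<lambda>xs. edge (a xs) (b xs))"
proof (rule dec_comp2[OF _ assms])
  show "decidable 2 (\<lambda>xs. edge (hd xs) (hd (tl xs)))"
    unfolding edge_def terminal_def pivot_def space_of_def sign_of_def expo_of_def label_of_def
      pts_def lns_def pls_def
    by (intro rec_intros) auto
qed

definition start :: "nat \<Rightarrow> nat \<Rightarrow> bool" where
  "start n u \<longleftrightarrow> pts (space_of u) = {..<n} \<and> (lns (space_of u), pls (space_of u)) \<in> free_types n \<and>
     sign_of u = 0 \<and> expo_of u = 0 \<and> label_of u = 0"

lemma dec_start [rec_intros]:
  assumes "total_recursive k a" "total_recursive k b"
  shows "decidable k (\<lambda>xs. start (a xs) (b xs))"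
proof (rule dec_comp2[OF _ assms])
  have *: "start n u \<longleftrightarrow> pts (space_of u) = {..<n} \<and>
     planar_space (pts (space_of u), lns (space_of u), pls (space_of u)) \<and>
     (\<forall>Q\<subseteq>pts (space_of u). card Q = 4 \<longrightarrow> \<not> covered (pls (space_of u)) Q) \<and>
     sign_of u = 0 \<and> expo_of u = 0 \<and> label_of u = 0" for n u
    by (auto simp: start_def free_types_def simp del: planar_space.simps)
  show "decidable 2 (\<lambda>xs. start (hd xs) (hd (tl xs)))"
    unfolding * space_of_def sign_of_def expo_of_def label_of_def pts_def lns_def pls_def
      all_subsets_set_decode set_decode_eq_lessThan
    by (intro rec_intros) auto
qed

text \<open>On points from \<open>{..<n}\<close> a point set has a code below \<open>2^n\<close> and
  a family of such sets has one below \<open>2^(2^n)\<close>. Signs are at most 1, labels at most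
  \<open>n\<close>, and exponents at most \<open>3 * n\<close>, because each deletion adds at most
  3.\<close>

definition state_bound :: "nat \<Rightarrow> nat" where
  "state_bound n = Suc (state (prod_encode (2 ^ n, prod_encode (2 ^ 2 ^ n, 2 ^ 2 ^ n))) 1 (3 * n) n)"

text \<open>A strict bound for the \<open>potential\<close> defined later: \<open>n\<close> points
  of weight \<open>2 * 2^n + 1\<close> each, plus a remainder of at most
  \<open>2 * 2^n\<close>.\<close>

definition num_steps :: "nat \<Rightarrow> nat" where
  "num_steps n = (n + 1) * (2 * 2 ^ n + 1)"

lemma rec_state_bound [rec_intros]:
  "total_recursive k a \<Longrightarrow> total_recursive k (\<lambda>xs. state_bound (a xs))"
  unfolding state_bound_def state_def by (intro rec_intros)

lemma rec_num_steps [rec_intros]: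
  "total_recursive k a \<Longrightarrow> total_recursive k (\<lambda>xs. num_steps (a xs))"
  unfolding num_steps_def by (intro rec_intros)

text \<open>A terminal state has itself as its only successor. Hence all expansions can be followed
  for the same number of steps, however early they finish.\<close>

definition walk :: "nat \<Rightarrow> nat \<Rightarrow> nat \<Rightarrow> bool" where
  "walk b T w \<longleftrightarrow> (\<forall>t<T. edge (digit b w t) (digit b w (Suc t)))"

definition end_of :: "nat \<Rightarrow> nat \<Rightarrow> nat" where
  "end_of n w = digit (state_bound n) w (num_steps n)"

text \<open>Signs are kept apart because the recursive functions take natural values only; the
  coefficient is the difference of the counts for \<open>s = 0\<close> and
  \<open>s = 1\<close>.\<close>

definition num_walks :: "nat \<Rightarrow> nat \<Rightarrow> nat \<Rightarrow> nat \<Rightarrow> nat" where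
  "num_walks n c s i = (\<Sum>w<state_bound n ^ Suc (num_steps n).
     of_bool (start n (digit (state_bound n) w 0) \<and> walk (state_bound n) (num_steps n) w \<and>
       iso_code n (space_of (end_of n w)) c \<and> sign_of (end_of n w) = s \<and> expo_of (end_of n w) = i))"

lemma rec_num_walks [rec_intros]:
  assumes "total_recursive k a" "total_recursive k b" "total_recursive k c" "total_recursive k d"
  shows "total_recursive k (\<lambda>xs. num_walks (a xs) (b xs) (c xs) (d xs))"
proof (rule rec_comp4[OF _ assms])
  show "total_recursive 4 (\<lambda>xs. num_walks (hd xs) (hd (tl xs)) (hd (tl (tl xs))) (hd (tl (tl (tl xs)))))"
    unfolding num_walks_def walk_def end_of_def space_of_def sign_of_def expo_of_def
    by (intro rec_intros) auto
qed

section \<open>Codes of polynomials\<close>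

lemma int_encode_diff:
  "int_encode (int a - int b) = (if b \<le> a then 2 * (a - b) else Suc (2 * (b - a - 1)))"
  by (auto simp: int_encode_def sum_encode_def nat_diff_distrib)

text \<open>Coefficient lists carry no leading zeros, so prepending 0 to the zero polynomial leaves
  the empty list, whose code is 0.\<close>

lemma poly_code_pCons:
  "poly_code (pCons z p) =
     (if z = 0 \<and> poly_code p = 0 then 0 else Suc (prod_encode (int_encode z, poly_code p)))"
proof -
  have "poly_code p = 0 \<longleftrightarrow> p = 0"
    by (cases "coeffs p") (auto simp: poly_code_def coeffs_eq_Nil)
  then show ?thesis by (auto simp: poly_code_def cCons_def)
qed

lemma rec_poly_code:
  assumes D: "total_recursive k D" and a: "total_recursive (Suc k) (\<lambda>xs. a (hd xs) (tl xs))"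
    and b: "total_recursive (Suc k) (\<lambda>xs. b (hd xs) (tl xs))"
  shows "total_recursive k (\<lambda>xs. poly_code (\<Sum>i<D xs. monom (int (a i xs) - int (b i xs)) i))"
proof -
  define f where "f xs i = int (a i xs) - int (b i xs)" for xs i
  \<comment> \<open>The coefficients are prepended from the highest degree down. Thus
    \<open>pCons\<close> suppresses leading zeros by itself, and each new code depends only on the
    previous one.\<close>
  define pol where "pol xs j = rec_nat 0 (\<lambda>i p. pCons (f xs (D xs - Suc i)) p) j" for xs j
  have pol_simps: "pol xs 0 = 0" "pol xs (Suc j) = pCons (f xs (D xs - Suc j)) (pol xs j)" for xs j
    by (simp_all add: pol_def)
  have coeff_pol: "coeff (pol xs j) i = (if i < j then f xs (D xs - j + i) else 0)" if "j \<le> D xs" for xs j i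
    using that
  proof (induction j arbitrary: i)
    case (Suc j)
    then have "D xs - Suc j + Suc i = D xs - j + i" for i by simp
    then show ?case using Suc by (cases i) (auto simp: pol_simps)
  qed (simp add: pol_simps)
  have pol_sum: "pol xs (D xs) = (\<Sum>i<D xs. monom (f xs i) i)" for xs
    by (rule poly_eqI) (simp add: coeff_pol coeff_sum coeff_monom sum.delta)
  have code_pol: "poly_code (pol xs j) = rec_nat 0 (\<lambda>i r.
      if a (D xs - Suc i) xs = b (D xs - Suc i) xs \<and> r = 0 then 0
      else Suc (prod_encode (if b (D xs - Suc i) xs \<le> a (D xs - Suc i) xs
        then 2 * (a (D xs - Suc i) xs - b (D xs - Suc i) xs)
        else Suc (2 * (b (D xs - Suc i) xs - a (D xs - Suc i) xs - 1)), r))) j" for xs j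
  proof (induction j)
    case 0
    then show ?case by (simp add: pol_simps poly_code_def)
  next
    case (Suc j)
    show ?case unfolding pol_simps poly_code_pCons Suc f_def int_encode_diff by simp
  qed
  have "total_recursive k (\<lambda>xs. rec_nat 0 (\<lambda>i r.
      if a (D xs - Suc i) xs = b (D xs - Suc i) xs \<and> r = 0 then 0
      else Suc (prod_encode (if b (D xs - Suc i) xs \<le> a (D xs - Suc i) xs
        then 2 * (a (D xs - Suc i) xs - b (D xs - Suc i) xs)
        else Suc (2 * (b (D xs - Suc i) xs - a (D xs - Suc i) xs - 1)), r))) (D xs))"
  proof (rule rec_iterate[OF _ _ D])
    have D2: "total_recursive (Suc (Suc k)) (\<lambda>xs. D (tl (tl xs)) - Suc (hd xs))"
      by (intro rec_intros rec_tl[of _ "\<lambda>xs. D (tl xs)"] rec_tl D) auto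
    \<comment> \<open>The index of the coefficient is computed from the counter and the parameters
      and then supplied as a new first argument by \<open>rec_cons\<close>.\<close>
    have sub: "total_recursive (Suc (Suc k)) (\<lambda>xs. g (D (tl (tl xs)) - Suc (hd xs)) (tl (tl xs)))"
      if g: "total_recursive (Suc k) (\<lambda>xs. g (hd xs) (tl xs))" for g
    proof -
      have "total_recursive (Suc (Suc (Suc k))) (\<lambda>ys. (\<lambda>zs. g (hd zs) (tl zs)) (map (\<lambda>f. f ys)
          ((\<lambda>ys. ys ! 0) # map (\<lambda>i ys. ys ! (i + 3)) [0..<k])))"
        using g by (intro total_recursive.comp) (auto intro: total_recursive.proj)
      then have "total_recursive (Suc (Suc (Suc k))) (\<lambda>ys. g (hd ys) (tl (tl (tl ys))))"
      proof (rule rec_cong)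
        fix ys :: "nat list" assume l: "length ys = Suc (Suc (Suc k))"
        have "map (\<lambda>i. ys ! (i + 3)) [0..<k] = tl (tl (tl ys))"
          using l by (intro nth_equalityI) (auto simp: nth_tl eval_nat_numeral)
        moreover have "ys ! 0 = hd ys" using l by (cases ys) auto
        ultimately show "g (hd ys) (tl (tl (tl ys))) = (\<lambda>zs. g (hd zs) (tl zs)) (map (\<lambda>f. f ys)
          ((\<lambda>ys. ys ! 0) # map (\<lambda>i ys. ys ! (i + 3)) [0..<k]))" by (simp add: comp_def)
      qed
      then show ?thesis
        by (rule rec_cons[of _ "\<lambda>y xs. g y (tl (tl xs))", OF _ D2])
    qed
    show "total_recursive (Suc (Suc k)) (\<lambda>xs.
      if a (D (tl (tl xs)) - Suc (hd xs)) (tl (tl xs)) = b (D (tl (tl xs)) - Suc (hd xs)) (tl (tl xs)) \<and> hd (tl xs) = 0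
      then 0 else Suc (prod_encode (if b (D (tl (tl xs)) - Suc (hd xs)) (tl (tl xs)) \<le> a (D (tl (tl xs)) - Suc (hd xs)) (tl (tl xs))
        then 2 * (a (D (tl (tl xs)) - Suc (hd xs)) (tl (tl xs)) - b (D (tl (tl xs)) - Suc (hd xs)) (tl (tl xs)))
        else Suc (2 * (b (D (tl (tl xs)) - Suc (hd xs)) (tl (tl xs)) - a (D (tl (tl xs)) - Suc (hd xs)) (tl (tl xs)) - 1)),
        hd (tl xs))))"
      using sub[OF a] sub[OF b] by (intro rec_intros) auto
  qed (rule rec_const)
  then show ?thesis
    by (rule rec_cong) (simp only: code_pol[symmetric] pol_sum f_def)
qed

text \<open>The range of exponents matches the bound \<open>3 * n\<close> on the exponents of
  reachable states.\<close>

definition class_poly :: "nat \<Rightarrow> nat \<Rightarrow> int poly" where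
  "class_poly n c = (\<Sum>i<Suc (3 * n). monom (int (num_walks n c 0 i) - int (num_walks n c 1 i)) i)"

lemma rec_class_poly:
  assumes "total_recursive k a" "total_recursive k b"
  shows "total_recursive k (\<lambda>xs. poly_code (class_poly (a xs) (b xs)))"
proof (rule rec_comp2[OF _ assms])
  show "total_recursive 2 (\<lambda>xs. poly_code (class_poly (hd xs) (hd (tl xs))))"
    unfolding class_poly_def
  proof (rule rec_poly_code)
    show "total_recursive 2 (\<lambda>xs. Suc (3 * hd xs))" by (intro rec_intros) auto
    show "total_recursive (Suc 2) (\<lambda>xs. num_walks (hd (tl xs)) (hd (tl (tl xs))) 0 (hd xs))"
      "total_recursive (Suc 2) (\<lambda>xs. num_walks (hd (tl xs)) (hd (tl (tl xs))) 1 (hd xs))"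
      by (intro rec_intros; simp)+
  qed
qed

section \<open>Counting the expansions\<close>

lemma digit_cons_0: "u < b \<Longrightarrow> digit b (u + b * w) 0 = u"
  by (simp add: digit_def)

lemma digit_cons_Suc: "u < b \<Longrightarrow> digit b (u + b * w) (Suc t) = digit b w t"
  by (simp add: digit_def div_mult2_eq)

lemma digit_less: "0 < b \<Longrightarrow> digit b w t < b"
  by (simp add: digit_def)

lemma walk_cons: "u < b \<Longrightarrow> walk b (Suc T) (u + b * w) \<longleftrightarrow> edge u (digit b w 0) \<and> walk b T w"
  by (simp add: walk_def All_less_Suc2 digit_cons_0 digit_cons_Suc)

lemma cons_less_power: "u < b \<Longrightarrow> u + b * w < b ^ Suc N \<longleftrightarrow> w < b ^ N" for u b w N :: nat
proof
  assume u: "u < b" and "u + b * w < b ^ Suc N"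
  then have "b * w < b * b ^ N" unfolding power_Suc by linarith
  then show "w < b ^ N" by simp
next
  assume u: "u < b" and "w < b ^ N"
  then have "b * Suc w \<le> b * b ^ N" by (intro mult_le_mono) auto
  then show "u + b * w < b ^ Suc N" using u by simp
qed

text \<open>If a value always equals the sum of the values of the successors, it can be pushed along
  edges: it equals the sum over the ends of all walks of a given length.\<close>

lemma walk_sum:
  fixes val :: "nat \<Rightarrow> int"
  assumes step: "\<And>u. V u \<Longrightarrow> val u = (\<Sum>v\<in>{v. v < b \<and> edge u v}. val v)"
    and closed: "\<And>u v. V u \<Longrightarrow> edge u v \<Longrightarrow> V v" and bound: "\<And>u. V u \<Longrightarrow> u < b"
  shows "V u \<Longrightarrow> (\<Sum>w\<in>{w. w < b ^ Suc T \<and> digit b w 0 = u \<and> walk b T w}. val (digit b w T)) = val u"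
proof (induction T arbitrary: u)
  case 0
  then have "{w. w < b ^ Suc 0 \<and> digit b w 0 = u \<and> walk b 0 w} = {u}"
    using bound[of u] by (auto simp: digit_def walk_def)
  then show ?case using bound[of u] 0 by (simp add: digit_def)
next
  case (Suc T)
  have u: "u < b" using bound Suc.prems by simp
  let ?S = "{w. w < b ^ Suc T \<and> edge u (digit b w 0) \<and> walk b T w}"
  have finS: "finite ?S" by simp
  \<comment> \<open>The first state of a walk is its least significant digit, so division by
    \<open>b\<close> removes it and \<open>u + b * w\<close> restores it.\<close>
  have "(\<Sum>w\<in>{w. w < b ^ Suc (Suc T) \<and> digit b w 0 = u \<and> walk b (Suc T) w}. val (digit b w (Suc T)))
      = (\<Sum>w\<in>?S. val (digit b w T))"
  proof (rule sum.reindex_bij_witness[of _ "\<lambda>w. u + b * w" "\<lambda>w. w div b"])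
    fix w assume w: "w \<in> {w. w < b ^ Suc (Suc T) \<and> digit b w 0 = u \<and> walk b (Suc T) w}"
    have eq: "u + b * (w div b) = w" using w by (auto simp: digit_def)
    show "u + b * (w div b) = w" by (rule eq)
    have "w div b < b ^ Suc T" using cons_less_power[OF u, of "w div b" "Suc T"] w eq by simp
    moreover have "edge u (digit b (w div b) 0) \<and> walk b T (w div b)"
      using walk_cons[OF u, of T "w div b"] w eq by simp
    ultimately show "w div b \<in> ?S" by simp
    show "val (digit b (w div b) T) = val (digit b w (Suc T))"
      using digit_cons_Suc[OF u, of "w div b" T] eq by simp
  next
    fix w assume w: "w \<in> ?S"
    show "(u + b * w) div b = w" using u by simp
    show "u + b * w \<in> {w. w < b ^ Suc (Suc T) \<and> digit b w 0 = u \<and> walk b (Suc T) w}"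
      using w cons_less_power[OF u, of w "Suc T"] walk_cons[OF u, of T w] digit_cons_0[OF u] by simp
  qed
  also have "\<dots> = (\<Sum>v\<in>{v. v < b \<and> edge u v}. \<Sum>w\<in>{w \<in> ?S. digit b w 0 = v}. val (digit b w T))"
    by (rule sum.group[symmetric]) (use u digit_less[of b] finS in auto)
  also have "\<dots> = (\<Sum>v\<in>{v. v < b \<and> edge u v}. val v)"
  proof (rule sum.cong[OF refl])
    fix v assume v: "v \<in> {v. v < b \<and> edge u v}"
    then have "{w \<in> ?S. digit b w 0 = v} = {w. w < b ^ Suc T \<and> digit b w 0 = v \<and> walk b T w}" by auto
    moreover have "V v" using closed[OF Suc.prems] v by simp
    ultimately show "(\<Sum>w\<in>{w \<in> ?S. digit b w 0 = v}. val (digit b w T)) = val v"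
      using Suc.IH by simp
  qed
  also have "\<dots> = val u" using step[OF Suc.prems] by simp
  finally show ?case .
qed

lemma digits_exist:
  assumes "\<And>t. t < N \<Longrightarrow> f t < b"
  shows "\<exists>w<b ^ N. \<forall>t<N. digit b w t = f t"
  using assms
proof (induction N arbitrary: f)
  case (Suc N)
  obtain w where w: "w < b ^ N" "\<forall>t<N. digit b w t = f (Suc t)" using Suc.IH[of "\<lambda>t. f (Suc t)"] Suc.prems by auto
  have f0: "f 0 < b" using Suc.prems by simp
  have "\<forall>t<Suc N. digit b (f 0 + b * w) t = f t"
    using w(2) by (simp add: All_less_Suc2 digit_cons_0[OF f0] digit_cons_Suc[OF f0])
  then show ?case using cons_less_power[OF f0, of w N] w(1) by blast
qed simp

lemma sum_codes:
  fixes f :: "nat set set \<Rightarrow> nat set set \<Rightarrow> int"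
  assumes "G \<subseteq> {(L, H). planar_space (P, L, H)}"
  shows "(\<Sum>c\<in>{c. pts c = P \<and> (lns c, pls c) \<in> G}. f (lns c) (pls c)) = (\<Sum>(L, H)\<in>G. f L H)"
proof (rule sum.reindex_bij_witness[of _ "\<lambda>(L, H). pspace_code (P, L, H)" "\<lambda>c. (lns c, pls c)"])
  fix c assume "c \<in> {c. pts c = P \<and> (lns c, pls c) \<in> G}"
  then show "(case (lns c, pls c) of (L, H) \<Rightarrow> pspace_code (P, L, H)) = c"
    using pspace_code_decode[of c] by auto
next
  fix g assume g: "g \<in> G"
  obtain L H where LH: "g = (L, H)" by (cases g)
  then have "planar_space (P, L, H)" using g assms by blast
  note dc = pspace_decode_code[OF this]
  show "(lns (case g of (L, H) \<Rightarrow> pspace_code (P, L, H)), pls (case g of (L, H) \<Rightarrow> pspace_code (P, L, H))) = g"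
    "(case g of (L, H) \<Rightarrow> pspace_code (P, L, H)) \<in> {c. pts c = P \<and> (lns c, pls c) \<in> G}"
    using dc g LH by (simp_all del: pspace_code.simps)
qed auto

lemma finite_codes:
  assumes "finite P" "G \<subseteq> {(L, H). planar_space (P, L, H)}"
  shows "finite {c. pts c = P \<and> (lns c, pls c) \<in> G}"
proof (rule finite_subset)
  show "{c. pts c = P \<and> (lns c, pls c) \<in> G} \<subseteq> (\<lambda>(L, H). pspace_code (P, L, H)) ` G"
  proof
    fix c assume "c \<in> {c. pts c = P \<and> (lns c, pls c) \<in> G}"
    then have "(lns c, pls c) \<in> G" "c = pspace_code (P, lns c, pls c)"
      using pspace_code_decode[of c] by auto
    then show "c \<in> (\<lambda>(L, H). pspace_code (P, L, H)) ` G" by force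
  qed
  show "finite ((\<lambda>(L, H). pspace_code (P, L, H)) ` G)"
    using finite_subset[OF assms(2) finite_planar_pairs[OF assms(1)]] by blast
qed

section \<open>Reachable states: bounds and invariant\<close>

lemma prod_encode_mono: "a \<le> a' \<Longrightarrow> b \<le> b' \<Longrightarrow> prod_encode (a, b) \<le> prod_encode (a', b')"
  unfolding prod_encode_def triangle_def
  by (simp, intro add_mono div_le_mono mult_le_mono) auto

lemma set_decode_bound: "set_decode p \<subseteq> {..<n} \<Longrightarrow> p < 2 ^ n"
proof -
  assume "set_decode p \<subseteq> {..<n}"
  then have "(\<Sum>x\<in>set_decode p. 2 ^ x) \<le> (\<Sum>x<n. 2 ^ x :: nat)" by (intro sum_mono2) auto
  moreover have "p = (\<Sum>x\<in>set_decode p. 2 ^ x)"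
    using set_decode_inverse[of p] by (simp add: set_encode_def)
  moreover have "(\<Sum>x<n. 2 ^ x :: nat) < 2 ^ n" by (induction n) auto
  ultimately show ?thesis by linarith
qed

lemma dsets_bound: "dsets b \<subseteq> Pow {..<n} \<Longrightarrow> b < 2 ^ 2 ^ n"
  by (rule set_decode_bound) (auto simp: dsets_subset_Pow intro: set_decode_bound)

text \<open>The invariant of walks. Exponent and number of points are coupled: a deletion releases 3
  units of the budget \<open>3 * n\<close>, exactly the largest possible
  \<open>freedom\<close>.\<close>

definition valid :: "nat \<Rightarrow> nat \<Rightarrow> bool" where
  "valid n u \<longleftrightarrow> planar_space (pspace_decode (space_of u)) \<and>
     (\<exists>m\<le>n. pts (space_of u) = {..<m} \<and> expo_of u + 3 * m \<le> 3 * n) \<and> sign_of u \<le> 1 \<and> label_of u \<le> n"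

lemma valid_planar: "valid n u \<Longrightarrow> planar_space (pspace_decode (space_of u))"
  unfolding valid_def by (rule conjunct1)

lemma valid_pts: "valid n u \<Longrightarrow> pts (space_of u) \<subseteq> {..<n}"
proof -
  assume "valid n u"
  then obtain m where "m \<le> n" "pts (space_of u) = {..<m}" unfolding valid_def by blast
  then show ?thesis by simp
qed

lemma start_valid: "start n u \<Longrightarrow> valid n u"
  unfolding valid_def
  by (intro conjI exI[of _ n]) (auto simp: start_def free_types_def simp del: planar_space.simps)

lemma valid_bound:
  assumes "valid n u" shows "u < state_bound n"
proof -
  let ?c = "space_of u"
  have pl: "planar_space (pts ?c, lns ?c, pls ?c)" and r: "sign_of u \<le> 1" "label_of u \<le> n"
    and "\<exists>m\<le>n. pts ?c = {..<m} \<and> expo_of u + 3 * m \<le> 3 * n"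
    using assms unfolding valid_def by blast+
  then obtain m where "m \<le> n" "pts ?c = {..<m}" "expo_of u + 3 * m \<le> 3 * n" by blast
  then have P: "pts ?c \<subseteq> {..<n}" and i: "expo_of u \<le> 3 * n" by auto
  have "lns ?c \<subseteq> Pow {..<n}" "pls ?c \<subseteq> Pow {..<n}"
    using planar_line_subset[OF pl] planar_plane_subset[OF pl] P by blast+
  then have "pfst ?c < 2 ^ n" "pfst (psnd ?c) < 2 ^ 2 ^ n" "psnd (psnd ?c) < 2 ^ 2 ^ n"
    using P set_decode_bound dsets_bound by (auto simp: pts_def lns_def pls_def)
  then have "prod_encode (pfst ?c, prod_encode (pfst (psnd ?c), psnd (psnd ?c))) \<le>
      prod_encode (2 ^ n, prod_encode (2 ^ 2 ^ n, 2 ^ 2 ^ n))"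
    by (intro prod_encode_mono) auto
  then have "?c \<le> prod_encode (2 ^ n, prod_encode (2 ^ 2 ^ n, 2 ^ 2 ^ n))" by simp
  then have "state ?c (sign_of u) (expo_of u) (label_of u) \<le>
      state (prod_encode (2 ^ n, prod_encode (2 ^ 2 ^ n, 2 ^ 2 ^ n))) 1 (3 * n) n"
    unfolding state_def using r i by (intro prod_encode_mono) auto
  then show ?thesis by (simp add: state_bound_def)
qed

lemma freedom_le: "freedom L H x \<le> 3"
  by (simp add: freedom_def)

lemma bij_shift: "x < Suc m \<Longrightarrow> bij_betw (shift x m) {..<m} ({..<Suc m} - {x})"
  by (rule bij_betw_byWitness[where f' = "\<lambda>y. if y = m then x else y"]) (auto simp: shift_def)

lemma is_deletion_planar: "is_deletion c x c' \<Longrightarrow> planar_space (pspace_decode c')"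
  unfolding is_deletion_def transports_def mem_Collect_eq prod.case by (elim conjE)

lemma is_specialization_planar: "is_specialization c x c' \<Longrightarrow> planar_space (pspace_decode c')"
  unfolding is_specialization_def specializations_def mem_Collect_eq prod.case by (elim conjE) (simp only:)

lemma edge_valid:
  assumes v: "valid n u" and e: "edge u v"
  shows "valid n v"
proof (cases "terminal (space_of u)")
  case True
  then show ?thesis using e v by (auto simp: edge_def terminal_def pivot_def)
next
  case False
  then obtain x where x: "x \<in> pts (space_of u)" and c: "is_deletion (space_of u) x (space_of v) \<and>
          sign_of v = sign_of u \<and> expo_of u \<le> expo_of v \<and>
          expo_of v \<le> expo_of u + freedom (lns (space_of u)) (pls (space_of u)) x \<and> label_of v = 0 \<or>
        is_deletion (space_of u) x (space_of v) \<and>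
          sign_of v = 1 - sign_of u \<and> expo_of v = expo_of u \<and> 0 < label_of v \<and>
          label_of v - 1 \<in> collisions (pts (space_of u)) (lns (space_of u)) (pls (space_of u)) x \<or>
        is_specialization (space_of u) x (space_of v) \<and>
          sign_of v = 1 - sign_of u \<and> expo_of v = expo_of u \<and> label_of v = 0"
    using e unfolding edge_def by blast
  obtain m where m: "m \<le> n" "pts (space_of u) = {..<m}" "expo_of u + 3 * m \<le> 3 * n"
    using v by (auto simp: valid_def)
  have s: "sign_of u \<le> 1" using v by (simp add: valid_def)
  have m0: "0 < m" using x m by auto
  \<comment> \<open>The label of a collision is the successor of a point below \<open>m\<close>,
    hence at most \<open>m\<close>.\<close>
  consider (del) "is_deletion (space_of u) x (space_of v)" "sign_of v \<le> 1" "expo_of v \<le> expo_of u + 3" "label_of v \<le> m"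
    | (spec) "is_specialization (space_of u) x (space_of v)" "sign_of v \<le> 1" "expo_of v = expo_of u" "label_of v = 0"
    using c s freedom_le[of "lns (space_of u)" "pls (space_of u)" x] m(2)
    by (fastforce simp: collisions_def)
  then show ?thesis
  proof cases
    case del
    have "pts (space_of v) = {..<m - 1}" using del(1) m by (simp add: is_deletion_def)
    then show ?thesis unfolding valid_def
      using is_deletion_planar[OF del(1)] del m m0 by (intro conjI exI[of _ "m - 1"]) auto
  next
    case spec
    have "pts (space_of v) = {..<m}" using spec(1) m by (simp add: is_specialization_def)
    then show ?thesis unfolding valid_def
      using is_specialization_planar[OF spec(1)] spec m by (intro conjI exI[of _ m]) auto
  qed
qed

section \<open>Termination of the expansion\<close>

definition dependent_sets :: "nat set set \<Rightarrow> nat set \<Rightarrow> nat set set" where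
  "dependent_sets L P = {Q. Q \<subseteq> P \<and> 2 \<le> card Q \<and> covered L Q}"

text \<open>The lexicographic order on the number of points and the number of dependencies still
  missing, packed into one number: the weight of a point exceeds every value of the second
  summand.\<close>

definition potential :: "nat \<Rightarrow> nat \<Rightarrow> nat" where
  "potential n c = card (pts c) * (2 * 2 ^ n + 1) +
     (2 * 2 ^ n - (card (dependent_sets (lns c) (pts c)) + card (dependent_sets (pls c) (pts c))))"

lemma finite_dependent_sets: "finite P \<Longrightarrow> finite (dependent_sets L P)"
  by (rule finite_subset[of _ "Pow P"]) (auto simp: dependent_sets_def)

lemma card_dependent_sets: "card (dependent_sets L {..<m}) \<le> 2 ^ m"
proof -
  have "card (dependent_sets L {..<m}) \<le> card (Pow {..<m})"
    by (rule card_mono) (auto simp: dependent_sets_def)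
  then show ?thesis by (simp add: card_Pow)
qed

lemma potential_bound: "pts c = {..<m} \<Longrightarrow> m \<le> n \<Longrightarrow> potential n c < num_steps n"
proof -
  assume "pts c = {..<m}" "m \<le> n"
  then have "potential n c \<le> n * (2 * 2 ^ n + 1) + 2 * 2 ^ n"
    unfolding potential_def by (intro add_mono mult_le_mono) auto
  then show ?thesis by (simp add: num_steps_def)
qed

text \<open>A deletion lowers the number of points. A specialization keeps all dependent sets, and
  being a different space on the same points it has at least one more, by
  \<open>planar_eqI\<close>.\<close>

lemma edge_potential:
  assumes v: "valid n u" and e: "edge u v" and nt: "\<not> terminal (space_of u)"
  shows "potential n (space_of v) < potential n (space_of u)"
proof -
  obtain x where x: "x \<in> pts (space_of u)"
    and c: "is_deletion (space_of u) x (space_of v) \<or> is_specialization (space_of u) x (space_of v)"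
    using e nt unfolding edge_def by blast
  let ?c = "space_of u" and ?d = "space_of v" and ?K = "2 * 2 ^ n :: nat"
  obtain m where m: "m \<le> n" "pts ?c = {..<m}" using v by (auto simp: valid_def)
  have pl: "planar_space (pspace_decode ?c)" using v by (simp add: valid_def del: planar_space.simps)
  from c show ?thesis
  proof
    assume d: "is_deletion ?c x ?d"
    then have "card (pts ?d) = m - 1" using m by (simp add: is_deletion_def)
    then have "potential n ?d \<le> (m - 1) * (?K + 1) + ?K" by (simp add: potential_def)
    also have "\<dots> < m * (?K + 1)" using x m by (cases m) auto
    also have "\<dots> \<le> potential n ?c" using m by (simp add: potential_def)
    finally show ?thesis .
  next
    assume s: "is_specialization ?c x ?d"
    then have P: "pts ?d = {..<m}" and ne: "?d \<noteq> ?c" and dg: "degenerates {..<m} (lns ?c) (pls ?c) (lns ?d) (pls ?d)"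
      and pl': "planar_space (pspace_decode ?d)"
      using m by (auto simp: is_specialization_def specializations_def simp del: planar_space.simps)
    let ?l = "dependent_sets (lns ?c) {..<m}" and ?l' = "dependent_sets (lns ?d) {..<m}"
    let ?h = "dependent_sets (pls ?c) {..<m}" and ?h' = "dependent_sets (pls ?d) {..<m}"
    have sub: "?l \<subseteq> ?l'" "?h \<subseteq> ?h'" using dg by (auto simp: degenerates_def dependent_sets_def)
    have fin: "finite ?l'" "finite ?h'" by (simp_all add: finite_dependent_sets)
    note le = card_mono[OF fin(1) sub(1)] card_mono[OF fin(2) sub(2)]
    have "card ?l + card ?h \<noteq> card ?l' + card ?h'"
    proof
      assume "card ?l + card ?h = card ?l' + card ?h'"
      then have "card ?l = card ?l'" "card ?h = card ?h'" using le by linarith+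
      then have eq: "?l = ?l'" "?h = ?h'" using card_subset_eq[OF fin(1) sub(1)] card_subset_eq[OF fin(2) sub(2)] by auto
      have "lns ?c = lns ?d \<and> pls ?c = pls ?d"
      proof (rule planar_eqI[of "{..<m}"])
        show "planar_space ({..<m}, lns ?c, pls ?c)" "planar_space ({..<m}, lns ?d, pls ?d)"
          using pl pl' P m by (simp_all del: planar_space.simps)
        fix Q :: "nat set" assume "Q \<subseteq> {..<m}" "2 \<le> card Q"
        then show "(covered (lns ?c) Q \<longleftrightarrow> covered (lns ?d) Q) \<and> (covered (pls ?c) Q \<longleftrightarrow> covered (pls ?d) Q)"
          using eq by (auto simp: dependent_sets_def)
      qed
      then show False using ne pspace_decode_eq_iff[of ?c ?d] P m by simp
    qed
    then have lt: "card ?l + card ?h < card ?l' + card ?h'" using le by linarith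
    have "(2::nat) ^ m \<le> 2 ^ n" using m by simp
    then have "card ?l' + card ?h' \<le> ?K"
      using card_dependent_sets[of "lns ?d" m] card_dependent_sets[of "pls ?d" m] by linarith
    then show ?thesis using lt P m by (simp add: potential_def)
  qed
qed

lemma walk_valid:
  assumes "valid n (digit b w 0)" "walk b T w" "t \<le> T"
  shows "valid n (digit b w t)"
  using assms(3)
proof (induction t)
  case (Suc t)
  then show ?case using edge_valid assms(2) unfolding walk_def by (meson Suc_le_lessD less_imp_le_nat)
qed (use assms in simp)

text \<open>The potential starts below \<open>num_steps n\<close> and drops with every step from a
  nonterminal state, so a walk of this length cannot avoid terminal states; once reached, they are
  never left.\<close>

lemma walk_terminal:
  assumes v: "valid n (digit b w 0)" and w: "walk b (num_steps n) w"
  shows "terminal (space_of (digit b w (num_steps n)))"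
proof -
  let ?d = "digit b w"
  have "terminal (space_of (?d t)) \<or> potential n (space_of (?d t)) + t \<le> potential n (space_of (?d 0))"
    if "t \<le> num_steps n" for t
    using that
  proof (induction t)
    case (Suc t)
    have e: "edge (?d t) (?d (Suc t))" using w Suc.prems by (simp add: walk_def)
    have vt: "valid n (?d t)" using walk_valid[OF v w] Suc.prems by simp
    show ?case
    proof (cases "terminal (space_of (?d t))")
      case True
      then have "?d (Suc t) = ?d t" using e by (auto simp: edge_def terminal_def pivot_def)
      then show ?thesis using True by simp
    next
      case False
      then show ?thesis using edge_potential[OF vt e] Suc by auto
    qed
  qed simp
  from this[of "num_steps n"] show ?thesis
    using v potential_bound[of "space_of (?d 0)" _ n] by (fastforce simp: valid_def)
qed

lemma state_eq_iff:
  "state c s i y = state c' s' i' y' \<longleftrightarrow> c = c' \<and> s = s' \<and> i = i' \<and> y = y'"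
  by (auto simp: state_def)

context finite_field4
begin

definition val :: "nat \<Rightarrow> int" where
  "val u = (- 1) ^ sign_of u * int (card (carrier R)) ^ expo_of u *
     int (nreal (pts (space_of u)) (lns (space_of u)) (pls (space_of u)))"

text \<open>The recursion at the pivot, term by term: \<open>A\<close> holds the powers of
  \<open>q\<close> from the geometric sum, \<open>B\<close> the collisions, \<open>E\<close> the
  proper specializations. Labels separate different collisions from each other, and being positive
  they separate \<open>B\<close> from \<open>A\<close>.\<close>

lemma val_expansion:
  assumes v: "valid n u"
  shows "val u = (\<Sum>v\<in>{v. v < state_bound n \<and> edge u v}. val v)"
proof -
  have set: "{v. v < state_bound n \<and> edge u v} = {v. edge u v}"
    using edge_valid[OF v] valid_bound by blast
  let ?c = "space_of u" and ?s = "sign_of u" and ?i = "expo_of u" and ?q = "int (card (carrier R))"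
  let ?L = "lns ?c" and ?H = "pls ?c"
  show ?thesis
  proof (cases "terminal ?c")
    case True
    then have "{v. edge u v} = {u}" by (auto simp: edge_def terminal_def pivot_def)
    then show ?thesis unfolding set by simp
  next
    case False
    obtain m where m: "m \<le> n" "pts ?c = {..<m}" using v by (auto simp: valid_def)
    have pl: "planar_space ({..<m}, ?L, ?H)" using v m by (simp add: valid_def del: planar_space.simps)
    have s: "?s \<le> 1" using v by (simp add: valid_def)
    define x where "x = (LEAST x. x \<in> pts ?c \<and> removable ?L ?H x)"
    have "\<exists>x. x \<in> pts ?c \<and> removable ?L ?H x" using False by (auto simp: terminal_def)
    then have "x \<in> pts ?c \<and> removable ?L ?H x" unfolding x_def by (rule LeastI_ex)
    then have x: "x \<in> pts ?c" "removable ?L ?H x" by simp_all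
    have "pivot ?c x" unfolding pivot_def using x not_less_Least x_def by blast
    then have piv: "pivot ?c z \<longleftrightarrow> z = x" for z
      unfolding pivot_def by (meson linorder_neqE_nat)
    obtain m' where m': "m = Suc m'" using x m by (cases m) auto
    let ?k = "freedom ?L ?H x" and ?C = "collisions {..<m} ?L ?H x"
    define D where "D = {c'. is_deletion ?c x c'}"
    define S where "S = {c'. is_specialization ?c x c'}"
    have D: "D = {c'. pts c' = {..<m'} \<and> (lns c', pls c') \<in> transports {..<m'} (shift x m') ?L ?H}"
      unfolding D_def is_deletion_def using m m' by auto
    have S: "S = {c'. pts c' = {..<m} \<and> (lns c', pls c') \<in> specializations {..<m} ?L ?H x - {(?L, ?H)}}"
      unfolding S_def is_specialization_def using m pspace_decode_eq_iff[of _ ?c] by auto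
    have tr: "transports {..<m'} (shift x m') ?L ?H \<subseteq> {(L, H). planar_space ({..<m'}, L, H)}"
      by (auto simp: transports_def simp del: planar_space.simps)
    have sp: "specializations {..<m} ?L ?H x - {(?L, ?H)} \<subseteq> {(L, H). planar_space ({..<m}, L, H)}"
      by (auto simp: specializations_def simp del: planar_space.simps)
    have fin: "finite D" "finite S" "finite ?C"
      unfolding D S using finite_codes[OF _ tr] finite_codes[OF _ sp] by (auto simp: collisions_def)
    define A where "A = (\<lambda>(c', e). state c' ?s (?i + e) 0) ` (D \<times> {..<Suc ?k})"
    define B where "B = (\<lambda>(c', y). state c' (1 - ?s) ?i (Suc y)) ` (D \<times> ?C)"
    define E where "E = (\<lambda>c'. state c' (1 - ?s) ?i 0) ` S"
    have edge_iff: "edge u v \<longleftrightarrow> 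
      (is_deletion ?c x (space_of v) \<and> sign_of v = ?s \<and> ?i \<le> expo_of v \<and> expo_of v \<le> ?i + ?k \<and> label_of v = 0) \<or>
      (is_deletion ?c x (space_of v) \<and> sign_of v = 1 - ?s \<and> expo_of v = ?i \<and> 0 < label_of v \<and> label_of v - 1 \<in> ?C) \<or>
      (is_specialization ?c x (space_of v) \<and> sign_of v = 1 - ?s \<and> expo_of v = ?i \<and> label_of v = 0)" for v
      unfolding edge_def piv using False x(1) m(2) by auto
    have "{v. edge u v} = A \<union> B \<union> E"
    proof (intro equalityI subsetI)
      fix v assume "v \<in> {v. edge u v}"
      then have e: "edge u v" by simp
      have vv: "v = state (space_of v) (sign_of v) (expo_of v) (label_of v)" by simp
      from e[unfolded edge_iff] show "v \<in> A \<union> B \<union> E"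
      proof (elim disjE conjE)
        assume a: "is_deletion ?c x (space_of v)" "sign_of v = ?s" "?i \<le> expo_of v" "expo_of v \<le> ?i + ?k" "label_of v = 0"
        then have "v = (\<lambda>(c', e). state c' ?s (?i + e) 0) (space_of v, expo_of v - ?i)" using vv by simp
        moreover have "(space_of v, expo_of v - ?i) \<in> D \<times> {..<Suc ?k}" using a by (auto simp: D_def)
        ultimately show ?thesis unfolding A_def by blast
      next
        assume a: "is_deletion ?c x (space_of v)" "sign_of v = 1 - ?s" "expo_of v = ?i" "0 < label_of v" "label_of v - 1 \<in> ?C"
        then have "v = (\<lambda>(c', y). state c' (1 - ?s) ?i (Suc y)) (space_of v, label_of v - 1)" using vv by simp
        moreover have "(space_of v, label_of v - 1) \<in> D \<times> ?C" using a by (auto simp: D_def)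
        ultimately show ?thesis unfolding B_def by blast
      next
        assume a: "is_specialization ?c x (space_of v)" "sign_of v = 1 - ?s" "expo_of v = ?i" "label_of v = 0"
        then have "v = (\<lambda>c'. state c' (1 - ?s) ?i 0) (space_of v)" using vv by simp
        moreover have "space_of v \<in> S" using a by (auto simp: S_def)
        ultimately show ?thesis unfolding E_def by blast
      qed
    next
      fix v assume "v \<in> A \<union> B \<union> E"
      then have "edge u v" unfolding edge_iff A_def B_def E_def D_def S_def by auto
      then show "v \<in> {v. edge u v}" by simp
    qed
    moreover have "A \<inter> B = {}" unfolding A_def B_def by (auto simp: state_eq_iff)
    \<comment> \<open>Deleted spaces have one point fewer than specializations.\<close>
    moreover have "(A \<union> B) \<inter> E = {}"
    proof (intro equals0I)
      fix v assume "v \<in> (A \<union> B) \<inter> E"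
      then have v: "v \<in> A \<or> v \<in> B" "v \<in> E" by blast+
      have "space_of v \<in> D" using v(1) unfolding A_def B_def by auto
      moreover have "space_of v \<in> S" using v(2) unfolding E_def by auto
      ultimately have "{..<m'} = {..<m}" unfolding D S by simp
      then show False using m' by (simp add: lessThan_eq_iff)
    qed
    moreover have "finite A" "finite B" "finite E" unfolding A_def B_def E_def using fin by auto
    ultimately have total: "(\<Sum>v\<in>{v. edge u v}. val v) = sum val A + sum val B + sum val E"
      by (simp add: sum.union_disjoint)
    define N where "N = (\<Sum>c'\<in>D. int (nreal {..<m'} (lns c') (pls c')))"
    have ptsD: "pts c' = {..<m'}" if "c' \<in> D" for c' using that by (simp add: D)
    have ptsS: "pts c' = {..<m}" if "c' \<in> S" for c' using that by (simp add: S)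
    have "sum val A = (\<Sum>(c', e)\<in>D \<times> {..<Suc ?k}. val (state c' ?s (?i + e) 0))"
      unfolding A_def by (subst sum.reindex) (auto simp: inj_on_def state_eq_iff split_def)
    also have "\<dots> = (\<Sum>c'\<in>D. \<Sum>e<Suc ?k. val (state c' ?s (?i + e) 0))"
      by (simp only: sum.cartesian_product)
    also have "\<dots> = (\<Sum>c'\<in>D. \<Sum>e<Suc ?k. (- 1) ^ ?s * ?q ^ ?i * (int (nreal {..<m'} (lns c') (pls c')) * ?q ^ e))"
      by (intro sum.cong refl) (simp add: val_def ptsD power_add)
    also have "\<dots> = (- 1) ^ ?s * ?q ^ ?i * (N * (\<Sum>e<Suc ?k. ?q ^ e))"
      unfolding N_def by (simp only: sum_distrib_left[symmetric] sum_distrib_right[symmetric])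
    finally have sumA: "sum val A = (- 1) ^ ?s * ?q ^ ?i * (N * (\<Sum>e<Suc ?k. ?q ^ e))" .
    \<comment> \<open>Signs stay in {0, 1}, where \<open>1 - s\<close> changes the parity.\<close>
    have sgn: "(- 1) ^ (1 - ?s) = - ((- 1) ^ ?s :: int)" using s by (cases "?s = 0") (auto simp: le_Suc_eq)
    have "sum val B = (\<Sum>(c', y)\<in>D \<times> ?C. val (state c' (1 - ?s) ?i (Suc y)))"
      unfolding B_def by (subst sum.reindex) (auto simp: inj_on_def state_eq_iff split_def)
    also have "\<dots> = (\<Sum>c'\<in>D. \<Sum>y\<in>?C. val (state c' (1 - ?s) ?i (Suc y)))"
      by (simp only: sum.cartesian_product)
    also have "\<dots> = (\<Sum>c'\<in>D. \<Sum>y\<in>?C. - ((- 1) ^ ?s * ?q ^ ?i) * int (nreal {..<m'} (lns c') (pls c')))"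
      by (intro sum.cong refl) (simp add: val_def ptsD sgn[unfolded One_nat_def])
    also have "\<dots> = - ((- 1) ^ ?s * ?q ^ ?i) * (N * int (card ?C))"
      unfolding N_def by (simp add: sum_distrib_left sum_distrib_right ac_simps)
    finally have sumB: "sum val B = - ((- 1) ^ ?s * ?q ^ ?i) * (N * int (card ?C))" .
    have "sum val E = (\<Sum>c'\<in>S. val (state c' (1 - ?s) ?i 0))"
      unfolding E_def by (subst sum.reindex) (auto simp: inj_on_def state_eq_iff)
    also have "\<dots> = (\<Sum>c'\<in>S. - ((- 1) ^ ?s * ?q ^ ?i) * int (nreal {..<m} (lns c') (pls c')))"
      by (intro sum.cong refl) (simp add: val_def ptsS sgn[unfolded One_nat_def])
    also have "\<dots> = - ((- 1) ^ ?s * ?q ^ ?i) * (\<Sum>c'\<in>S. int (nreal {..<m} (lns c') (pls c')))"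
      by (simp only: sum_distrib_left)
    finally have sumE: "sum val E = - ((- 1) ^ ?s * ?q ^ ?i) * (\<Sum>c'\<in>S. int (nreal {..<m} (lns c') (pls c')))" .
    have N: "N = (\<Sum>(L', H')\<in>transports {..<m'} (shift x m') ?L ?H. int (nreal {..<m'} L' H'))"
      unfolding N_def D by (rule sum_codes[OF tr])
    have SS: "(\<Sum>c'\<in>S. int (nreal {..<m} (lns c') (pls c'))) =
        (\<Sum>(L', H')\<in>specializations {..<m} ?L ?H x - {(?L, ?H)}. int (nreal {..<m} L' H'))"
      unfolding S by (rule sum_codes[OF sp])
    have "x \<in> {..<m}" using x m by simp
    moreover have "bij_betw (shift x m') {..<m'} ({..<m} - {x})" using bij_shift[of x m'] x m m' by simp
    ultimately have "int (nreal {..<m} ?L ?H) = N * ((\<Sum>e<Suc ?k. ?q ^ e) - int (card ?C)) -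
        (\<Sum>c'\<in>S. int (nreal {..<m} (lns c') (pls c')))"
      unfolding N SS by (intro nreal_recursion[OF pl _ x(2)]) auto
    then have "val u = (- 1) ^ ?s * ?q ^ ?i * (N * ((\<Sum>e<Suc ?k. ?q ^ e) - int (card ?C)) -
        (\<Sum>c'\<in>S. int (nreal {..<m} (lns c') (pls c'))))"
      using m by (simp add: val_def del: sum.lessThan_Suc)
    also have "\<dots> = sum val A + sum val B + sum val E"
      unfolding sumA sumB sumE by (simp add: algebra_simps del: sum.lessThan_Suc)
    finally show ?thesis unfolding set total .
  qed
qed

text \<open>Start states have sign and exponent 0, so their values are the summands of
  \<open>num_arcs_eq\<close>; \<open>walk_sum\<close> moves these values to the ends of the
  walks.\<close>

lemma num_arcs_walks:
  "int (num_arcs R n) = (\<Sum>w\<in>{w. w < state_bound n ^ Suc (num_steps n) \<and>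
     start n (digit (state_bound n) w 0) \<and> walk (state_bound n) (num_steps n) w}. val (end_of n w))"
proof -
  let ?b = "state_bound n" and ?T = "num_steps n"
  let ?W = "{w. w < ?b ^ Suc ?T \<and> start n (digit ?b w 0) \<and> walk ?b ?T w}"
  have free: "free_types n \<subseteq> {(L, H). planar_space ({..<n}, L, H)}"
    by (auto simp: free_types_def simp del: planar_space.simps)
  have "{u. start n u} \<subseteq> {..<?b}" using start_valid valid_bound by blast
  then have fin: "finite {u. start n u}" using finite_subset by blast
  have "int (num_arcs R n) = (\<Sum>(L, H)\<in>free_types n. int (nreal {..<n} L H))"
    unfolding num_arcs_eq by (simp add: split_def)
  also have "\<dots> = (\<Sum>c\<in>{c. pts c = {..<n} \<and> (lns c, pls c) \<in> free_types n}. int (nreal {..<n} (lns c) (pls c)))"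
    by (rule sum_codes[OF free, symmetric])
  also have "\<dots> = (\<Sum>u\<in>{u. start n u}. val u)"
  proof (rule sum.reindex_bij_witness[of _ space_of "\<lambda>c. state c 0 0 0"])
    fix u assume "u \<in> {u. start n u}"
    then show "state (space_of u) 0 0 0 = u"
      using state_simps(5)[of u] by (simp add: start_def del: state_simps(5))
  qed (auto simp: start_def val_def)
  also have "\<dots> = (\<Sum>u\<in>{u. start n u}. \<Sum>w\<in>{w. w < ?b ^ Suc ?T \<and> digit ?b w 0 = u \<and> walk ?b ?T w}. val (digit ?b w ?T))"
    by (rule sum.cong[OF refl], rule walk_sum[where V = "valid n", symmetric])
      (use val_expansion edge_valid valid_bound start_valid in auto)
  also have "\<dots> = (\<Sum>u\<in>{u. start n u}. \<Sum>w\<in>{w \<in> ?W. digit ?b w 0 = u}. val (digit ?b w ?T))"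
    by (intro sum.cong refl) auto
  also have "\<dots> = (\<Sum>w\<in>?W. val (digit ?b w ?T))"
    by (rule sum.group) (use fin in auto)
  finally show ?thesis by (simp only: end_of_def)
qed

end

section \<open>Isomorphism classes of hyperfigurations\<close>

lemma iso_code_iff:
  assumes "pts c \<subseteq> {..<n}" "pts c' \<subseteq> {..<n}" and pl: "planar_space (pspace_decode c)"
  shows "iso_code n c c' \<longleftrightarrow> pspace_iso (pspace_decode c) (pspace_decode c')"
proof
  assume "iso_code n c c'"
  then show "pspace_iso (pspace_decode c) (pspace_decode c')" by (auto simp: iso_code_def)
next
  assume "pspace_iso (pspace_decode c) (pspace_decode c')"
  then obtain \<phi> where \<phi>: "bij_betw \<phi> (pts c) (pts c')" "(\<lambda>l. \<phi> ` l) ` lns c = lns c'" "(\<lambda>h. \<phi> ` h) ` pls c = pls c'"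
    by auto
  \<comment> \<open>Off the point set the table is filled with 0, which is a legal digit because
    \<open>t < n\<close> makes \<open>n\<close> positive.\<close>
  have less: "(if t \<in> pts c then \<phi> t else 0) < n" if "t < n" for t
  proof (cases "t \<in> pts c")
    case True
    then have "\<phi> t \<in> pts c'" using bij_betwE[OF \<phi>(1)] by blast
    then show ?thesis using True assms(2) by auto
  qed (use that in simp)
  obtain g where g: "g < n ^ n" "\<forall>t<n. digit n g t = (if t \<in> pts c then \<phi> t else 0)"
    using digits_exist[of n "\<lambda>t. if t \<in> pts c then \<phi> t else 0" n, OF less] by blast
  have eq: "digit n g t = \<phi> t" if "t \<in> pts c" for t using g(2) that assms(1) by auto
  have im: "digit n g ` A = \<phi> ` A" if "A \<subseteq> pts c" for A using eq that by (intro image_cong) auto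
  have "bij_betw (digit n g) (pts c) (pts c')"
    using \<phi>(1) bij_betw_cong[of "pts c" "digit n g" \<phi>] eq by blast
  moreover have "(\<lambda>l. digit n g ` l) ` lns c = lns c'"
    unfolding \<phi>(2)[symmetric] by (intro image_cong refl im planar_line_subset[OF pl])
  moreover have "(\<lambda>h. digit n g ` h) ` pls c = pls c'"
    unfolding \<phi>(3)[symmetric] by (intro image_cong refl im planar_plane_subset[OF pl])
  ultimately show "iso_code n c c'" unfolding iso_code_def using g(1) by blast
qed

lemma pspace_iso_refl: "pspace_iso f f"
  by (cases f) (auto intro!: exI[of _ id])

lemma pspace_iso_sym:
  assumes "planar_space f" "pspace_iso f g" shows "pspace_iso g f"
proof -
  obtain P L H P' L' H' where fg: "f = (P, L, H)" "g = (P', L', H')" by (cases f, cases g)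
  then have pl: "planar_space (P, L, H)" using assms by simp
  obtain \<phi> where \<phi>: "bij_betw \<phi> P P'" "(\<lambda>l. \<phi> ` l) ` L = L'" "(\<lambda>h. \<phi> ` h) ` H = H'"
    using assms(2) fg by auto
  let ?i = "the_inv_into P \<phi>"
  have inj: "inj_on \<phi> P" using \<phi> by (simp add: bij_betw_def)
  have im: "?i ` \<phi> ` A = A" if "A \<subseteq> P" for A
  proof -
    have "?i (\<phi> a) = a" if "a \<in> A" for a using the_inv_into_f_f[OF inj] that \<open>A \<subseteq> P\<close> by blast
    then show ?thesis by (simp add: image_image)
  qed
  have "(\<lambda>l. ?i ` l) ` L' = (\<lambda>l. ?i ` \<phi> ` l) ` L" unfolding \<phi>(2)[symmetric] by (rule image_image)
  also have "\<dots> = (\<lambda>l. l) ` L" by (intro image_cong refl im planar_line_subset[OF pl])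
  finally have L: "(\<lambda>l. ?i ` l) ` L' = L" by simp
  have "(\<lambda>h. ?i ` h) ` H' = (\<lambda>h. ?i ` \<phi> ` h) ` H" unfolding \<phi>(3)[symmetric] by (rule image_image)
  also have "\<dots> = (\<lambda>h. h) ` H" by (intro image_cong refl im planar_plane_subset[OF pl])
  finally have "(\<lambda>h. ?i ` h) ` H' = H" by simp
  with L show ?thesis using bij_betw_the_inv_into[OF \<phi>(1)] fg by auto
qed

lemma pspace_iso_trans:
  assumes "pspace_iso f g" "pspace_iso g h" shows "pspace_iso f h"
proof -
  obtain P L H P' L' H' P'' L'' H'' where fgh: "f = (P, L, H)" "g = (P', L', H')" "h = (P'', L'', H'')"
    by (cases f, cases g, cases h)
  obtain \<phi> where \<phi>: "bij_betw \<phi> P P'" "(\<lambda>l. \<phi> ` l) ` L = L'" "(\<lambda>h. \<phi> ` h) ` H = H'"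
    using assms(1) fgh by auto
  obtain \<psi> where \<psi>: "bij_betw \<psi> P' P''" "(\<lambda>l. \<psi> ` l) ` L' = L''" "(\<lambda>h. \<psi> ` h) ` H' = H''"
    using assms(2) fgh by auto
  have "(\<lambda>l. (\<psi> \<circ> \<phi>) ` l) ` L = L''" "(\<lambda>h. (\<psi> \<circ> \<phi>) ` h) ` H = H''"
    unfolding \<psi>(2,3)[symmetric] \<phi>(2,3)[symmetric] by (simp_all add: image_image image_comp[symmetric])
  then show ?thesis using bij_betw_trans[OF \<phi>(1) \<psi>(1)] fgh by auto
qed

definition iso_rel :: "nat \<Rightarrow> (nat pspace \<times> nat pspace) set" where
  "iso_rel n = {(f, g). f \<in> std_hyperfigurations n \<and> g \<in> std_hyperfigurations n \<and> pspace_iso f g}"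

lemma std_planar: "f \<in> std_hyperfigurations n \<Longrightarrow> planar_space f"
  by (cases f) (auto simp: std_hyperfigurations_def simp del: planar_space.simps)

lemma equiv_iso_rel: "equiv (std_hyperfigurations n) (iso_rel n)"
proof (rule equivI)
  show "sym (iso_rel n)" by (rule symI) (auto simp: iso_rel_def intro: pspace_iso_sym std_planar)
  show "trans (iso_rel n)" by (rule transI) (auto simp: iso_rel_def intro: pspace_iso_trans)
qed (auto simp: iso_rel_def refl_on_def pspace_iso_refl)

lemma finite_std_hyperfigurations: "finite (std_hyperfigurations n)"
proof (rule finite_subset)
  show "std_hyperfigurations n \<subseteq> (\<Union>m\<le>n. (\<lambda>(L, H). ({..<m}, L, H)) ` {(L, H). planar_space ({..<m}, L, H)})"
  proof
    fix f assume f: "f \<in> std_hyperfigurations n"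
    then obtain m L H where m: "m \<le> n" "f = ({..<m}, L, H)" by (cases f) (auto simp: std_hyperfigurations_def)
    then have "(L, H) \<in> {(L, H). planar_space ({..<m}, L, H)}"
      using std_planar[OF f] by (simp del: planar_space.simps)
    then have "f \<in> (\<lambda>(L, H). ({..<m}, L, H)) ` {(L, H). planar_space ({..<m}, L, H)}"
      using m(2) by (intro image_eqI[of _ _ "(L, H)"]) auto
    then show "f \<in> (\<Union>m\<le>n. (\<lambda>(L, H). ({..<m}, L, H)) ` {(L, H). planar_space ({..<m}, L, H)})"
      using m(1) by blast
  qed
qed (auto simp del: planar_space.simps intro: finite_planar_pairs)

text \<open>Having no removable point is the hyperfiguration condition, so the expansion stops
  exactly there.\<close>

lemma std_iff_terminal:
  assumes "planar_space (pspace_decode c)" "pts c = {..<m}" "m \<le> n" "terminal c"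
  shows "pspace_decode c \<in> std_hyperfigurations n"
  using assms unfolding std_hyperfigurations_def terminal_def removable_def
  by (auto simp del: planar_space.simps)

lemma std_decode_code:
  assumes "f \<in> std_hyperfigurations n"
  shows "pspace_decode (pspace_code f) = f" "pts (pspace_code f) \<subseteq> {..<n}"
proof -
  obtain m L H where m: "m \<le> n" "f = ({..<m}, L, H)"
    using assms by (cases f) (auto simp: std_hyperfigurations_def)
  then have "planar_space ({..<m}, L, H)" using std_planar[OF assms] by (simp del: planar_space.simps)
  from pspace_decode_code[OF this] show d: "pspace_decode (pspace_code f) = f" using m by simp
  then show "pts (pspace_code f) \<subseteq> {..<n}" using m by auto
qed

text \<open>This space counts as a hyperfiguration but, as the empty set lies on a projective line and on
  none of its lines, has no strong realization. So its polynomial is free to be the constant term.\<close>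

definition empty_space :: "nat pspace" where "empty_space = ({}, {}, {{}})"

text \<open>The point of a one-point space has index (0, 0), which violates the hyperfiguration
  condition, whereas the empty space satisfies it vacuously.\<close>

lemma std_small:
  assumes "f \<in> std_hyperfigurations n"
  shows "f = empty_space \<or> 2 \<le> card (fst f)"
proof -
  obtain m L H where m: "m \<le> n" "f = ({..<m}, L, H)" and hyp: "hyperfiguration ({..<m}, L, H)"
    using assms by (cases f) (auto simp: std_hyperfigurations_def simp del: hyperfiguration.simps)
  then have pl: "planar_space ({..<m}, L, H)" by simp
  consider "m = 0" | "m = 1" | "2 \<le> m" by linarith
  then show ?thesis
  proof cases
    case 1
    have "L = {}" using planar_line_subset[OF pl] planar_line_card[OF pl] 1 by fastforce
    moreover have "H = {{}}" using planar_plane_collinear[OF pl] 1 by simp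
    ultimately show ?thesis using m 1 by (simp add: empty_space_def)
  next
    case 2
    have small: "card A \<le> 1" if "A \<subseteq> {..<m}" for A using card_mono[OF _ that] 2 by simp
    have "{l \<in> L. 0 \<in> l \<and> 3 \<le> card l} = {}" "{h \<in> H. 0 \<in> h \<and> 4 \<le> card h} = {}"
      using small[OF planar_line_subset[OF pl]] small[OF planar_plane_subset[OF pl]] by fastforce+
    then have "full_line_index L 0 = 0" "full_plane_index H 0 = 0"
      unfolding full_line_index_def full_plane_index_def by (simp_all only: card.empty)
    then show ?thesis using hyp 2 by (auto simp del: planar_space.simps)
  qed (simp add: m)
qed

lemma empty_space_std: "empty_space \<in> std_hyperfigurations n"
  by (auto simp: empty_space_def std_hyperfigurations_def linear_space_def intro: exI[of _ 0])

lemma empty_space_class: "iso_rel n `` {empty_space} = {empty_space}"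
proof -
  have "g = empty_space" if g: "g \<in> std_hyperfigurations n" "pspace_iso empty_space g" for g
  proof -
    obtain P L H where PLH: "g = (P, L, H)" by (cases g)
    then have "P = {}" using g(2) by (auto simp: empty_space_def bij_betw_def)
    then show ?thesis using std_small[OF g(1)] PLH by auto
  qed
  then show ?thesis using empty_space_std[of n]
    by (auto simp: iso_rel_def pspace_iso_refl simp del: pspace_iso.simps)
qed

text \<open>Ends are counted up to isomorphism, so the polynomial depends on the class only and may
  be computed from the code of any member.\<close>

lemma num_walks_cong:
  assumes "f \<in> std_hyperfigurations n" "g \<in> std_hyperfigurations n" "pspace_iso f g"
  shows "num_walks n (pspace_code f) s i = num_walks n (pspace_code g) s i"
proof -
  have "iso_code n (space_of (end_of n w)) (pspace_code f) \<longleftrightarrow> iso_code n (space_of (end_of n w)) (pspace_code g)"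
    if w: "start n (digit (state_bound n) w 0)" "walk (state_bound n) (num_steps n) w" for w
  proof -
    from walk_valid[OF start_valid[OF w(1)] w(2), of "num_steps n"] have "valid n (end_of n w)" by (simp add: end_of_def)
    then have v: "pts (space_of (end_of n w)) \<subseteq> {..<n}" "planar_space (pspace_decode (space_of (end_of n w)))"
      by (rule valid_pts, rule valid_planar)
    show ?thesis
      unfolding iso_code_iff[OF v(1) std_decode_code(2)[OF assms(1)] v(2)]
        iso_code_iff[OF v(1) std_decode_code(2)[OF assms(2)] v(2)]
        std_decode_code(1)[OF assms(1)] std_decode_code(1)[OF assms(2)]
      using pspace_iso_trans assms(3) pspace_iso_sym[OF std_planar[OF assms(1)] assms(3)] by blast
  qed
  then show ?thesis unfolding num_walks_def by (intro sum.cong refl arg_cong[of _ _ of_bool]) blast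
qed

definition representative :: "nat pspace set \<Rightarrow> nat pspace" where
  "representative h = (SOME f. f \<in> h)"

lemma representative_singleton: "representative {f} = f"
  unfolding representative_def by (rule some_equality) simp_all

context finite_field4
begin

section \<open>Assembling the polynomials\<close>

definition real_count :: "nat pspace \<Rightarrow> nat" where
  "real_count f = (case f of (P, L, H) \<Rightarrow> nreal P L H)"

lemma real_count_iso: "planar_space f \<Longrightarrow> pspace_iso f g \<Longrightarrow> real_count f = real_count g"
  by (cases f, cases g) (simp add: real_count_def nreal_iso del: planar_space.simps pspace_iso.simps)

lemma real_count_empty: "real_count empty_space = 1"
proof -
  have "realizations ({} :: nat set) {} {{}} = {\<lambda>x. undefined}"
    by (auto simp: realizations_def inj_maps_def matches_def)
  then show ?thesis by (simp add: real_count_def empty_space_def nreal_def)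
qed

lemma num_realizations_empty: "num_realizations R empty_space = 0"
proof -
  obtain p where "p \<in> proj_points R"
    by (rule point_outside[of "{\<zero>\<^bsub>V4\<^esub>}" 0]) (auto simp: subspaces4_iff lin_def)
  then have "collin {p, p}" by (rule collin_pair) fact
  then obtain W where "W \<in> proj_lines R" by (auto simp: collin_def)
  then show ?thesis by (auto simp: num_realizations_def empty_space_def)
qed

lemma num_realizations_real_count:
  assumes "f \<in> std_hyperfigurations n" "f \<noteq> empty_space"
  shows "num_realizations R f = real_count f"
proof -
  obtain P L H where f: "f = (P, L, H)" by (cases f)
  have "planar_space (P, L, H)" "2 \<le> card P"
    using std_planar[OF assms(1)] std_small[OF assms(1)] assms(2) f by (simp_all del: planar_space.simps)
  then show ?thesis using num_realizations_eq f by (simp add: real_count_def del: planar_space.simps)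
qed

text \<open>Walks ending in the class of \<open>f\<close> are grouped by exponent, which validity
  bounds by \<open>3 * n\<close>; each group contributes its signed size as a coefficient.\<close>

lemma poly_class_poly:
  assumes f: "f \<in> std_hyperfigurations n"
  defines "W \<equiv> {w. w < state_bound n ^ Suc (num_steps n) \<and>
     start n (digit (state_bound n) w 0) \<and> walk (state_bound n) (num_steps n) w}"
  assumes v: "\<And>w. w \<in> W \<Longrightarrow> valid n (end_of n w)"
  shows "poly (class_poly n (pspace_code f)) q =
     (\<Sum>w\<in>{w \<in> W. pspace_iso (pspace_decode (space_of (end_of n w))) f}.
        (- 1) ^ sign_of (end_of n w) * q ^ expo_of (end_of n w))"
proof -
  let ?X = "{w \<in> W. pspace_iso (pspace_decode (space_of (end_of n w))) f}"
  let ?s = "\<lambda>w. sign_of (end_of n w)" and ?i = "\<lambda>w. expo_of (end_of n w)"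
  have finW: "finite W" by (simp add: W_def)
  have iso: "iso_code n (space_of (end_of n w)) (pspace_code f) \<longleftrightarrow> pspace_iso (pspace_decode (space_of (end_of n w))) f"
    if "w \<in> W" for w
  proof -
    have "pts (space_of (end_of n w)) \<subseteq> {..<n}" "planar_space (pspace_decode (space_of (end_of n w)))"
      using valid_pts valid_planar v[OF that] by blast+
    then show ?thesis using iso_code_iff[OF _ std_decode_code(2)[OF f]] std_decode_code(1)[OF f] by simp
  qed
  have nw: "num_walks n (pspace_code f) s i = card {w \<in> ?X. ?i w = i \<and> ?s w = s}" for s i
  proof -
    have "num_walks n (pspace_code f) s i = card ({..<state_bound n ^ Suc (num_steps n)} \<inter>
      {w. start n (digit (state_bound n) w 0) \<and> walk (state_bound n) (num_steps n) w \<and>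
       iso_code n (space_of (end_of n w)) (pspace_code f) \<and> ?s w = s \<and> ?i w = i})"
      unfolding num_walks_def by (simp add: of_bool_def sum.If_cases)
    also have "\<dots> = card {w \<in> W. iso_code n (space_of (end_of n w)) (pspace_code f) \<and> ?s w = s \<and> ?i w = i}"
      by (rule arg_cong[of _ _ card]) (auto simp: W_def)
    also have "\<dots> = card {w \<in> ?X. ?i w = i \<and> ?s w = s}"
      by (rule arg_cong[of _ _ card]) (use iso in blast)
    finally show ?thesis .
  qed
  have bnd: "?i w < Suc (3 * n)" "?s w \<le> 1" if "w \<in> ?X" for w using v[of w] that by (auto simp: valid_def)
  have "(\<Sum>w\<in>?X. (- 1) ^ ?s w * q ^ ?i w) =
      (\<Sum>i<Suc (3 * n). \<Sum>w\<in>{w \<in> ?X. ?i w = i}. (- 1) ^ ?s w * q ^ ?i w)"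
    by (rule sum.group[symmetric]) (use finW bnd in auto)
  also have "\<dots> = (\<Sum>i<Suc (3 * n). (int (num_walks n (pspace_code f) 0 i) - int (num_walks n (pspace_code f) 1 i)) * q ^ i)"
  proof (rule sum.cong[OF refl])
    fix i
    let ?Xi = "{w \<in> ?X. ?i w = i}"
    have finXi: "finite ?Xi" using finW by simp
    \<comment> \<open>The sign is written as a difference of two indicators, so that the sum becomes
      a difference of two cardinalities.\<close>
    have "(\<Sum>w\<in>?Xi. (- 1) ^ ?s w * q ^ ?i w) = (\<Sum>w\<in>?Xi. (of_bool (?s w = 0) - of_bool (?s w = 1)) * q ^ i)"
    proof (rule sum.cong[OF refl])
      fix w assume w: "w \<in> ?Xi"
      then have "?s w = 0 \<or> ?s w = 1" using bnd(2)[of w] by auto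
      then show "(- 1) ^ ?s w * q ^ ?i w = (of_bool (?s w = 0) - of_bool (?s w = 1)) * q ^ i" using w by auto
    qed
    also have "\<dots> = (int (card (?Xi \<inter> {w. ?s w = 0})) - int (card (?Xi \<inter> {w. ?s w = 1}))) * q ^ i"
      by (simp only: sum_distrib_right[symmetric] sum_subtractf of_bool_def sum.If_cases[OF finXi]) simp
    also have "\<dots> = (int (num_walks n (pspace_code f) 0 i) - int (num_walks n (pspace_code f) 1 i)) * q ^ i"
      unfolding nw by (simp add: Int_def conj_assoc)
    finally show "(\<Sum>w\<in>?Xi. (- 1) ^ ?s w * q ^ ?i w) =
      (int (num_walks n (pspace_code f) 0 i) - int (num_walks n (pspace_code f) 1 i)) * q ^ i" .
  qed
  also have "\<dots> = poly (class_poly n (pspace_code f)) q"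
    by (simp only: class_poly_def poly_sum poly_monom)
  finally show ?thesis by simp
qed

text \<open>All walks end in hyperfigurations, and grouping the ends by class makes the count a
  combination of realization numbers. Only for the empty space do the internal count and the number
  of strong realizations differ, being 1 and 0.\<close>

theorem num_arcs_expansion:
  "int (num_arcs R n) =
     poly (class_poly n (pspace_code empty_space)) (int (card (carrier R))) +
     (\<Sum>h\<in>hyperfiguration_classes n.
        poly (class_poly n (pspace_code (representative h))) (int (card (carrier R))) * int (class_realizations R h))"
proof -
  let ?q = "int (card (carrier R))" and ?S = "std_hyperfigurations n" and ?r = "iso_rel n"
  let ?p = "\<lambda>h. poly (class_poly n (pspace_code (representative h))) ?q"
  define W where "W = {w. w < state_bound n ^ Suc (num_steps n) \<and>
     start n (digit (state_bound n) w 0) \<and> walk (state_bound n) (num_steps n) w}"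
  let ?f = "\<lambda>w. pspace_decode (space_of (end_of n w))"
  have classes: "hyperfiguration_classes n = ?S // ?r" by (simp add: hyperfiguration_classes_def iso_rel_def)
  have finW: "finite W" by (simp add: W_def)
  have vW: "valid n (end_of n w)" and tW: "terminal (space_of (end_of n w))" if w: "w \<in> W" for w
  proof -
    have s: "start n (digit (state_bound n) w 0)" and wk: "walk (state_bound n) (num_steps n) w"
      using w by (simp_all add: W_def)
    have v: "valid n (digit (state_bound n) w 0)" by (rule start_valid[OF s])
    show "valid n (end_of n w)" unfolding end_of_def by (rule walk_valid[OF v wk]) simp
    show "terminal (space_of (end_of n w))" unfolding end_of_def by (rule walk_terminal[OF v wk])
  qed
  have fS: "?f w \<in> ?S" if w: "w \<in> W" for w
  proof -
    obtain m where "m \<le> n" "pts (space_of (end_of n w)) = {..<m}" using vW[OF w] by (auto simp: valid_def)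
    moreover have "planar_space (?f w)" using vW[OF w] by (simp add: valid_def del: planar_space.simps)
    ultimately show ?thesis using std_iff_terminal tW[OF w] by blast
  qed
  have fin: "finite (?S // ?r)"
    by (rule finite_quotient[OF finite_std_hyperfigurations]) (auto simp: iso_rel_def)
  have rep: "representative h \<in> h" "representative h \<in> ?S" "h = ?r `` {representative h}" if h: "h \<in> ?S // ?r" for h
  proof -
    obtain g where g: "g \<in> ?S" "h = ?r `` {g}" using h by (auto simp: quotient_def)
    then have "g \<in> h" using equiv_class_self[OF equiv_iso_rel] by blast
    then show 1: "representative h \<in> h" unfolding representative_def by (rule someI)
    then have gr: "(g, representative h) \<in> ?r" using g by blast
    then show "representative h \<in> ?S" by (simp add: iso_rel_def)
    show "h = ?r `` {representative h}" using equiv_class_eq[OF equiv_iso_rel gr] g by simp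
  qed
  have "int (num_arcs R n) = (\<Sum>w\<in>W. val (end_of n w))"
    unfolding W_def by (rule num_arcs_walks)
  also have "\<dots> = (\<Sum>h\<in>?S // ?r. \<Sum>w\<in>{w \<in> W. ?r `` {?f w} = h}. val (end_of n w))"
    by (rule sum.group[symmetric]) (use finW fin fS in \<open>auto intro: quotientI\<close>)
  also have "\<dots> = (\<Sum>h\<in>?S // ?r. ?p h * int (real_count (representative h)))"
  proof (rule sum.cong[OF refl])
    fix h assume h: "h \<in> ?S // ?r"
    let ?g = "representative h"
    have iso: "?r `` {?f w} = h \<longleftrightarrow> pspace_iso (?f w) ?g" if w: "w \<in> W" for w
    proof -
      have "?r `` {?f w} = ?r `` {?g} \<longleftrightarrow> (?f w, ?g) \<in> ?r"
        using eq_equiv_class_iff[OF equiv_iso_rel fS[OF w] rep(2)[OF h]] .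
      then show ?thesis using rep(2,3)[OF h] fS[OF w] by (simp add: iso_rel_def del: pspace_iso.simps)
    qed
    have set: "{w \<in> W. ?r `` {?f w} = h} = {w \<in> W. pspace_iso (?f w) ?g}" using iso by blast
    have "(\<Sum>w\<in>{w \<in> W. ?r `` {?f w} = h}. val (end_of n w)) =
        (\<Sum>w\<in>{w \<in> W. pspace_iso (?f w) ?g}. (- 1) ^ sign_of (end_of n w) * ?q ^ expo_of (end_of n w) * int (real_count ?g))"
      unfolding set
    proof (rule sum.cong[OF refl])
      fix w assume w: "w \<in> {w \<in> W. pspace_iso (?f w) ?g}"
      then have "real_count (?f w) = real_count ?g"
        using real_count_iso std_planar[OF fS] by blast
      then show "val (end_of n w) = (- 1) ^ sign_of (end_of n w) * ?q ^ expo_of (end_of n w) * int (real_count ?g)"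
        by (simp add: val_def real_count_def split_def)
    qed
    also have "\<dots> = ?p h * int (real_count ?g)"
      unfolding sum_distrib_right[symmetric]
      using poly_class_poly[OF rep(2)[OF h], folded W_def, OF vW, of ?q] by simp
    finally show "(\<Sum>w\<in>{w \<in> W. ?r `` {?f w} = h}. val (end_of n w)) = ?p h * int (real_count ?g)" .
  qed
  \<comment> \<open>The summand of the empty space is split off; with internal count 1 it becomes
    the constant polynomial.\<close>
  also have "\<dots> = ?p {empty_space} * int (real_count empty_space) +
      (\<Sum>h\<in>?S // ?r - {{empty_space}}. ?p h * int (real_count (representative h)))"
  proof -
    have "{empty_space} \<in> ?S // ?r"
      using quotientI[OF empty_space_std, of ?r n] empty_space_class by simp
    from sum.remove[OF fin this, of "\<lambda>h. ?p h * int (real_count (representative h))"] show ?thesis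
      by (simp only: representative_singleton)
  qed
  also have "(\<Sum>h\<in>?S // ?r - {{empty_space}}. ?p h * int (real_count (representative h))) =
      (\<Sum>h\<in>?S // ?r - {{empty_space}}. ?p h * int (class_realizations R h))"
  proof (rule sum.cong[OF refl])
    fix h assume h: "h \<in> ?S // ?r - {{empty_space}}"
    let ?g = "representative h"
    note hr = rep[of h]
    have "num_realizations R g = real_count ?g" if g: "g \<in> h" for g
    proof -
      have gS: "g \<in> ?S" and iso: "pspace_iso ?g g" using hr(3) h g by (auto simp: iso_rel_def)
      have "g \<noteq> empty_space"
      proof
        assume "g = empty_space"
        then have "(?g, empty_space) \<in> ?r" using gS iso hr(2) h by (simp add: iso_rel_def)
        then have "?r `` {?g} = ?r `` {empty_space}" by (rule equiv_class_eq[OF equiv_iso_rel])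
        then show False using hr(3) h empty_space_class by auto
      qed
      then have "num_realizations R g = real_count g" by (rule num_realizations_real_count[OF gS])
      then show ?thesis using real_count_iso[OF std_planar iso] hr(2) h by simp
    qed
    then have "num_realizations R ` h = {real_count ?g}" using hr(1) h by auto
    then show "?p h * int (real_count ?g) = ?p h * int (class_realizations R h)"
      by (simp add: class_realizations_def)
  qed
  \<comment> \<open>The class of the empty space returns to the sum, now with 0 strong realizations,
    so that all classes are covered.\<close>
  also have "\<dots> = (\<Sum>h\<in>?S // ?r. ?p h * int (class_realizations R h))"
  proof -
    have e: "{empty_space} \<in> ?S // ?r"
      using quotientI[OF empty_space_std, of ?r n] empty_space_class by simp
    have "class_realizations R {empty_space} = 0"
      by (simp add: class_realizations_def num_realizations_empty)
    then show ?thesis using sum.remove[OF fin e, of "\<lambda>h. ?p h * int (class_realizations R h)"] by simp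
  qed
  finally show ?thesis unfolding classes by (simp add: real_count_empty representative_singleton)
qed

end

theorem theorem1p13:
  shows "\<exists>(p :: nat \<Rightarrow> int poly) (p_h :: nat \<Rightarrow> nat pspace set \<Rightarrow> int poly).
    (\<forall>n\<ge>4. \<forall>(q :: nat) (R :: nat ring).
       primepow q \<and> field R \<and> finite (carrier R) \<and> card (carrier R) = q \<longrightarrow>
         int (num_arcs R n) =
           poly (p n) (int q) +
           (\<Sum>h\<in>hyperfiguration_classes n.
              poly (p_h n h) (int q) * int (class_realizations R h))) \<and>
    (\<exists>F. total_recursive 1 F \<and> (\<forall>n\<ge>4. F [n] = poly_code (p n))) \<and>
    (\<exists>G. total_recursive 2 G \<and>
       (\<forall>n\<ge>4. \<forall>h\<in>hyperfiguration_classes n. \<forall>f\<in>h.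
          G [n, pspace_code f] = poly_code (p_h n h)))"
proof (intro exI conjI allI impI)
  fix n q :: nat and R :: "nat ring"
  assume R: "primepow q \<and> field R \<and> finite (carrier R) \<and> card (carrier R) = q"
  then have "finite_field4 R" by (simp add: finite_field4_def finite_field4_axioms_def)
  from finite_field4.num_arcs_expansion[OF this, of n] R
  show "int (num_arcs R n) = poly (class_poly n (pspace_code empty_space)) (int q) +
     (\<Sum>h\<in>hyperfiguration_classes n.
        poly (class_poly n (pspace_code (representative h))) (int q) * int (class_realizations R h))" by simp
next
  \<comment> \<open>The code of the empty space is a fixed number, so \<open>n\<close> is the only
    input.\<close>
  show "total_recursive 1 (\<lambda>xs. poly_code (class_poly (hd xs) (pspace_code empty_space)))"
    by (intro rec_class_poly rec_intros) simp
  show "poly_code (class_poly (hd [n]) (pspace_code empty_space)) =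
      poly_code (class_poly n (pspace_code empty_space))" for n by simp
  show "total_recursive 2 (\<lambda>xs. poly_code (class_poly (hd xs) (hd (tl xs))))"
    by (intro rec_class_poly rec_intros) simp_all
  \<comment> \<open>The algorithm evaluates the polynomial at whichever member of the class it is
    given, while the theorem uses a chosen representative; \<open>num_walks_cong\<close> reconciles
    the two.\<close>
  show "\<forall>h\<in>hyperfiguration_classes n. \<forall>f\<in>h. poly_code (class_poly (hd [n, pspace_code f]) (hd (tl [n, pspace_code f]))) =
      poly_code (class_poly n (pspace_code (representative h)))" for n
  proof (intro ballI)
    fix h f assume h: "h \<in> hyperfiguration_classes n" and f: "f \<in> h"
    then have hq: "h \<in> std_hyperfigurations n // iso_rel n"
      by (simp add: hyperfiguration_classes_def iso_rel_def)
    have "representative h \<in> h" unfolding representative_def using f by (rule someI)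
    then have "(f, representative h) \<in> iso_rel n"
      using quotient_eq_iff[OF equiv_iso_rel hq hq f] by blast
    then have "num_walks n (pspace_code f) s i = num_walks n (pspace_code (representative h)) s i" for s i
      by (intro num_walks_cong) (simp_all add: iso_rel_def)
    then show "poly_code (class_poly (hd [n, pspace_code f]) (hd (tl [n, pspace_code f]))) =
      poly_code (class_poly n (pspace_code (representative h)))"
      by (simp add: class_poly_def)
  qed
qed

end
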